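(* Let $\mathcal{N}^-(5^2;X)$ denote the number of imaginary quadratic number fields $k$ with $|d_k|\leq X$ and $\operatorname{rk}_5 \operatorname{Cl}(k)\geq 2$. Then \[ \mathcal{N}^-(5^2;X)\gg \frac{X^{1/3}}{(\log X)^2}. \]
   Context: For a finitely generated abelian group $A$ and integer $m>1$, $\operatorname{rk}_m A$ is the largest integer $r$ such that $A$ has a subgroup isomorphic to $(\mathbb{Z}/m\mathbb{Z})^r$. For a number field $k$, $\operatorname{Cl}(k)$ denotes its ideal class group and $d_k$ its absolute discriminant. The notation $f\gg g$ means $f\geq c\,g$ for some constant $c>0$ and all sufficiently large $X$. *)

theory Defs
  imports
    Complex_Main
    "HOL-Computational_Algebra.Polynomial"
    "HOL-Algebra.Algebraic_Closure_Type"
    "HOL-Algebra.Embedded_Algebras"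
    "HOL-Algebra.Ideal_Product"
    "HOL-Algebra.Elementary_Groups"
    "HOL-Algebra.Product_Groups"
    "Jordan_Normal_Form.Determinant"
begin

text \<open>Number fields are represented as subfields of the complex numbers.\<close>

abbreviation complex_ring :: "complex ring" where
  "complex_ring \<equiv> ring_of_type_algebra"

definition number_field_of_degree :: "nat \<Rightarrow> complex set \<Rightarrow> bool" where
  "number_field_of_degree n K \<longleftrightarrow>
     subfield K complex_ring \<and> ring.dimension complex_ring n \<rat> K"

text \<open>A quadratic subfield of the complex numbers is Galois over the rationals, hence it is the only
  subfield in its isomorphism class, and all its embeddings have the same image. So counting
  such subfields is counting isomorphism classes, and a quadratic field is imaginary (has no real
  embedding) iff it is not contained in the reals.\<close>

definition imaginary_quadratic_field :: "complex set \<Rightarrow> bool" where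
  "imaginary_quadratic_field K \<longleftrightarrow> number_field_of_degree 2 K \<and> \<not> K \<subseteq> \<real>"

definition integers_of :: "complex set \<Rightarrow> complex set" where
  "integers_of K = {x \<in> K. algebraic_int x}"

abbreviation ring_of_integers :: "complex set \<Rightarrow> complex ring" where
  "ring_of_integers K \<equiv> complex_ring\<lparr>carrier := integers_of K\<rparr>"

definition field_embeddings :: "complex set \<Rightarrow> (complex \<Rightarrow> complex) set" where
  "field_embeddings K = Ring.ring_hom (complex_ring\<lparr>carrier := K\<rparr>) complex_ring \<inter> extensional K"

definition integral_basis :: "complex set \<Rightarrow> complex list \<Rightarrow> bool" where
  "integral_basis K ws \<longleftrightarrow>
     set ws \<subseteq> integers_of K \<and>
     (\<forall>x \<in> integers_of K. \<exists>!cs :: int list.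
        length cs = length ws \<and> x = (\<Sum>i<length ws. of_int (cs ! i) * ws ! i))"

text \<open>The discriminant is the squared determinant of the matrix of conjugates of an integral basis;
  it depends neither on the basis nor on the order of the embeddings.\<close>

definition field_discriminant :: "complex set \<Rightarrow> int" where
  "field_discriminant K =
     (THE d. \<exists>ws \<sigma>s. integral_basis K ws \<and>
        distinct \<sigma>s \<and> set \<sigma>s = field_embeddings K \<and> length \<sigma>s = length ws \<and>
        of_int d = (det (mat (length ws) (length ws) (\<lambda>(i, j). (\<sigma>s ! i) (ws ! j))))\<^sup>2)"

definition fractional_ideal :: "complex set \<Rightarrow> complex set \<Rightarrow> bool" where
  "fractional_ideal K I \<longleftrightarrow>
     I \<subseteq> K \<and> I \<noteq> {0} \<and>
     (\<exists>d \<in> integers_of K - {0}. ideal ((*) d ` I) (ring_of_integers K))"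

text \<open>The product below consists of the finite sums of products of elements of the two factors.\<close>

definition fractional_ideal_group :: "complex set \<Rightarrow> complex set monoid" where
  "fractional_ideal_group K =
     \<lparr>carrier = {I. fractional_ideal K I},
      monoid.mult = ideal_prod complex_ring,
      one = integers_of K\<rparr>"

definition principal_fractional_ideals :: "complex set \<Rightarrow> complex set set" where
  "principal_fractional_ideals K = {(*) x ` integers_of K | x. x \<in> K - {0}}"

definition class_group :: "complex set \<Rightarrow> complex set set monoid" where
  "class_group K = fractional_ideal_group K Mod principal_fractional_ideals K"

definition rk :: "nat \<Rightarrow> ('a, 'b) monoid_scheme \<Rightarrow> nat" where
  "rk m A = (GREATEST r. \<exists>H. subgroup H A \<and>
     A\<lparr>carrier := H\<rparr> \<cong> product_group {..<r} (\<lambda>_. integer_mod_group m))"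

text \<open>The number of imaginary quadratic fields with absolute value of the discriminant at most
  \<open>x\<close> and with class group of \<open>m\<close>-rank at least \<open>r\<close>.\<close>

definition N_minus :: "nat \<Rightarrow> nat \<Rightarrow> real \<Rightarrow> nat" where
  "N_minus m r x =
     card {K. imaginary_quadratic_field K \<and> real_of_int (abs (field_discriminant K)) \<le> x \<and>
              rk m (class_group K) \<ge> r}"

end

theory Submission
  imports
    Defs
    "HOL-Number_Theory.Number_Theory"
    "HOL-Computational_Algebra.Squarefree"
    "HOL-Analysis.Kronecker_Approximation_Theorem"
    "HOL-Real_Asymp.Real_Asymp"
begin

text \<open>
  An elliptic curve with a rational point of order ten yields a binary sextic form \<open>F\<close>, symmetric
  in its variables, and an identity \<open>a\<^sup>2 + c\<^sup>2 F = Q\<^sup>5\<close> of forms; exchanging the variables gives a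
  second one. At suitable integers \<open>u, v\<close> the two identities produce elements of
  \<open>\<int>[sqrt (- F(u, v))]\<close> whose principal ideals are fifth powers, and congruence conditions modulo
  \<open>11\<close> and \<open>31\<close> keep all products of these elements, other than the trivial one, from being
  fifth powers up to a unit. As the only units are \<open>1\<close> and \<open>- 1\<close>, the class group has \<open>5\<close>-rank at
  least two.

  The discriminant is at most a multiple of \<open>T\<^sup>6\<close> when \<open>u, v\<close> are of size \<open>T\<close>, so it remains to
  see that the values \<open>F(u, v)\<close> take a positive proportion of \<open>T\<^sup>2\<close> many values modulo squares. For
  most pairs no prime \<open>p > y = T\<^bsup>1/J\<^esup>\<close> has a square dividing \<open>F(u, v)\<close> (the form is a product of
  a quadratic and a quartic form), and the part of \<open>F(u, v)\<close> composed of primes up to \<open>y\<close> is at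
  most \<open>T\<^sup>2\<close>. For such a pair the class modulo squares determines boundedly many primes with
  product larger than \<open>3T\<^sup>2\<close>, and these, together with the ratio \<open>u/v\<close> modulo each of them,
  determine \<open>(u, v)\<close>.
\<close>

section \<open>Elementary prime estimates\<close>

text \<open>The rational point of order two does two jobs. It makes the cubic reducible, which is
  why the sextic splits into a quadratic and a quartic factor. It also gives the Moebius involution
  of the x-line that fixes this point and exchanges the other two roots of the cubic, which becomes
  the exchange of \<open>u\<close> and \<open>v\<close>. The obstacle to counting is that many pairs
  could give the same field. Bounding the fibres of the map to squarefree parts requires less than
  squarefree values: squares of small primes may divide \<open>F(u, v)\<close>, as long as the small
  primes take up only a bounded power of \<open>T\<close>. Squares of large primes are handled
  through the degree: if the square of a prime \<open>p > 4T\<close> divides a value, it divides the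
  quartic factor, so \<open>p\<close> is at most \<open>7T^2\<close>, and such primes number
  \<open>o(T^2)\<close> by Chebyshev, each spoiling at most six points. The count reached is of
  order \<open>X^(1/3)\<close>; the logarithm in the statement is given away at the end.\<close>

lemma finite_primes_le: "finite {p::nat. prime p \<and> p \<le> n}"
  by (rule finite_subset[of _ "{..n}"]) auto

lemma prod_coprime_dvd:
  fixes f :: "'a \<Rightarrow> 'b :: semiring_gcd"
  assumes "finite S" "\<And>x. x \<in> S \<Longrightarrow> f x dvd n"
    and "\<And>x y. x \<in> S \<Longrightarrow> y \<in> S \<Longrightarrow> x \<noteq> y \<Longrightarrow> coprime (f x) (f y)"
  shows "prod f S dvd n"
  using assms
proof (induction S rule: finite_induct)
  case (insert x S)
  have "coprime (f x) (prod f S)" using insert by (intro prod_coprime_right) auto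
  moreover have "prod f S dvd n" "f x dvd n" using insert by auto
  ultimately show ?case using insert by (simp add: divides_mult)
qed simp

text \<open>Each such prime divides the numerator \<open>(2m + 1)!\<close> but is too large to
  divide either factorial in the denominator.\<close>

lemma prod_primes_dvd_binomial:
  "\<Prod>{p. prime p \<and> Suc m < p \<and> p \<le> 2 * m + 1} dvd ((2 * m + 1) choose m)"
proof -
  let ?S = "{p::nat. prime p \<and> Suc m < p \<and> p \<le> 2 * m + 1}"
  have "p dvd ((2 * m + 1) choose m)" if p: "p \<in> ?S" for p
  proof -
    have "fact m * fact (Suc m) * ((2 * m + 1) choose m) = (fact (2 * m + 1) :: nat)"
      using binomial_fact_lemma[of m "2 * m + 1"] by simp
    moreover have "p dvd fact (2 * m + 1)" using p by (simp add: prime_dvd_fact_iff del: fact_Suc)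
    moreover have "\<not> p dvd fact m" "\<not> p dvd fact (Suc m)"
      using p by (auto simp: prime_dvd_fact_iff simp del: fact_Suc)
    ultimately show ?thesis using p by (metis (no_types, lifting) mem_Collect_eq prime_dvd_mult_iff)
  qed
  then have "(\<Prod>p\<in>?S. p) dvd ((2 * m + 1) choose m)"
    by (intro prod_coprime_dvd) (auto intro: primes_coprime finite_subset[OF _ finite_primes_le[of "2 * m + 1"]])
  then show ?thesis by simp
qed

text \<open>Erdos's induction: an even \<open>n > 2\<close> adds no prime, and for
  \<open>n = 2m + 1\<close> the primes above \<open>m + 1\<close> divide a binomial coefficient of
  size at most \<open>4^m\<close>.\<close>

lemma primorial_le: "\<Prod>{p::nat. prime p \<and> p \<le> n} \<le> 4 ^ n"
proof (induction n rule: less_induct)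
  case (less n)
  show ?case
  proof (cases "n \<le> 2")
    case True
    have "{p::nat. prime p \<and> p \<le> n} \<subseteq> {2}" using True by (auto dest: prime_ge_2_nat)
    then consider "{p::nat. prime p \<and> p \<le> n} = {}" | "{p::nat. prime p \<and> p \<le> n} = {2}" by blast
    then show ?thesis
    proof cases
      case 2
      then have "2 \<in> {p::nat. prime p \<and> p \<le> n}" by simp
      then have "n = 2" using True by simp
      then show ?thesis unfolding 2 by simp
    qed (simp only: prod.empty one_le_power one_le_numeral)
  next
    case n2: False
    show ?thesis
    proof (cases "even n")
      case True
      then have "\<not> prime n" using n2 prime_odd_nat by auto
      then have "prime p \<and> p \<le> n \<longleftrightarrow> prime p \<and> p \<le> n - 1" for p
        by (cases "p = n") auto
      then have "{p. prime p \<and> p \<le> n} = {p. prime p \<and> p \<le> n - 1}" by simp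
      then have "\<Prod>{p. prime p \<and> p \<le> n} \<le> 4 ^ (n - 1)" using less[of "n - 1"] n2 by simp
      also have "\<dots> \<le> 4 ^ n" by (rule power_increasing) auto
      finally show ?thesis .
    next
      case False
      then obtain m where m: "n = 2 * m + 1" by (elim oddE)
      let ?B = "{p::nat. prime p \<and> p \<le> Suc m}" and ?C = "{p::nat. prime p \<and> Suc m < p \<and> p \<le> n}"
      have "{p. prime p \<and> p \<le> n} = ?B \<union> ?C" using m by auto
      then have "\<Prod>{p. prime p \<and> p \<le> n} = \<Prod>?B * \<Prod>?C"
        using finite_primes_le[of "Suc m"] finite_subset[OF _ finite_primes_le[of n], of ?C]
        by (subst prod.union_disjoint[symmetric]) auto
      also have "\<dots> \<le> 4 ^ Suc m * 4 ^ m"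
      proof (rule mult_mono)
        show "\<Prod>?B \<le> 4 ^ Suc m" using less[of "Suc m"] n2 m by simp
        \<comment> \<open>The coefficient occurs twice in its row, whose sum is
          \<open>2 * 4^m\<close>.\<close>
        have "2 * ((2 * m + 1) choose m) = ((2 * m + 1) choose m) + ((2 * m + 1) choose (m + 1))"
          using binomial_symmetric[of m "2 * m + 1"] by simp
        also have "\<dots> = (\<Sum>k\<in>{m, m + 1}. (2 * m + 1) choose k)" by simp
        also have "\<dots> \<le> (\<Sum>k\<le>2 * m + 1. (2 * m + 1) choose k)" by (rule sum_mono2) auto
        also have "\<dots> = 2 ^ (2 * m + 1)" by (rule choose_row_sum)
        finally have "(2 * m + 1) choose m \<le> 4 ^ m" by (simp add: power_mult)
        moreover have "\<Prod>?C \<le> (2 * m + 1) choose m"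
          using prod_primes_dvd_binomial[of m] m by (intro dvd_imp_le) auto
        ultimately show "\<Prod>?C \<le> 4 ^ m" by linarith
      qed auto
      also have "\<dots> = 4 ^ n" using m by (simp add: power_add[symmetric] mult_2)
      finally show ?thesis .
    qed
  qed
qed

text \<open>The primes in \<open>(sqrt n, n]\<close> are each at least \<open>sqrt n\<close> and
  have product at most \<open>4^n\<close>, so their number is at most \<open>n ln 4\<close> divided
  by \<open>ln n / 2\<close>; the smaller ones are counted trivially.\<close>

lemma card_primes_le:
  assumes "n \<ge> 2"
  shows "real (card {p::nat. prime p \<and> p \<le> n}) \<le> sqrt n + 2 * ln 4 * n / ln n"
proof -
  let ?A = "{p::nat. prime p \<and> real p \<le> sqrt n}" and ?B = "{p::nat. prime p \<and> sqrt n < real p \<and> p \<le> n}"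
  have fin: "finite ?B" by (rule finite_subset[OF _ finite_primes_le[of n]]) auto
  have A: "real (card ?A) \<le> sqrt n"
  proof -
    have "?A \<subseteq> {1..nat \<lfloor>sqrt n\<rfloor>}" by (auto simp: le_nat_floor dest: prime_gt_0_nat)
    then have "card ?A \<le> card {1..nat \<lfloor>sqrt n\<rfloor>}" by (intro card_mono) auto
    also have "real \<dots> \<le> sqrt n" by (simp add: of_nat_floor)
    finally show ?thesis by simp
  qed
  have "sqrt n ^ card ?B = (\<Prod>p\<in>?B. sqrt n)" by simp
  also have "\<dots> \<le> (\<Prod>p\<in>?B. real p)" by (rule prod_mono) auto
  also have "\<dots> = real (\<Prod>?B)" by simp
  also have "\<dots> \<le> real (\<Prod>{p::nat. prime p \<and> p \<le> n})"
    unfolding of_nat_le_iff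
    by (intro dvd_imp_le prod_dvd_prod_subset finite_primes_le prod_pos) (auto intro!: prod_pos dest: prime_gt_0_nat)
  also have "\<dots> \<le> real (4 ^ n)" unfolding of_nat_le_iff by (rule primorial_le)
  finally have "ln (sqrt n ^ card ?B) \<le> ln (4 ^ n)" using assms by simp
  then have "real (card ?B) * (ln n / 2) \<le> n * ln 4"
    using assms by (simp add: ln_realpow ln_sqrt)
  moreover have "ln (real n) > 0" using assms by simp
  ultimately have B: "real (card ?B) \<le> 2 * ln 4 * n / ln n" by (simp add: field_simps)
  have "{p::nat. prime p \<and> p \<le> n} \<subseteq> ?A \<union> ?B" by auto
  moreover have "finite ?A"
    by (rule finite_subset[of _ "{..nat \<lfloor>sqrt n\<rfloor>}"]) (auto simp: le_nat_floor)
  ultimately have "card {p::nat. prime p \<and> p \<le> n} \<le> card (?A \<union> ?B)"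
    using fin by (intro card_mono) auto
  also have "\<dots> \<le> card ?A + card ?B" by (rule card_Un_le)
  finally show ?thesis using A B by linarith
qed

lemma card_primes_smallo:
  fixes \<epsilon> :: real
  assumes "\<epsilon> > 0"
  shows "eventually (\<lambda>n. real (card {p::nat. prime p \<and> p \<le> n}) \<le> \<epsilon> * n) sequentially"
proof -
  have "eventually (\<lambda>n::nat. sqrt n + 2 * ln 4 * n / ln n \<le> \<epsilon> * n) sequentially"
    using assms by real_asymp
  moreover have "eventually (\<lambda>n::nat. n \<ge> 2) sequentially" by (rule eventually_ge_at_top)
  ultimately show ?thesis
  proof eventually_elim
    case (elim n)
    then show ?case using card_primes_le[of n] by linarith
  qed
qed

text \<open>Passing from \<open>n\<close> to \<open>n - p\<close> removes a multiple of
  \<open>p!\<close> from the factorial, so every full block of \<open>p\<close> factors contributes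
  one \<open>p\<close>.\<close>

lemma prime_power_dvd_fact: "prime p \<Longrightarrow> p ^ (n div p) dvd (fact n :: nat)"
proof (induction n rule: less_induct)
  case (less n)
  have p0: "p > 0" using less.prems by (simp add: prime_gt_0_nat)
  show ?case
  proof (cases "n < p")
    case False
    have "p ^ ((n - p) div p) dvd (fact (n - p) :: nat)" using False less p0 by simp
    moreover have "p * fact (n - p) dvd (fact n :: nat)"
    proof -
      have "(n choose p) * fact p * fact (n - p) = (fact n :: nat)"
        using binomial_fact_lemma[of p n] False by (simp add: mult_ac)
      moreover have "p dvd (n choose p) * fact p" using p0 by (simp add: dvd_fact)
      ultimately show ?thesis by (metis mult_dvd_mono dvd_refl)
    qed
    ultimately have "p * p ^ ((n - p) div p) dvd (fact n :: nat)"
      by (meson dvd_refl dvd_trans mult_dvd_mono)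
    moreover have "n div p = Suc ((n - p) div p)" using False p0 by (simp add: le_div_geq)
    ultimately show ?thesis by simp
  qed auto
qed

text \<open>The upper half of Mertens' first theorem. The product of the
  \<open>p ^ (n div p)\<close> divides \<open>n!\<close>, which is at most \<open>n^n\<close>; take
  logarithms. The constant 2 comes from \<open>n div p \<ge> n / (2p)\<close>.\<close>

lemma sum_ln_prime_over_prime_le:
  fixes n :: nat
  assumes "n \<ge> 1"
  shows "(\<Sum>p | prime p \<and> p \<le> n. ln (real p) / real p) \<le> 2 * ln n"
proof -
  let ?S = "{p::nat. prime p \<and> p \<le> n}"
  have pos: "p > 0" if "p \<in> ?S" for p using that by (auto dest: prime_gt_0_nat)
  have "(\<Prod>p\<in>?S. p ^ (n div p)) dvd (fact n :: nat)"
    by (intro prod_coprime_dvd finite_primes_le) (auto intro: prime_power_dvd_fact primes_coprime)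
  then have "(\<Prod>p\<in>?S. p ^ (n div p)) \<le> (fact n :: nat)" by (intro dvd_imp_le) auto
  also have "\<dots> \<le> n ^ n" using fact_le_power[of n, where 'a = nat] by simp
  finally have "real (\<Prod>p\<in>?S. p ^ (n div p)) \<le> real (n ^ n)" by (rule of_nat_mono)
  then have "(\<Prod>p\<in>?S. real p ^ (n div p)) \<le> real n ^ n" by simp
  moreover have "(\<Prod>p\<in>?S. real p ^ (n div p)) > 0"
    using pos by (intro prod_pos) auto
  ultimately have "ln (\<Prod>p\<in>?S. real p ^ (n div p)) \<le> ln (real n ^ n)" using assms by simp
  moreover have "ln (\<Prod>p\<in>?S. real p ^ (n div p)) = (\<Sum>p\<in>?S. (n div p) * ln p)"
  proof (subst ln_prod)
    show "(\<Sum>p\<in>?S. ln (real p ^ (n div p))) = (\<Sum>p\<in>?S. real (n div p) * ln (real p))"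
      by (rule sum.cong) (auto simp: ln_realpow dest: prime_gt_0_nat)
  qed (use pos finite_primes_le in auto)
  moreover have "ln (real n ^ n) = n * ln n" using assms by (simp add: ln_realpow)
  ultimately have *: "(\<Sum>p\<in>?S. (n div p) * ln p) \<le> n * ln n" by simp
  have "n / 2 * (\<Sum>p\<in>?S. ln p / p) = (\<Sum>p\<in>?S. n / (2 * p) * ln p)"
    by (subst sum_distrib_left) (rule sum.cong, auto)
  also have "\<dots> \<le> (\<Sum>p\<in>?S. (n div p) * ln p)"
  proof (rule sum_mono)
    fix p assume p: "p \<in> ?S"
    then have "n div p \<ge> 1" using pos[OF p] by (auto simp: Suc_le_eq div_greater_zero_iff)
    then have "p * 1 \<le> p * (n div p)" by (rule mult_le_mono2)
    moreover have "n < p * (n div p) + p" using pos[OF p] by (metis add.commute mult.commute mod_less_divisor nat_add_left_cancel_less mult_div_mod_eq)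
    ultimately have "n \<le> 2 * p * (n div p)" by linarith
    then have "real n \<le> 2 * p * (n div p)" by (metis of_nat_le_iff of_nat_mult of_nat_numeral)
    then have "n / (2 * p) \<le> n div p" using pos[OF p] by (simp add: divide_le_eq mult.commute mult.left_commute)
    then show "n / (2 * p) * ln p \<le> (n div p) * ln p"
      using pos[OF p] by (intro mult_right_mono) auto
  qed
  also note *
  finally have "real n / 2 * (\<Sum>p\<in>?S. ln p / p) \<le> real n / 2 * (2 * ln n)" by simp
  then show ?thesis using assms by (simp only: mult_le_cancel_left_pos)
qed

lemma sum_inverse_squares_le:
  fixes m n :: nat
  assumes "m \<ge> 1"
  shows "(\<Sum>k\<in>{m<..n}. 1 / (real k)\<^sup>2) \<le> 1 / m"
proof -
  have "(\<Sum>k\<in>{m<..n}. 1 / (real k)\<^sup>2) \<le> 1 / m - 1 / n" if "n \<ge> m" using that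
  proof (induction n rule: dec_induct)
    case (step n)
    have "{m<..Suc n} = insert (Suc n) {m<..n}" using step by auto
    then have "(\<Sum>k\<in>{m<..Suc n}. 1 / (real k)\<^sup>2) = 1 / (real (Suc n))\<^sup>2 + (\<Sum>k\<in>{m<..n}. 1 / (real k)\<^sup>2)"
      by simp
    also have "\<dots> \<le> 1 / (real (Suc n))\<^sup>2 + (1 / m - 1 / n)" using step by simp
    also have "1 / (real (Suc n))\<^sup>2 \<le> 1 / (real n * real (Suc n))"
      using step assms by (intro frac_le) (auto simp: power2_eq_square)
    also have "1 / (real n * real (Suc n)) = 1 / n - 1 / Suc n"
      using step assms by (simp add: field_simps)
    finally show ?case by simp
  qed simp
  then show ?thesis by (cases "n \<ge> m") (auto intro: order_trans)
qed

lemma card_residue_class_interval: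
  fixes a L q c :: int
  assumes "q > 0" "L \<ge> 0"
  shows "real (card {u \<in> {a<..a + L}. q dvd u - c}) \<le> L / q + 1"
    and "real (card {u \<in> {a<..a + L}. q dvd u - c}) \<ge> L / q - 1"
proof -
  define f where "f = \<lfloor>real_of_int (a + L - c) / q\<rfloor>"
  define g where "g = \<lfloor>real_of_int (a - c) / q\<rfloor>"
  have q: "real_of_int q > 0" using assms by simp
  have "{u \<in> {a<..a + L}. q dvd u - c} = (\<lambda>k. c + q * k) ` {g<..f}" (is "?A = ?B")
  proof -
    have iff: "c + q * k \<in> {a<..a + L} \<longleftrightarrow> k \<in> {g<..f}" for k
    proof -
      have "a < c + q * k \<longleftrightarrow> real_of_int (a - c) / q < k"
        unfolding pos_divide_less_eq[OF q] by (simp flip: of_int_mult of_int_diff add: algebra_simps)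
      moreover have "c + q * k \<le> a + L \<longleftrightarrow> k \<le> real_of_int (a + L - c) / q"
        unfolding pos_le_divide_eq[OF q] by (simp flip: of_int_mult of_int_diff add: algebra_simps)
      ultimately show ?thesis by (auto simp: f_def g_def floor_less_iff le_floor_iff)
    qed
    show ?thesis
    proof
      show "?A \<subseteq> ?B"
      proof
        fix u assume u: "u \<in> ?A"
        then obtain k where "u - c = q * k" by (auto elim: dvdE)
        then have "u = c + q * k" by simp
        then show "u \<in> ?B" using u iff by auto
      qed
      show "?B \<subseteq> ?A" using iff by (intro subsetI) (elim imageE, simp)
    qed
  qed
  moreover have "inj_on (\<lambda>k. c + q * k) {g<..f}" using assms by (auto simp: inj_on_def)
  ultimately have c: "card {u \<in> {a<..a + L}. q dvd u - c} = nat (f - g)" by (simp add: card_image)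
  have "g \<le> f" unfolding f_def g_def
    using assms by (intro floor_mono divide_right_mono) auto
  then have "real (card {u \<in> {a<..a + L}. q dvd u - c}) = f - g" using c by simp
  moreover have "f \<le> real_of_int (a + L - c) / q" "f > real_of_int (a + L - c) / q - 1"
    "g \<le> real_of_int (a - c) / q" "g > real_of_int (a - c) / q - 1"
    unfolding f_def g_def by linarith+
  moreover have "real_of_int (a + L - c) / q = real_of_int (a - c) / q + L / q"
    by (simp add: add_divide_distrib[symmetric])
  ultimately show "real (card {u \<in> {a<..a + L}. q dvd u - c}) \<le> L / q + 1"
    "real (card {u \<in> {a<..a + L}. q dvd u - c}) \<ge> L / q - 1" by linarith+
qed

section \<open>The sextic form\<close>

text \<open>Only used when \<open>697\<close> divides \<open>u\<^sup>2 + v\<^sup>2\<close>, so that the division is exact.\<close>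

definition red_norm :: "int \<Rightarrow> int \<Rightarrow> int" where
  "red_norm u v = (u\<^sup>2 + v\<^sup>2) div 697"

text \<open>In the coordinates of the elliptic curve introduced in the last section, where
  \<open>Y\<close> satisfies the curve equation, this is \<open>- (27/19)^2 v^6 Y^2\<close>, so
  \<open>Y\<close> lies in the field generated by the square root of minus this value. The factor
  \<open>red_norm\<close> is the contribution of the point of order two: there
  \<open>x + 1/9 = - 304 n / (9 v^2)\<close>, with \<open>n\<close> the reduced norm.\<close>

definition sextic :: "int \<Rightarrow> int \<Rightarrow> int" where
  "sextic u v = red_norm u v * (311296 * (red_norm u v)\<^sup>2 - (u * v)\<^sup>2)"

text \<open>The modulus is \<open>2\<^sup>2 \<cdot> 3 \<cdot> 5 \<cdot> 11 \<cdot> 19 \<cdot> 31 \<cdot> 697\<^sup>2\<close>. The residues make \<open>697\<close> divide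
  \<open>u\<^sup>2 + v\<^sup>2\<close>, keep the sextic form, apart from a single factor \<open>2\<close>, prime to the primes
  excluded from the root count, make the norms of the ideals constructed later prime to the traces
  of the corresponding elements, and fix the quintic residue classes of these elements
  at \<open>11\<close> and \<open>31\<close>.\<close>

definition admissible :: "int \<Rightarrow> int \<Rightarrow> bool" where
  "admissible u v \<longleftrightarrow> u mod 188853390660 = 8277 \<and> v mod 188853390660 = 2915 \<and> coprime u v"

text \<open>One of the two factors 697 of the modulus is spent on the exact division, so the
  quotient is still known modulo \<open>188853390660 / 697 = 270951780\<close>, a multiple of 697.
  The residue is \<open>110482 = (8277^2 + 2915^2) / 697\<close>.\<close>

lemma admissible_red_norm:
  assumes "admissible u v"
  shows "u\<^sup>2 + v\<^sup>2 = 697 * red_norm u v" "red_norm u v mod 270951780 = 110482"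
proof -
  obtain a b where u: "u = 8277 + 188853390660 * a" and v: "v = 2915 + 188853390660 * b"
    using assms unfolding admissible_def by (metis mod_mult_div_eq)
  define m where "m = 110482 + 270951780 * (2 * 8277 * a + 2 * 2915 * b
     + 188853390660 * (a\<^sup>2 + b\<^sup>2))"
  have *: "u\<^sup>2 + v\<^sup>2 = 697 * m"
    unfolding u v m_def by (simp add: power2_eq_square algebra_simps)
  then have n: "red_norm u v = m" by (simp add: red_norm_def)
  show "u\<^sup>2 + v\<^sup>2 = 697 * red_norm u v" using * n by simp
  have "m mod 270951780 = 110482 mod 270951780" unfolding m_def by (rule mod_mult_self2)
  then show "red_norm u v mod 270951780 = 110482" using n by simp
qed

lemma admissible_mod:
  assumes adm: "admissible u v" and m: "m dvd 270951780"
  shows "[u = 8277] (mod m)" "[v = 2915] (mod m)" "[red_norm u v = 110482] (mod m)"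
    "[sextic u v = 17276038] (mod m)"
proof -
  have "u mod 188853390660 mod 270951780 = 8277 mod 270951780"
       "v mod 188853390660 mod 270951780 = 2915 mod 270951780"
    using adm by (auto simp: admissible_def)
  then have u: "[u = 8277] (mod 270951780)" and v: "[v = 2915] (mod 270951780)"
    by (simp_all add: unique_euclidean_semiring_class.cong_def mod_mod_cancel)
  have n: "[red_norm u v = 110482] (mod 270951780)"
    using admissible_red_norm(2)[OF adm] by (simp add: unique_euclidean_semiring_class.cong_def)
  have "[sextic u v = 110482 * (311296 * 110482\<^sup>2 - (8277 * 2915)\<^sup>2)] (mod 270951780)"
    unfolding sextic_def by (intro cong_mult cong_diff cong_pow u v n cong_refl)
  then have s: "[sextic u v = 17276038] (mod 270951780)"
    by (simp add: unique_euclidean_semiring_class.cong_def)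
  show "[u = 8277] (mod m)" "[v = 2915] (mod m)" "[red_norm u v = 110482] (mod m)"
    "[sextic u v = 17276038] (mod m)"
    using u v n s m cong_dvd_modulus by blast+
qed

text \<open>The residue 17276038 is 2 modulo 4 and prime to
  \<open>198645 = 3 * 5 * 17 * 19 * 41\<close>, so of the primes dividing 397290 only 2 divides the
  value, and only once.\<close>

lemma admissible_sextic_dvd:
  assumes "admissible u v"
  shows "\<not> 4 dvd sextic u v" "2 dvd sextic u v"
    and "\<And>p. p dvd 198645 \<Longrightarrow> p dvd sextic u v \<Longrightarrow> p dvd 1"
proof -
  have d: "c dvd sextic u v \<longleftrightarrow> c dvd 17276038" if "c dvd 270951780" for c
    using admissible_mod(4)[OF assms that] cong_dvd_iff by blast
  show "\<not> 4 dvd sextic u v" "2 dvd sextic u v" using d by simp_all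
  fix p :: int assume p: "p dvd 198645" "p dvd sextic u v"
  have "p dvd 198645 * 1364" using p(1) by (rule dvd_mult2)
  then have "p dvd 17276038" using d[of p] p by simp
  \<comment> \<open>A Bezout relation: the difference equals 1.\<close>
  then have "p dvd 17276038 * 133792 - 198645 * 11635811" using p(1) by (intro dvd_diff dvd_mult2)
  then show "p dvd 1" by simp
qed

section \<open>Roots of the form modulo prime powers\<close>

lemma finite_filter_interval: "finite {t \<in> {0..<q::int}. P t}"
  by (rule finite_subset[of _ "{0..<q}"]) auto

lemma prime_power_dvd_mult_cases:
  fixes p a b :: int
  assumes "prime p" "p ^ k dvd a * b" "\<not> (p dvd a \<and> p dvd b)"
  shows "p ^ k dvd a \<or> p ^ k dvd b"
proof (cases "p dvd a")
  case True
  then have "coprime (p ^ k) b"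
    using assms by (auto intro: prime_imp_coprime coprime_power_left_iff[THEN iffD2])
  then show ?thesis using assms(2) by (metis coprime_dvd_mult_left_iff)
next
  case False
  then have "coprime (p ^ k) a"
    using assms by (auto intro: prime_imp_coprime coprime_power_left_iff[THEN iffD2])
  then show ?thesis using assms(2) by (metis coprime_dvd_mult_right_iff)
qed

text \<open>For two roots \<open>s\<close> and \<open>t\<close> the prime cannot divide both
  \<open>t - s\<close> and \<open>t + s\<close>, since it would then divide \<open>2s\<close>; so
  the full power divides one of them and \<open>t\<close> is \<open>s\<close> or
  \<open>- s\<close>.\<close>

lemma card_square_roots_mod_prime_power:
  fixes p c :: int
  assumes p: "prime p" "odd p" "\<not> p dvd c"
  shows "card {t \<in> {0..<p ^ k}. p ^ k dvd t\<^sup>2 - c} \<le> 2"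
proof (cases "{t \<in> {0..<p ^ k}. p ^ k dvd t\<^sup>2 - c} = {} \<or> k = 0")
  case True
  then show ?thesis
  proof
    assume "k = 0"
    then have "{t \<in> {0..<p ^ k}. p ^ k dvd t\<^sup>2 - c} \<subseteq> {0}" by auto
    from card_mono[OF _ this] show ?thesis by simp
  qed (metis card.empty zero_le)
next
  case False
  then obtain s where s: "s \<in> {0..<p ^ k}" "p ^ k dvd s\<^sup>2 - c" by auto
  have pk: "p dvd p ^ k" using False by simp
  have ps: "\<not> p dvd s"
  proof
    assume "p dvd s"
    then have "p dvd s\<^sup>2" by (simp add: power2_eq_square)
    from dvd_diff[OF this dvd_trans[OF pk s(2)]] show False using p by simp
  qed
  have "{t \<in> {0..<p ^ k}. p ^ k dvd t\<^sup>2 - c} \<subseteq> {s, (-s) mod p ^ k}"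
  proof
    fix t assume t: "t \<in> {t \<in> {0..<p ^ k}. p ^ k dvd t\<^sup>2 - c}"
    have "p ^ k dvd (t\<^sup>2 - c) - (s\<^sup>2 - c)" by (rule dvd_diff) (use t s in auto)
    then have d: "p ^ k dvd (t - s) * (t + s)"
      by (simp add: power2_eq_square algebra_simps)
    have "\<not> (p dvd t - s \<and> p dvd t + s)"
    proof
      assume "p dvd t - s \<and> p dvd t + s"
      then have "p dvd (t + s) - (t - s)" by (metis dvd_diff)
      then have "p dvd 2 * s" by simp
      then have "p dvd 2" using ps p by (simp add: prime_dvd_mult_iff)
      then show False using p(1,2) by (metis primes_dvd_imp_eq two_is_prime dvd_refl)
    qed
    from prime_power_dvd_mult_cases[OF p(1) d this]
    show "t \<in> {s, (-s) mod p ^ k}"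
    proof
      assume "p ^ k dvd t - s"
      then have "t mod p ^ k = s mod p ^ k" by (simp add: mod_eq_dvd_iff)
      then show ?thesis using t s by simp
    next
      assume "p ^ k dvd t + s"
      then have "t mod p ^ k = (-s) mod p ^ k" by (simp add: mod_eq_dvd_iff)
      then show ?thesis using t by simp
    qed
  qed
  then have "card {t \<in> {0..<p ^ k}. p ^ k dvd t\<^sup>2 - c} \<le> card {s, (-s) mod p ^ k}"
    by (intro card_mono) auto
  also have "\<dots> \<le> 2" by (simp add: card_insert_if)
  finally show ?thesis .
qed

text \<open>The polynomial is \<open>697^3 F(t, 1)\<close>: multiplying by \<open>697^3\<close>
  clears the division by 697 hidden in the form, and \<open>485809 = 697^2\<close>.\<close>

definition sextic_roots :: "int \<Rightarrow> int set" where
  "sextic_roots q = {t \<in> {0..<q}. q dvd (t\<^sup>2 + 1) * (311296 * (t\<^sup>2 + 1)\<^sup>2 - 485809 * t\<^sup>2)}"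

lemma finite_sextic_roots [simp]: "finite (sextic_roots q)"
  unfolding sextic_roots_def by (rule finite_filter_interval)

lemma prime_not_dvd_coefficients:
  fixes p :: int
  assumes p: "prime p" "\<not> p dvd 397290"
  shows "\<not> p dvd 2" "\<not> p dvd 311296" "\<not> p dvd 622592" "\<not> p dvd 485809" "\<not> p dvd 368911209375"
proof -
  have *: "\<not> p dvd c" if "c dvd r ^ k" "r dvd 397290" for c r k
    using p that by (meson dvd_trans prime_dvd_power)
  show "\<not> p dvd 2" by (rule *[of _ 2 1]) simp_all
  show "\<not> p dvd 311296" by (rule *[of _ 38 14]) simp_all
  show "\<not> p dvd 622592" by (rule *[of _ 38 15]) simp_all
  show "\<not> p dvd 485809" by (rule *[of _ 697 2]) simp_all
  show "\<not> p dvd 368911209375" by (rule *[of _ 10455 5]) simp_all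
qed

text \<open>The excluded primes \<open>2, 3, 5, 17, 19, 41\<close> divide the leading coefficient \<open>311296\<close>, the
  discriminant \<open>136783\<^sup>2 - 4 \<cdot> 311296\<^sup>2 = - 697\<^sup>2 \<cdot> 15\<^sup>5\<close> of the quadratic satisfied by
  \<open>t\<^sup>2\<close>, or the resultant with \<open>t\<^sup>2 + 1\<close>.\<close>

lemma card_sextic_roots:
  fixes p :: int
  assumes p: "prime p" "\<not> p dvd 397290"
  shows "card (sextic_roots (p ^ k)) \<le> 6"
proof (cases "k = 0")
  case True
  then have "sextic_roots (p ^ k) \<subseteq> {0}" by (auto simp: sextic_roots_def)
  then show ?thesis using card_mono[of "{0::int}" "sextic_roots (p ^ k)"] by simp
next
  case False
  define q where "q = p ^ k"
  have pq: "p dvd q" using False by (simp add: q_def)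
  have q0: "q > 0" using p by (simp add: q_def prime_gt_0_int)
  note n2 = prime_not_dvd_coefficients[OF p]
  have odd: "odd p" using n2(1) p(1) by (metis dvd_refl primes_dvd_imp_eq two_is_prime)
  define S1 where "S1 = {t \<in> {0..<q}. q dvd t\<^sup>2 - (-1)}"
  define Z where "Z = {z \<in> {0..<q}. q dvd 311296 * z\<^sup>2 + 136783 * z + 311296}"
  define S2 where "S2 = (\<Union>z\<in>Z. {t \<in> {0..<q}. q dvd t\<^sup>2 - z})"
  have c1: "card S1 \<le> 2" unfolding S1_def q_def
    using p odd not_prime_unit by (intro card_square_roots_mod_prime_power) auto
  \<comment> \<open>\<open>Z\<close> contains the possible values of \<open>t^2\<close>. Completing
    the square sends \<open>z\<close> to \<open>2az + b\<close> with \<open>a = 311296\<close> and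
    \<open>b = 136783\<close>, injectively into the square roots of the discriminant modulo
    \<open>q\<close>.\<close>
  have "card Z \<le> card {l \<in> {0..<q}. q dvd l\<^sup>2 - (-368911209375)}"
  proof (rule card_inj_on_le[where f = "\<lambda>z. (622592 * z + 136783) mod q"])
    show "inj_on (\<lambda>z. (622592 * z + 136783) mod q) Z"
    proof (rule inj_onI)
      fix y z assume yz: "y \<in> Z" "z \<in> Z" "(622592 * y + 136783) mod q = (622592 * z + 136783) mod q"
      then have "q dvd 622592 * (y - z)" by (simp add: mod_eq_dvd_iff algebra_simps)
      moreover have "coprime q 622592" unfolding q_def
        using p n2 by (auto intro: prime_imp_coprime coprime_power_left_iff[THEN iffD2])
      ultimately have "q dvd y - z" by (metis coprime_dvd_mult_right_iff)
      then have "y mod q = z mod q" by (simp add: mod_eq_dvd_iff)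
      then show "y = z" using yz by (simp add: Z_def)
    qed
    show "(\<lambda>z. (622592 * z + 136783) mod q) ` Z \<subseteq> {l \<in> {0..<q}. q dvd l\<^sup>2 - (-368911209375)}"
    proof clarsimp
      fix z assume "z \<in> Z"
      then have "q dvd 311296 * z\<^sup>2 + 136783 * z + 311296" by (simp add: Z_def)
      then have "q dvd 1245184 * (311296 * z\<^sup>2 + 136783 * z + 311296)" by (rule dvd_mult)
      then have "q dvd (622592 * z + 136783)\<^sup>2 + 368911209375"
        by (simp add: power2_eq_square algebra_simps)
      moreover have "[((622592 * z + 136783) mod q)\<^sup>2 + 368911209375
          = (622592 * z + 136783)\<^sup>2 + 368911209375] (mod q)"
        by (intro cong_add cong_pow cong_refl) (simp add: unique_euclidean_semiring_class.cong_def)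
      ultimately have "q dvd ((622592 * z + 136783) mod q)\<^sup>2 + 368911209375"
        using cong_dvd_iff by blast
      then show "0 \<le> (622592 * z + 136783) mod q \<and> (622592 * z + 136783) mod q < q
          \<and> q dvd ((622592 * z + 136783) mod q)\<^sup>2 + 368911209375"
        using q0 by simp
    qed
  qed (rule finite_filter_interval)
  also have "\<dots> \<le> 2" unfolding q_def
    using p odd n2 by (intro card_square_roots_mod_prime_power) auto
  finally have cZ: "card Z \<le> 2" .
  have fZ: "finite Z" unfolding Z_def by (rule finite_filter_interval)
  have "card S2 \<le> (\<Sum>z\<in>Z. card {t \<in> {0..<q}. q dvd t\<^sup>2 - z})"
    unfolding S2_def by (rule card_UN_le[OF fZ])
  also have "\<dots> \<le> (\<Sum>z\<in>Z. 2)"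
  proof (rule sum_mono)
    fix z assume z: "z \<in> Z"
    have "\<not> p dvd z"
    proof
      assume "p dvd z"
      moreover have "p dvd 311296 * z\<^sup>2 + 136783 * z + 311296"
        using z pq by (auto simp: Z_def intro: dvd_trans)
      moreover have "311296 = (311296 * z\<^sup>2 + 136783 * z + 311296) - z * (311296 * z + 136783)"
        by (simp add: power2_eq_square algebra_simps)
      ultimately have "p dvd 311296" by (metis dvd_diff dvd_mult2)
      then show False using n2 by simp
    qed
    then show "card {t \<in> {0..<q}. q dvd t\<^sup>2 - z} \<le> 2"
      unfolding q_def using p odd by (intro card_square_roots_mod_prime_power) auto
  qed
  also have "\<dots> \<le> 4" using cZ by simp
  finally have c2: "card S2 \<le> 4" .
  have "sextic_roots q \<subseteq> S1 \<union> S2"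
  proof
    fix t assume t: "t \<in> sextic_roots q"
    let ?a = "t\<^sup>2 + 1" and ?b = "311296 * (t\<^sup>2 + 1)\<^sup>2 - 485809 * t\<^sup>2"
    have "\<not> (p dvd ?a \<and> p dvd ?b)"
    proof
      assume *: "p dvd ?a \<and> p dvd ?b"
      \<comment> \<open>Modulo \<open>t^2 + 1\<close> the second factor is the constant
        \<open>697^2\<close>, so only the excluded primes 17 and 41 could divide both
        factors.\<close>
      have "485809 = ?b - ?a * (311296 * (t\<^sup>2 + 1) - 485809)"
        by (simp add: power2_eq_square algebra_simps)
      with * have "p dvd 485809" by (metis dvd_diff dvd_mult2)
      then show False using n2 by simp
    qed
    moreover have "p ^ k dvd ?a * ?b" using t by (simp add: sextic_roots_def q_def)
    ultimately have "q dvd ?a \<or> q dvd ?b"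
      unfolding q_def using prime_power_dvd_mult_cases[OF p(1)] by blast
    then show "t \<in> S1 \<union> S2"
    proof
      assume "q dvd ?a" then show ?thesis using t by (simp add: S1_def sextic_roots_def)
    next
      assume b: "q dvd ?b"
      let ?z = "t\<^sup>2 mod q"
      have "?b = 311296 * (t\<^sup>2)\<^sup>2 + 136783 * t\<^sup>2 + 311296"
        by (simp add: power2_eq_square algebra_simps)
      moreover have "[311296 * ?z\<^sup>2 + 136783 * ?z + 311296 = 311296 * (t\<^sup>2)\<^sup>2 + 136783 * t\<^sup>2 + 311296] (mod q)"
        by (intro cong_add cong_mult cong_pow cong_refl) (simp_all add: unique_euclidean_semiring_class.cong_def)
      ultimately have "q dvd 311296 * ?z\<^sup>2 + 136783 * ?z + 311296"
        using b cong_dvd_iff by metis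
      then have "?z \<in> Z" using q0 by (simp add: Z_def)
      moreover have "q dvd t\<^sup>2 - ?z" by (simp add: mod_eq_dvd_iff[symmetric])
      ultimately show ?thesis using t unfolding S2_def sextic_roots_def by blast
    qed
  qed
  then have "card (sextic_roots q) \<le> card (S1 \<union> S2)"
    unfolding S1_def S2_def by (intro card_mono finite_UnI finite_UN_I fZ finite_filter_interval)
  also have "\<dots> \<le> card S1 + card S2" by (rule card_Un_le)
  finally show ?thesis using c1 c2 by (simp add: q_def)
qed

text \<open>The root is \<open>t = u / v\<close> modulo \<open>p^k\<close>. By homogeneity
  \<open>v^6\<close> times the dehomogenised form at \<open>t\<close> is
  \<open>697^3 F(u, v)\<close>, and \<open>v\<close> is invertible.\<close>

lemma sextic_root_of_dvd:
  fixes p :: int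
  assumes uv: "u\<^sup>2 + v\<^sup>2 = 697 * red_norm u v" and p: "prime p" "\<not> p dvd v" "p ^ k dvd sextic u v"
  shows "\<exists>t \<in> sextic_roots (p ^ k). p ^ k dvd u - t * v"
proof -
  let ?q = "p ^ k"
  have cop: "coprime v ?q" using p by (metis coprime_commute coprime_power_right_iff prime_imp_coprime)
  then obtain w where w: "[v * w = 1] (mod ?q)" using cong_solve_coprime_int by blast
  define t where "t = (u * w) mod ?q"
  have q0: "?q > 0" using p by (simp add: prime_gt_0_int)
  have "[t * v = u * w * v] (mod ?q)"
    unfolding t_def by (intro cong_mult cong_refl) (simp add: unique_euclidean_semiring_class.cong_def)
  also have "u * w * v = u * (v * w)" by simp
  also have "[u * (v * w) = u * 1] (mod ?q)" by (intro cong_mult cong_refl w)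
  finally have tv: "[t * v = u] (mod ?q)" by simp
  let ?g = "(t\<^sup>2 + 1) * (311296 * (t\<^sup>2 + 1)\<^sup>2 - 485809 * t\<^sup>2)"
  have "(t * v)\<^sup>2 + v\<^sup>2 = v\<^sup>2 * (t\<^sup>2 + 1)" by (simp add: power_mult_distrib algebra_simps)
  moreover have "((t * v) * v)\<^sup>2 = t\<^sup>2 * v\<^sup>2 * v\<^sup>2" by (simp add: power_mult_distrib)
  moreover have "w ^ 3 * (s * (311296 * s\<^sup>2 - 485809 * r)) =
      w * s * (311296 * (w * s)\<^sup>2 - 485809 * (r * w * w))" for w s r :: int
    by (simp add: power2_eq_square power3_eq_cube right_diff_distrib)
  moreover have "v ^ 6 = (v\<^sup>2) ^ 3" by (simp flip: power_mult)
  ultimately have "v ^ 6 * ?g =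
      ((t * v)\<^sup>2 + v\<^sup>2) * (311296 * ((t * v)\<^sup>2 + v\<^sup>2)\<^sup>2 - 485809 * ((t * v) * v)\<^sup>2)"
    by (simp only:)
  also have "[\<dots> = (u\<^sup>2 + v\<^sup>2) * (311296 * (u\<^sup>2 + v\<^sup>2)\<^sup>2 - 485809 * (u * v)\<^sup>2)] (mod ?q)"
    by (intro cong_mult cong_add cong_diff cong_pow cong_refl tv)
  also have "(u\<^sup>2 + v\<^sup>2) * (311296 * (u\<^sup>2 + v\<^sup>2)\<^sup>2 - 485809 * (u * v)\<^sup>2) = 697 ^ 3 * sextic u v"
    unfolding uv sextic_def by (simp add: power2_eq_square algebra_simps)
  also have "[\<dots> = 0] (mod ?q)" using p(3) by (simp add: cong_0_iff)
  finally have "?q dvd v ^ 6 * ?g" by (simp add: cong_0_iff)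
  moreover have "coprime ?q (v ^ 6)" using cop by (simp add: coprime_commute)
  ultimately have "?q dvd ?g" by (metis coprime_dvd_mult_right_iff)
  then have "t \<in> sextic_roots ?q" using q0 by (simp add: sextic_roots_def t_def)
  moreover have "?q dvd u - t * v" using tv by (metis cong_iff_dvd_diff cong_sym)
  ultimately show ?thesis by blast
qed

text \<open>If \<open>p\<close> divided \<open>u v\<close>, the definition of the form would give
  that \<open>p\<close> divides \<open>311296 (u^2 + v^2)^3\<close>, hence \<open>u^2 + v^2\<close>,
  and with it both of the coprime numbers \<open>u\<close> and \<open>v\<close>.\<close>

lemma admissible_prime_not_dvd:
  fixes p :: int
  assumes uv: "admissible u v" and p: "prime p" "\<not> p dvd 397290" "p dvd sextic u v"
  shows "\<not> p dvd v" "\<not> p dvd u"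
proof -
  note n2 = prime_not_dvd_coefficients(2)[OF p(1,2)]
  have "311296 * (u\<^sup>2 + v\<^sup>2) ^ 3 = 697 ^ 3 * sextic u v + (u\<^sup>2 + v\<^sup>2) * 485809 * (u * v)\<^sup>2"
    unfolding admissible_red_norm(1)[OF uv] sextic_def
    by (simp add: power2_eq_square power3_eq_cube algebra_simps)
  then have "p dvd 311296 * (u\<^sup>2 + v\<^sup>2) ^ 3" if "p dvd u * v"
    using p(3) that by (simp add: power2_eq_square)
  then have *: "p dvd u\<^sup>2 + v\<^sup>2" if "p dvd u * v"
    using that n2 p(1) by (meson prime_dvd_mult_iff prime_dvd_power)
  have c: "coprime u v" using uv by (simp add: admissible_def)
  show "\<not> p dvd v"
  proof
    assume v: "p dvd v"
    with * have "p dvd u\<^sup>2" by (simp add: power2_eq_square dvd_add_left_iff)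
    then show False using v c p(1) by (metis coprime_common_divisor not_prime_unit prime_dvd_power)
  qed
  show "\<not> p dvd u"
  proof
    assume u: "p dvd u"
    with * have "p dvd v\<^sup>2" by (simp add: power2_eq_square dvd_add_right_iff)
    then show False using u c p(1) by (metis coprime_common_divisor not_prime_unit prime_dvd_power)
  qed
qed

section \<open>Values of the form at the admissible points of a dyadic box\<close>

definition admissible_box :: "nat \<Rightarrow> (int \<times> int) set" where
  "admissible_box T = {(u, v). u \<in> {int T<..2 * int T} \<and> v \<in> {int T<..2 * int T} \<and> admissible u v}"

abbreviation sextic_at :: "int \<times> int \<Rightarrow> int" where
  "sextic_at P \<equiv> sextic (fst P) (snd P)"

lemma finite_admissible_box [simp]: "finite (admissible_box T)"
  by (rule finite_subset[of _ "{int T<..2 * int T} \<times> {int T<..2 * int T}"])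
     (auto simp: admissible_box_def)

text \<open>All bounds come from \<open>x = u^2 + v^2\<close> with
  \<open>2T^2 \<le> x \<le> 8T^2\<close> and the inequality \<open>4 (u v)^2 \<le> x^2\<close>,
  which keeps the quartic factor positive and of full size. The constant \<open>338608873\<close> is
  \<open>697^3\<close>.\<close>

lemma admissible_box_bounds:
  assumes "(u, v) \<in> admissible_box T"
  shows "int T ^ 6 \<le> 300 * sextic u v" "sextic u v \<le> int T ^ 6"
    and "0 < red_norm u v" "red_norm u v < 16 * int T ^ 2"
    and "0 < 311296 * (red_norm u v)\<^sup>2 - (u * v)\<^sup>2"
        "311296 * (red_norm u v)\<^sup>2 - (u * v)\<^sup>2 \<le> 49 * int T ^ 4"
proof -
  have uv: "int T < u" "u \<le> 2 * int T" "int T < v" "v \<le> 2 * int T" "admissible u v"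
    using assms by (auto simp: admissible_box_def)
  define t where "t = int T"
  have t: "t > 0" using uv by (simp add: t_def)
  define N where "N = red_norm u v"
  define x where "x = 697 * N"
  have x: "x = u\<^sup>2 + v\<^sup>2" using admissible_red_norm(1)[OF uv(5)] by (simp add: N_def x_def)
  define w where "w = (u * v)\<^sup>2"
  have "t\<^sup>2 \<le> u\<^sup>2" by (rule power_mono) (use uv t in \<open>auto simp: t_def\<close>)
  moreover have "u\<^sup>2 \<le> (2 * t)\<^sup>2" by (rule power_mono) (use uv t in \<open>auto simp: t_def\<close>)
  moreover have "t\<^sup>2 \<le> v\<^sup>2" by (rule power_mono) (use uv t in \<open>auto simp: t_def\<close>)
  moreover have "v\<^sup>2 \<le> (2 * t)\<^sup>2" by (rule power_mono) (use uv t in \<open>auto simp: t_def\<close>)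
  ultimately have xb: "2 * t\<^sup>2 \<le> x" "x \<le> 8 * t\<^sup>2" by (auto simp: x power_mult_distrib)
  have t2: "t\<^sup>2 > 0" "t ^ 4 > 0" "t ^ 6 > 0" using t by auto
  have x0: "x > 0" using xb t2 by linarith
  have "0 \<le> (u\<^sup>2 - v\<^sup>2)\<^sup>2" by simp
  then have w: "4 * w \<le> x\<^sup>2" by (simp add: w_def x power2_eq_square algebra_simps)
  have w0: "0 \<le> w" by (simp add: w_def)
  show N0: "0 < red_norm u v" using x0 by (simp add: x_def N_def)
  have "697 * N < 697 * (16 * t\<^sup>2)" using xb x_def t2 by linarith
  then show "red_norm u v < 16 * int T ^ 2" by (simp add: N_def t_def)
  have H: "485809 * (311296 * N\<^sup>2 - w) = 311296 * x\<^sup>2 - 485809 * w"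
    by (simp add: x_def power_mult_distrib)
  have x2: "x\<^sup>2 > 0" using x0 by simp
  have "0 < 485809 * (311296 * N\<^sup>2 - w)" unfolding H using w w0 x2 by linarith
  then show "0 < 311296 * (red_norm u v)\<^sup>2 - (u * v)\<^sup>2" unfolding N_def w_def by simp
  have x2b: "x\<^sup>2 \<le> 64 * t ^ 4"
    using power_mono[OF xb(2), of 2] x0 by (simp add: power_mult_distrib flip: power_mult)
  have "485809 * (311296 * N\<^sup>2 - w) \<le> 485809 * (49 * t ^ 4)"
    unfolding H using x2b w0 t2 by linarith
  then show "311296 * (red_norm u v)\<^sup>2 - (u * v)\<^sup>2 \<le> 49 * int T ^ 4"
    unfolding N_def w_def t_def by simp
  have "338608873 * sextic u v = x * (485809 * (311296 * N\<^sup>2 - w))"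
    by (simp add: sextic_def x_def N_def w_def)
  then have S: "338608873 * sextic u v = x * (311296 * x\<^sup>2 - 485809 * w)" unfolding H .
  have x3: "8 * t ^ 6 \<le> x ^ 3" "x ^ 3 \<le> 512 * t ^ 6"
    using power_mono[OF xb(1), of 3] power_mono[OF xb(2), of 3] x0 t
    by (simp_all add: power_mult_distrib flip: power_mult)
  have xw: "0 \<le> x * w" "4 * (x * w) \<le> x ^ 3"
    using w0 x0 mult_left_mono[OF w, of x] by (simp_all add: power3_eq_cube power2_eq_square)
  have S': "338608873 * sextic u v = 311296 * x ^ 3 - 485809 * (x * w)"
    unfolding S by (simp add: power3_eq_cube power2_eq_square algebra_simps)
  have "338608873 * t ^ 6 \<le> 338608873 * (300 * sextic u v)"
    using S' xw x3(1) t2 by linarith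
  then show "int T ^ 6 \<le> 300 * sextic u v" by (simp add: t_def)
  have "338608873 * sextic u v \<le> 338608873 * t ^ 6" using S' xw x3(2) t2 by linarith
  then show "sextic u v \<le> int T ^ 6" by (simp add: t_def)
qed

lemma sextic_at_pos: "P \<in> admissible_box T \<Longrightarrow> sextic_at P > 0"
  using admissible_box_bounds(3,5)[of "fst P" "snd P" T] by (simp add: sextic_def)

text \<open>Both products in the determinant lie between \<open>T^2\<close> and \<open>4T^2\<close>,
  so it is smaller than \<open>q\<close> in absolute value and must vanish; coprime positive pairs
  with vanishing determinant are equal. This is what turns knowledge of the ratio
  \<open>u / v\<close> modulo \<open>q\<close> into knowledge of the point.\<close>

lemma admissible_box_eqI:
  assumes P: "(u, v) \<in> admissible_box T" "(u', v') \<in> admissible_box T"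
    and q: "q dvd u * v' - u' * v" "q > 3 * int T ^ 2"
  shows "(u, v) = (u', v')"
proof -
  have b: "int T < u" "u \<le> 2 * int T" "int T < v" "v \<le> 2 * int T"
    "int T < u'" "u' \<le> 2 * int T" "int T < v'" "v' \<le> 2 * int T"
    and c: "coprime u v" "coprime u' v'"
    using P by (auto simp: admissible_box_def admissible_def)
  have m: "int T * int T \<le> a * b \<and> a * b \<le> (2 * int T) * (2 * int T)"
    if "int T < a" "a \<le> 2 * int T" "int T < b" "b \<le> 2 * int T" for a b
    using that by (intro conjI mult_mono) auto
  have "\<bar>u * v' - u' * v\<bar> \<le> 3 * (int T * int T)"
    using m[of u v'] m[of u' v] b by linarith
  then have "\<bar>u * v' - u' * v\<bar> < q" using q(2) by (simp add: power2_eq_square)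
  then have e: "u * v' = u' * v" using q(1) dvd_imp_le_int[of "u * v' - u' * v" q] by fastforce
  then have "u dvd u'" "u' dvd u"
    using c by (metis coprime_dvd_mult_left_iff dvd_triv_left, metis coprime_dvd_mult_left_iff dvd_triv_left)
  then have "u = u'" using b by (simp add: zdvd_antisym_nonneg)
  then show ?thesis using e b by simp
qed

lemma sextic_root_of_box:
  assumes P: "P \<in> admissible_box T" and p: "prime p" "\<not> int p dvd 397290" "int p ^ k dvd sextic_at P" "k > 0"
  shows "\<exists>t \<in> sextic_roots (int p ^ k). int p ^ k dvd fst P - t * snd P"
proof -
  have a: "admissible (fst P) (snd P)" using P by (auto simp: admissible_box_def)
  have "int p dvd sextic_at P" using p(3,4) by (meson dvd_power dvd_trans)
  then have "\<not> int p dvd snd P" using admissible_prime_not_dvd(1)[OF a] p by simp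
  then show ?thesis using sextic_root_of_dvd[OF admissible_red_norm(1)[OF a]] p by simp
qed

lemma card_cartesian_product_singleton_right: "card (A \<times> {x}) = card A"
  by (simp add: card_cartesian_product)

text \<open>For each \<open>v\<close> there are at most six ratios, and each confines
  \<open>u\<close> to one residue class modulo \<open>p^k\<close> in an interval of length
  \<open>T\<close>.\<close>

lemma card_box_prime_power_dvd:
  assumes p: "prime p" "\<not> int p dvd 397290" "k > 0"
  shows "real (card {P \<in> admissible_box T. int p ^ k dvd sextic_at P}) \<le> 6 * T * (T / real p ^ k + 1)"
proof -
  let ?q = "int p ^ k"
  let ?C = "\<lambda>c. {u \<in> {int T<..int T + int T}. ?q dvd u - c}"
  have q0: "?q > 0" using p by (simp add: prime_gt_0_nat)
  have fC: "finite (?C c)" for c by (rule finite_subset[of _ "{int T<..int T + int T}"]) auto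
  have "{P \<in> admissible_box T. ?q dvd sextic_at P}
      \<subseteq> (\<Union>v\<in>{int T<..2 * int T}. \<Union>t\<in>sextic_roots ?q. ?C (t * v) \<times> {v})"
  proof
    fix P assume P: "P \<in> {P \<in> admissible_box T. ?q dvd sextic_at P}"
    then obtain t where "t \<in> sextic_roots ?q" "?q dvd fst P - t * snd P"
      using sextic_root_of_box[OF _ p(1,2) _ p(3)] by blast
    moreover have "fst P \<in> {int T<..int T + int T}" "snd P \<in> {int T<..2 * int T}"
      using P by (auto simp: admissible_box_def)
    ultimately have "P \<in> ?C (t * snd P) \<times> {snd P}" by (simp add: mem_Times_iff)
    with \<open>t \<in> _\<close> \<open>snd P \<in> _\<close>
    show "P \<in> (\<Union>v\<in>{int T<..2 * int T}. \<Union>t\<in>sextic_roots ?q. ?C (t * v) \<times> {v})"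
      by (intro UN_I)
  qed
  then have "card {P \<in> admissible_box T. ?q dvd sextic_at P}
      \<le> card (\<Union>v\<in>{int T<..2 * int T}. \<Union>t\<in>sextic_roots ?q. ?C (t * v) \<times> {v})"
    by (intro card_mono finite_UN_I finite_cartesian_product fC) auto
  also have "\<dots> \<le> (\<Sum>v\<in>{int T<..2 * int T}. card (\<Union>t\<in>sextic_roots ?q. ?C (t * v) \<times> {v}))"
    by (rule card_UN_le) simp
  also have "\<dots> \<le> (\<Sum>v\<in>{int T<..2 * int T}. \<Sum>t\<in>sextic_roots ?q. card (?C (t * v) \<times> {v}))"
    by (intro sum_mono card_UN_le) simp
  finally have "real (card {P \<in> admissible_box T. ?q dvd sextic_at P})
      \<le> real (\<Sum>v\<in>{int T<..2 * int T}. \<Sum>t\<in>sextic_roots ?q. card (?C (t * v) \<times> {v}))"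
    by (rule of_nat_mono)
  also have "\<dots> = (\<Sum>v\<in>{int T<..2 * int T}. \<Sum>t\<in>sextic_roots ?q. real (card (?C (t * v))))"
    by (simp only: of_nat_sum card_cartesian_product_singleton_right)
  also have "\<dots> \<le> (\<Sum>v\<in>{int T<..2 * int T}. \<Sum>t\<in>sextic_roots ?q. T / real p ^ k + 1)"
  proof (intro sum_mono)
    fix v t
    show "real (card (?C (t * v))) \<le> T / real p ^ k + 1"
      using card_residue_class_interval(1)[OF q0, of "int T" "int T" "t * v"] by simp
  qed
  also have "\<dots> = T * (card (sextic_roots ?q) * (T / real p ^ k + 1))" by simp
  also have "\<dots> \<le> T * (6 * (T / real p ^ k + 1))"
    using card_sextic_roots[of "int p" k] p by (intro mult_left_mono mult_right_mono) auto
  finally show ?thesis by (simp only: mult_ac)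
qed

text \<open>Since \<open>p > 4T\<close>, the modulus \<open>p^2\<close> exceeds \<open>3T^2\<close>,
  so points with the same ratio modulo \<open>p^2\<close> coincide, and there are at most six
  ratios. The bound \<open>T / p^2 + 1\<close> per value of \<open>v\<close> would be useless
  here.\<close>

lemma card_box_large_prime_square_dvd:
  assumes p: "prime p" "\<not> int p dvd 397290" "p > 4 * T"
  shows "card {P \<in> admissible_box T. int p ^ 2 dvd sextic_at P} \<le> 6"
proof -
  let ?S = "{P \<in> admissible_box T. int p ^ 2 dvd sextic_at P}"
  have "\<forall>P\<in>?S. \<exists>t. t \<in> sextic_roots (int p ^ 2) \<and> int p ^ 2 dvd fst P - t * snd P"
    using sextic_root_of_box[OF _ p(1,2) _ pos2] by blast
  then obtain r where "\<forall>P\<in>?S. r P \<in> sextic_roots (int p ^ 2) \<and> int p ^ 2 dvd fst P - r P * snd P"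
    by (rule bchoice[THEN exE])
  then have r: "r P \<in> sextic_roots (int p ^ 2)" "int p ^ 2 dvd fst P - r P * snd P" if "P \<in> ?S" for P
    using that by blast+
  have "4 * int T * (4 * int T) \<le> int p * int p" using p(3) by (intro mult_mono) auto
  moreover have "T > 0 \<or> ?S = {}" by (auto simp: admissible_box_def intro: gr0I)
  ultimately have q: "?S = {} \<or> int p ^ 2 > 3 * int T ^ 2"
    by (auto simp: power2_eq_square) (smt (verit) mult_pos_pos of_nat_0_less_iff)
  have "inj_on r ?S"
  proof (rule inj_onI)
    fix P P' assume P: "P \<in> ?S" "P' \<in> ?S" "r P = r P'"
    obtain u v u' v' where uv: "P = (u, v)" "P' = (u', v')" by (cases P, cases P')
    have "int p ^ 2 dvd (u - r P * v) * v' - (u' - r P * v') * v"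
      by (rule dvd_diff; rule dvd_mult2) (use r(2)[OF P(1)] r(2)[OF P(2)] P(3) uv in auto)
    then have "int p ^ 2 dvd u * v' - u' * v" by (simp add: algebra_simps)
    then show "P = P'" using admissible_box_eqI[of u v T u' v' "int p ^ 2"] P q uv by auto
  qed
  then have "card ?S \<le> card (sextic_roots (int p ^ 2))"
    using r by (intro card_inj_on_le[where f = r]) auto
  also have "\<dots> \<le> 6" using p by (intro card_sextic_roots) auto
  finally show ?thesis .
qed

text \<open>The prime cannot divide both factors of the form, and \<open>p^2\<close> is too large to
  divide the quadratic one, which is below \<open>16T^2\<close>. So \<open>p^2\<close> divides the
  quartic factor, which is at most \<open>(7T^2)^2\<close>.\<close>

lemma large_prime_square_dvd_bound:
  assumes P: "P \<in> admissible_box T" and p: "prime p" "\<not> int p dvd 397290" "p > 4 * T" "int p ^ 2 dvd sextic_at P"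
  shows "p \<le> 7 * T ^ 2"
proof -
  obtain u v where uv: "P = (u, v)" by (cases P)
  note b = admissible_box_bounds[OF P[unfolded uv]]
  have a: "admissible u v" using P uv by (auto simp: admissible_box_def)
  let ?n = "red_norm u v" and ?h = "311296 * (red_norm u v)\<^sup>2 - (u * v)\<^sup>2"
  have pd: "int p dvd sextic u v" using p(4) uv by (auto simp: power2_eq_square dest: dvd_mult_left)
  have pp: "prime (int p)" using p by simp
  have np: "\<not> int p dvd u" "\<not> int p dvd v" using admissible_prime_not_dvd[OF a pp p(2) pd] by auto
  have "\<not> (int p dvd ?n \<and> int p dvd ?h)"
  proof
    assume *: "int p dvd ?n \<and> int p dvd ?h"
    have "int p dvd 311296 * ?n\<^sup>2 - ?h"
      by (rule dvd_diff) (use * in \<open>auto simp: power2_eq_square\<close>)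
    then have "int p dvd (u * v)\<^sup>2" by simp
    then show False using np pp by (meson prime_dvd_mult_iff prime_dvd_power)
  qed
  then have "int p ^ 2 dvd ?n \<or> int p ^ 2 dvd ?h"
    using prime_power_dvd_mult_cases[OF pp, of 2 ?n ?h] p(4) uv by (simp add: sextic_def)
  moreover have "\<not> int p ^ 2 dvd ?n"
  proof
    assume "int p ^ 2 dvd ?n"
    then have "int p ^ 2 \<le> ?n" using b(3) by (rule zdvd_imp_le)
    moreover have "(4 * int T)\<^sup>2 \<le> int p ^ 2" using p(3) by (intro power_mono) auto
    ultimately show False using b(4) by (simp add: power_mult_distrib)
  qed
  ultimately have "int p ^ 2 \<le> ?h" using b(5) by (auto intro: zdvd_imp_le)
  also have "\<dots> \<le> (7 * int T ^ 2) ^ 2" using b(6) by (simp add: power_mult_distrib flip: power_mult)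
  finally have "int p \<le> 7 * int T ^ 2" by (rule power2_le_imp_le) simp
  then have "int p \<le> int (7 * T ^ 2)" by simp
  then show ?thesis by (simp only: of_nat_le_iff)
qed

section \<open>Values of the form modulo squares\<close>

text \<open>Primes up to \<open>4T\<close> are treated by residue classes for each \<open>v\<close>,
  larger ones by the bound of six points per prime. The assumption on \<open>y\<close> keeps all
  primes above \<open>y\<close> away from the divisors of 397290.\<close>

lemma card_box_prime_square_dvd:
  fixes y T :: nat
  assumes y: "y \<ge> 397290"
  shows "real (card {P \<in> admissible_box T. \<exists>p>y. prime p \<and> int p ^ 2 dvd sextic_at P})
    \<le> 6 * real T * (T / y + card {p::nat. prime p \<and> p \<le> 4 * T}) + 6 * card {p::nat. prime p \<and> p \<le> 7 * T ^ 2}"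
proof -
  let ?S = "\<lambda>p. {P \<in> admissible_box T. int p ^ 2 dvd sextic_at P}"
  let ?A = "{p. prime p \<and> y < p \<and> p \<le> 4 * T}" and ?B = "{p. prime p \<and> 4 * T < p \<and> y < p \<and> p \<le> 7 * T ^ 2}"
  have good: "\<not> int p dvd 397290" if "p > y" for p
    using that y by (auto dest!: zdvd_imp_le)
  have fA: "finite ?A" by (rule finite_subset[OF _ finite_primes_le[of "4 * T"]]) auto
  have fB: "finite ?B" by (rule finite_subset[OF _ finite_primes_le[of "7 * T ^ 2"]]) auto
  have fS: "finite (?S p)" for p by (rule finite_subset[OF _ finite_admissible_box[of T]]) auto
  have "{P \<in> admissible_box T. \<exists>p>y. prime p \<and> int p ^ 2 dvd sextic_at P} \<subseteq> (\<Union>p\<in>?A. ?S p) \<union> (\<Union>p\<in>?B. ?S p)"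
  proof
    fix P assume "P \<in> {P \<in> admissible_box T. \<exists>p>y. prime p \<and> int p ^ 2 dvd sextic_at P}"
    then obtain p where p: "P \<in> admissible_box T" "p > y" "prime p" "int p ^ 2 dvd sextic_at P" by blast
    then have "p \<in> ?A \<or> p \<in> ?B" using large_prime_square_dvd_bound[OF p(1,3) good[OF p(2)] _ p(4)] by force
    then show "P \<in> (\<Union>p\<in>?A. ?S p) \<union> (\<Union>p\<in>?B. ?S p)" using p by blast
  qed
  then have "card {P \<in> admissible_box T. \<exists>p>y. prime p \<and> int p ^ 2 dvd sextic_at P}
      \<le> card ((\<Union>p\<in>?A. ?S p) \<union> (\<Union>p\<in>?B. ?S p))"
    by (intro card_mono finite_UnI finite_UN_I fA fB fS)
  also have "\<dots> \<le> card (\<Union>p\<in>?A. ?S p) + card (\<Union>p\<in>?B. ?S p)" by (rule card_Un_le)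
  also have "\<dots> \<le> (\<Sum>p\<in>?A. card (?S p)) + (\<Sum>p\<in>?B. card (?S p))"
    by (intro add_mono card_UN_le fA fB)
  finally have "real (card {P \<in> admissible_box T. \<exists>p>y. prime p \<and> int p ^ 2 dvd sextic_at P})
      \<le> real ((\<Sum>p\<in>?A. card (?S p)) + (\<Sum>p\<in>?B. card (?S p)))" by (rule of_nat_mono)
  also have "\<dots> = (\<Sum>p\<in>?A. real (card (?S p))) + (\<Sum>p\<in>?B. real (card (?S p)))" by simp
  also have "(\<Sum>p\<in>?A. real (card (?S p))) \<le> (\<Sum>p\<in>?A. 6 * real T * (T / real p ^ 2 + 1))"
    by (intro sum_mono card_box_prime_power_dvd good) auto
  also have "\<dots> = 6 * real T * (T * (\<Sum>p\<in>?A. 1 / real p ^ 2) + card ?A)"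
    by (simp add: sum_distrib_left sum.distrib algebra_simps)
  also have "\<dots> \<le> 6 * real T * (T / y + card {p::nat. prime p \<and> p \<le> 4 * T})"
  proof (intro mult_left_mono add_mono)
    have "(\<Sum>p\<in>?A. 1 / real p ^ 2) \<le> (\<Sum>p\<in>{y<..4 * T}. 1 / real p ^ 2)"
      by (rule sum_mono2) auto
    also have "\<dots> \<le> 1 / y" using y by (intro sum_inverse_squares_le) auto
    finally show "T * (\<Sum>p\<in>?A. 1 / real p ^ 2) \<le> T / y"
      using mult_left_mono[of _ "1 / real y" "real T"] by simp
    show "real (card ?A) \<le> real (card {p::nat. prime p \<and> p \<le> 4 * T})"
      unfolding of_nat_le_iff by (rule card_mono[OF finite_primes_le]) auto
  qed auto
  also have "(\<Sum>p\<in>?B. real (card (?S p))) \<le> (\<Sum>p\<in>?B. 6)"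
  proof (rule sum_mono)
    fix p assume p: "p \<in> ?B"
    have "card (?S p) \<le> 6" by (rule card_box_large_prime_square_dvd) (use p good in auto)
    then show "real (card (?S p)) \<le> 6" by simp
  qed
  also have "\<dots> \<le> 6 * card {p::nat. prime p \<and> p \<le> 7 * T ^ 2}"
  proof -
    have "card ?B \<le> card {p::nat. prime p \<and> p \<le> 7 * T ^ 2}"
      by (rule card_mono[OF finite_primes_le]) auto
    then show ?thesis by simp
  qed
  finally show ?thesis by simp
qed

text \<open>As \<open>T / p^(K p)\<close> is at most \<open>y\<close>, each prime accounts for at
  most \<open>6T(y + 1)\<close> points; the total of order \<open>T y^2\<close> is small against
  \<open>T^2\<close> once \<open>T\<close> is at least \<open>y^3\<close>.\<close>

lemma card_box_high_power_dvd:
  assumes K: "\<And>p. prime p \<Longrightarrow> p \<le> y \<Longrightarrow> K p > 0 \<and> T \<le> y * p ^ K p"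
  shows "real (card {P \<in> admissible_box T. \<exists>p\<le>y. prime p \<and> \<not> int p dvd 397290 \<and> int p ^ K p dvd sextic_at P})
    \<le> 6 * real T * y * (real y + 1)"
proof -
  let ?S = "\<lambda>p. {P \<in> admissible_box T. int p ^ K p dvd sextic_at P}"
  let ?A = "{p. prime p \<and> p \<le> y \<and> \<not> int p dvd 397290}"
  have fA: "finite ?A" by (rule finite_subset[OF _ finite_primes_le[of y]]) auto
  have fS: "finite (?S p)" for p by (rule finite_subset[OF _ finite_admissible_box[of T]]) auto
  have "{P \<in> admissible_box T. \<exists>p\<le>y. prime p \<and> \<not> int p dvd 397290 \<and> int p ^ K p dvd sextic_at P}
      = (\<Union>p\<in>?A. ?S p)" by blast
  then have "card {P \<in> admissible_box T. \<exists>p\<le>y. prime p \<and> \<not> int p dvd 397290 \<and> int p ^ K p dvd sextic_at P}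
      \<le> (\<Sum>p\<in>?A. card (?S p))" using card_UN_le[OF fA] by simp
  then have "real (card {P \<in> admissible_box T. \<exists>p\<le>y. prime p \<and> \<not> int p dvd 397290 \<and> int p ^ K p dvd sextic_at P})
      \<le> (\<Sum>p\<in>?A. real (card (?S p)))" by (simp flip: of_nat_sum)
  also have "\<dots> \<le> (\<Sum>p\<in>?A. 6 * real T * (real y + 1))"
  proof (rule sum_mono)
    fix p assume p: "p \<in> ?A"
    have "real (card (?S p)) \<le> 6 * real T * (T / real p ^ K p + 1)"
      by (rule card_box_prime_power_dvd) (use p K in auto)
    also have "\<dots> \<le> 6 * real T * (real y + 1)"
    proof (intro mult_left_mono add_right_mono)
      have "T \<le> y * p ^ K p" using p K by blast
      then have "real T \<le> y * real p ^ K p" by (metis of_nat_le_iff of_nat_mult of_nat_power)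
      then show "T / real p ^ K p \<le> y" using p by (simp add: divide_le_eq prime_gt_0_nat)
    qed auto
    finally show "real (card (?S p)) \<le> 6 * real T * (real y + 1)" .
  qed
  also have "\<dots> = card ?A * (6 * real T * (real y + 1))" by simp
  also have "\<dots> \<le> y * (6 * real T * (real y + 1))"
  proof (intro mult_right_mono)
    have "?A \<subseteq> {1..y}" by (auto dest: prime_gt_0_nat)
    then have "card ?A \<le> card {1..y}" by (intro card_mono) auto
    then show "real (card ?A) \<le> y" by simp
  qed auto
  finally show ?thesis by (simp only: mult_ac)
qed

text \<open>The logarithm of the part of the sextic value composed of good primes up to \<open>y\<close>, with the
  exponent of \<open>p\<close> capped at \<open>K p\<close>.\<close>

definition smooth_weight :: "nat \<Rightarrow> (nat \<Rightarrow> nat) \<Rightarrow> int \<times> int \<Rightarrow> real" where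
  "smooth_weight y K P = (\<Sum>p | prime p \<and> p \<le> y \<and> \<not> int p dvd 397290.
     \<Sum>k\<in>{1..K p}. if int p ^ k dvd sextic_at P then ln p else 0)"

lemma sum_geometric_le:
  fixes p :: nat assumes "p \<ge> 2"
  shows "(\<Sum>k\<in>{1..n}. 1 / real p ^ k) \<le> 2 / p"
proof -
  \<comment> \<open>Strengthened for the induction by the exact tail of the geometric series; the
    complete series is \<open>1 / (p - 1)\<close>, at most \<open>2 / p\<close>.\<close>
  have "(\<Sum>k\<in>{1..n}. 1 / real p ^ k) \<le> 2 / p - 1 / (real p ^ n * (real p - 1))"
  proof (induction n)
    case 0
    have "1 / (real p - 1) \<le> 2 / p \<longleftrightarrow> real p \<le> 2 * (real p - 1)" using assms by (simp add: field_simps)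
    then show ?case using assms by simp
  next
    case (Suc n)
    have "real p \<noteq> 0" "real p - 1 \<noteq> 0" "real p ^ n \<noteq> 0" using assms by auto
    then have "1 / real p ^ Suc n = 1 / (real p ^ n * (real p - 1)) - 1 / (real p ^ Suc n * (real p - 1))"
      by (simp add: divide_simps)
    then show ?case using Suc by (simp add: sum.cl_ivl_Suc)
  qed
  also have "\<dots> \<le> 2 / p" using assms by simp
  finally show ?thesis .
qed

text \<open>A first moment, obtained by exchanging the sums. For \<open>p^k \<le> T\<close> the
  rounding term is absorbed and at most \<open>12T^2 / p^k\<close> points count; the geometric
  series in \<open>k\<close> and the bound on the sum of \<open>ln p / p\<close> supply two further
  factors of 2.\<close>

lemma sum_smooth_weight_le:
  assumes y: "y \<ge> 1" and K: "\<And>p. prime p \<Longrightarrow> p \<le> y \<Longrightarrow> p ^ K p \<le> T"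
  shows "(\<Sum>P\<in>admissible_box T. smooth_weight y K P) \<le> 48 * real T ^ 2 * ln y"
proof -
  let ?A = "{p. prime p \<and> p \<le> y \<and> \<not> int p dvd 397290}"
  let ?S = "\<lambda>p k. {P \<in> admissible_box T. int p ^ k dvd sextic_at P}"
  have fA: "finite ?A" by (rule finite_subset[OF _ finite_primes_le[of y]]) auto
  have "(\<Sum>P\<in>admissible_box T. smooth_weight y K P)
      = (\<Sum>p\<in>?A. \<Sum>P\<in>admissible_box T. \<Sum>k\<in>{1..K p}. if int p ^ k dvd sextic_at P then ln p else 0)"
    unfolding smooth_weight_def by (rule sum.swap)
  also have "\<dots> = (\<Sum>p\<in>?A. \<Sum>k\<in>{1..K p}. \<Sum>P\<in>admissible_box T. if int p ^ k dvd sextic_at P then ln p else 0)"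
    by (intro sum.cong refl sum.swap)
  also have "\<dots> = (\<Sum>p\<in>?A. \<Sum>k\<in>{1..K p}. ln p * card (?S p k))"
    by (intro sum.cong refl) (simp add: sum.If_cases Int_def mult.commute)
  also have "\<dots> \<le> (\<Sum>p\<in>?A. \<Sum>k\<in>{1..K p}. ln p * (12 * real T ^ 2 * (1 / real p ^ k)))"
  proof (intro sum_mono mult_left_mono)
    fix p k assume p: "p \<in> ?A" and k: "k \<in> {1..K p}"
    have p0: "p > 0" using p by (auto dest: prime_gt_0_nat)
    have "p ^ k \<le> p ^ K p" using k p0 by (intro power_increasing) auto
    also have "\<dots> \<le> T" using K p by auto
    finally have "real p ^ k \<le> T" by (metis of_nat_le_iff of_nat_power)
    then have "1 \<le> T / real p ^ k" using p0 by (simp add: le_divide_eq)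
    then have "6 * real T * (T / real p ^ k + 1) \<le> 6 * real T * (T / real p ^ k + T / real p ^ k)"
      by (intro mult_left_mono add_left_mono) auto
    then show "real (card (?S p k)) \<le> 12 * real T ^ 2 * (1 / real p ^ k)"
      using card_box_prime_power_dvd[of p k T] p k by (simp add: power2_eq_square)
    show "0 \<le> ln (real p)" using p0 by simp
  qed
  also have "\<dots> = (\<Sum>p\<in>?A. ln p * (12 * real T ^ 2 * (\<Sum>k\<in>{1..K p}. 1 / real p ^ k)))"
    by (simp add: sum_distrib_left)
  also have "\<dots> \<le> (\<Sum>p\<in>?A. ln p * (12 * real T ^ 2 * (2 / p)))"
    by (intro sum_mono mult_left_mono sum_geometric_le) (auto dest: prime_ge_2_nat prime_gt_0_nat)
  also have "\<dots> = 24 * real T ^ 2 * (\<Sum>p\<in>?A. ln p / p)"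
    by (simp add: sum_distrib_left mult_ac)
  also have "\<dots> \<le> 24 * real T ^ 2 * (\<Sum>p | prime p \<and> p \<le> y. ln (real p) / real p)"
    by (intro mult_left_mono sum_mono2 finite_primes_le) (auto dest: prime_gt_0_nat)
  also have "\<dots> \<le> 24 * real T ^ 2 * (2 * ln y)"
    by (intro mult_left_mono sum_ln_prime_over_prime_le y) auto
  finally show ?thesis by simp
qed

text \<open>Markov's inequality: the weights sum to at most \<open>48 T^2 ln y\<close>, while
  \<open>ln T = J ln y\<close>. A large \<open>J\<close> therefore makes the exceptional proportion
  as small as desired.\<close>

lemma card_box_smooth_weight:
  assumes y: "y \<ge> 2" "J > 0" and K: "\<And>p. prime p \<Longrightarrow> p \<le> y \<Longrightarrow> p ^ K p \<le> T" and T: "T = y ^ J"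
  shows "real (card {P \<in> admissible_box T. smooth_weight y K P \<ge> 2 * ln T}) \<le> 24 * real T ^ 2 / J"
proof -
  let ?B = "{P \<in> admissible_box T. smooth_weight y K P \<ge> 2 * ln T}"
  have nn: "smooth_weight y K P \<ge> 0" for P
    unfolding smooth_weight_def by (intro sum_nonneg) (auto dest: prime_gt_0_nat)
  have "card ?B * (2 * ln T) = (\<Sum>P\<in>?B. 2 * ln T)" by simp
  also have "\<dots> \<le> (\<Sum>P\<in>?B. smooth_weight y K P)" by (rule sum_mono) auto
  also have "\<dots> \<le> (\<Sum>P\<in>admissible_box T. smooth_weight y K P)" by (rule sum_mono2) (auto simp: nn)
  also have "\<dots> \<le> 48 * real T ^ 2 * ln y" by (rule sum_smooth_weight_le) (use y K in auto)
  finally have "card ?B * (2 * ln T) \<le> 48 * real T ^ 2 * ln y" .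
  moreover have "ln T = J * ln y" using y T by (simp add: ln_realpow)
  ultimately have "(card ?B * J) * (2 * ln y) \<le> 24 * real T ^ 2 * (2 * ln y)" by (simp add: mult_ac)
  moreover have "2 * ln (real y) > 0" using y by simp
  ultimately have "card ?B * J \<le> 24 * real T ^ 2" by (simp only: mult_le_cancel_right_pos)
  then show ?thesis using y by (simp add: le_divide_eq)
qed

section \<open>Large prime factors and the fibres of the squarefree part\<close>

definition rough_primes :: "nat \<Rightarrow> int \<times> int \<Rightarrow> nat set" where
  "rough_primes y P = {p. prime p \<and> y < p \<and> int p dvd sextic_at P}"

lemma finite_rough_primes:
  assumes "P \<in> admissible_box T"
  shows "finite (rough_primes y P)"
proof (rule finite_subset)
  show "rough_primes y P \<subseteq> {..nat (sextic_at P)}"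
    using sextic_at_pos[OF assms] by (auto simp: rough_primes_def dest!: zdvd_imp_le)
qed simp

text \<open>The value is at least \<open>T^6 / 300\<close>. Its part at the excluded primes is at
  most 2, its part at the remaining primes up to \<open>y\<close> is at most \<open>T^2\<close> by
  the weight, and the rest is a product of distinct rough primes.\<close>

lemma prod_rough_primes_ge:
  assumes P: "P \<in> admissible_box T" and T: "T > 0"
    and square: "\<And>p. prime p \<Longrightarrow> p > y \<Longrightarrow> \<not> int p ^ 2 dvd sextic_at P"
    and high: "\<And>p. prime p \<Longrightarrow> p \<le> y \<Longrightarrow> \<not> int p dvd 397290 \<Longrightarrow> \<not> int p ^ K p dvd sextic_at P"
    and weight: "smooth_weight y K P < 2 * ln T"
  shows "T ^ 4 \<le> 600 * \<Prod>(rough_primes y P)"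
proof -
  define e where "e = nat (sextic_at P)"
  have e0: "e > 0" using sextic_at_pos[OF P] by (simp add: e_def)
  have ie: "int e = sextic_at P" using sextic_at_pos[OF P] by (simp add: e_def)
  have dvd_e: "m dvd e \<longleftrightarrow> int m dvd sextic_at P" for m by (simp flip: ie)
  have adm: "admissible (fst P) (snd P)" using P by (auto simp: admissible_box_def)
  define F1 where "F1 = {p \<in> prime_factors e. p \<le> y \<and> int p dvd 397290}"
  define F2 where "F2 = {p \<in> prime_factors e. p \<le> y \<and> \<not> int p dvd 397290}"
  define F3 where "F3 = {p \<in> prime_factors e. y < p}"
  have fin: "finite F1" "finite F2" "finite F3" by (simp_all add: F1_def F2_def F3_def)
  have "prime_factors e = F1 \<union> (F2 \<union> F3)" by (auto simp: F1_def F2_def F3_def)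
  moreover have "F1 \<inter> (F2 \<union> F3) = {}" "F2 \<inter> F3 = {}" by (auto simp: F1_def F2_def F3_def)
  moreover have "e = (\<Prod>p\<in>prime_factors e. p ^ multiplicity p e)"
    using e0 by (simp add: prod_prime_factors)
  ultimately have split: "e = (\<Prod>p\<in>F1. p ^ multiplicity p e) * ((\<Prod>p\<in>F2. p ^ multiplicity p e)
      * (\<Prod>p\<in>F3. p ^ multiplicity p e))"
    using fin by (simp add: prod.union_disjoint)
  have c1: "(\<Prod>p\<in>F1. p ^ multiplicity p e) \<le> 2"
  proof -
    have "F1 \<subseteq> {2}"
    proof
      fix p assume "p \<in> F1"
      then have p: "prime p" "int p dvd 397290" "int p dvd sextic_at P"
        by (auto simp: F1_def in_prime_factors_iff dvd_e)
      have "\<not> int p dvd 198645"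
        using admissible_sextic_dvd(3)[OF adm _ p(3)] p(1) by (metis not_prime_unit prime_nat_int_transfer)
      moreover have "int p dvd 2 * 198645" using p(2) by simp
      ultimately have "int p dvd 2" using p(1) by (metis prime_dvd_mult_iff prime_nat_int_transfer)
      then have "p \<le> 2" by (auto dest: zdvd_imp_le)
      then show "p \<in> {2}" using prime_ge_2_nat[OF p(1)] by simp
    qed
    moreover have "multiplicity 2 e \<le> 1"
    proof (rule ccontr)
      assume "\<not> multiplicity 2 e \<le> 1"
      then have "2 ^ 2 dvd e" by (intro multiplicity_dvd') auto
      then have "4 dvd e" by simp
      then show False using admissible_sextic_dvd(1)[OF adm] dvd_e[of 4] by simp
    qed
    then have "2 ^ multiplicity 2 e \<le> (2 ^ 1 :: nat)" by (intro power_increasing) auto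
    ultimately show ?thesis by (cases "F1 = {}") (auto simp: subset_singleton_iff)
  qed
  have c2: "real (\<Prod>p\<in>F2. p ^ multiplicity p e) \<le> real T ^ 2"
  proof -
    let ?A = "{p. prime p \<and> p \<le> y \<and> \<not> int p dvd 397290}"
    have pos: "p > 0" if "p \<in> F2" for p using that by (auto simp: F2_def in_prime_factors_iff prime_gt_0_nat)
    have fA: "finite ?A" by (rule finite_subset[OF _ finite_primes_le[of y]]) auto
    have "ln (real (\<Prod>p\<in>F2. p ^ multiplicity p e)) = ln (\<Prod>p\<in>F2. real p ^ multiplicity p e)" by simp
    also have "\<dots> = (\<Sum>p\<in>F2. ln (real p ^ multiplicity p e))"
      by (rule ln_prod) (use fin pos in auto)
    also have "\<dots> = (\<Sum>p\<in>F2. multiplicity p e * ln p)"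
      using pos by (intro sum.cong) (auto simp: ln_realpow)
    also have "\<dots> \<le> (\<Sum>p\<in>F2. \<Sum>k\<in>{1..K p}. if int p ^ k dvd sextic_at P then ln p else 0)"
    proof (rule sum_mono)
      fix p assume p: "p \<in> F2"
      \<comment> \<open>The multiplicity stays below the cap \<open>K p\<close>, so the capped
        weight counts it in full.\<close>
      have "\<not> p ^ K p dvd e" using high[of p] p by (auto simp: F2_def in_prime_factors_iff dvd_e)
      then have "multiplicity p e < K p" by (meson multiplicity_dvd' not_less)
      then have sub: "{1..multiplicity p e} \<subseteq> {1..K p}" by auto
      have "multiplicity p e * ln p = (\<Sum>k\<in>{1..multiplicity p e}. ln p)" by simp
      also have "\<dots> = (\<Sum>k\<in>{1..multiplicity p e}. if int p ^ k dvd sextic_at P then ln p else 0)"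
      proof (rule sum.cong)
        fix k assume "k \<in> {1..multiplicity p e}"
        then have "p ^ k dvd e" by (intro multiplicity_dvd') auto
        then show "ln p = (if int p ^ k dvd sextic_at P then ln p else 0)" by (simp add: dvd_e)
      qed simp
      also have "\<dots> \<le> (\<Sum>k\<in>{1..K p}. if int p ^ k dvd sextic_at P then ln p else 0)"
        using sub pos[OF p] by (intro sum_mono2) auto
      finally show "multiplicity p e * ln p \<le> (\<Sum>k\<in>{1..K p}. if int p ^ k dvd sextic_at P then ln p else 0)" .
    qed
    also have "\<dots> \<le> smooth_weight y K P" unfolding smooth_weight_def
      using fA by (intro sum_mono2) (auto simp: F2_def in_prime_factors_iff intro!: sum_nonneg dest: prime_gt_0_nat)
    also have "\<dots> < 2 * ln T" by (rule weight)
    also have "2 * ln T = ln (real T ^ 2)" using T by (simp add: ln_realpow)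
    finally have "ln (real (\<Prod>p\<in>F2. p ^ multiplicity p e)) < ln (real T ^ 2)" .
    moreover have "real (\<Prod>p\<in>F2. p ^ multiplicity p e) > 0"
      unfolding of_nat_0_less_iff by (intro prod_pos) (use pos in auto)
    ultimately show ?thesis using T by (subst (asm) ln_less_cancel_iff) auto
  qed
  have F3: "F3 = rough_primes y P"
    using e0 by (auto simp: F3_def rough_primes_def in_prime_factors_iff dvd_e)
  have c3: "(\<Prod>p\<in>F3. p ^ multiplicity p e) = \<Prod>(rough_primes y P)"
    unfolding F3[symmetric]
  proof (rule prod.cong)
    fix p assume p: "p \<in> F3"
    then have pp: "prime p" "p dvd e" "p > y" by (auto simp: F3_def in_prime_factors_iff)
    have "\<not> p ^ 2 dvd e" using square[OF pp(1,3)] by (simp add: dvd_e)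
    then have "multiplicity p e < 2" by (meson multiplicity_dvd' not_less)
    moreover have "multiplicity p e > 0" using pp e0 by (simp add: prime_multiplicity_gt_zero_iff)
    ultimately have "multiplicity p e = 1" by simp
    then show "p ^ multiplicity p e = p" by simp
  qed simp
  have "real (\<Prod>p\<in>F1. p ^ multiplicity p e) \<le> 2" using of_nat_mono[OF c1, where 'a = real] by (simp only: of_nat_numeral)
  moreover have "real e = real (\<Prod>p\<in>F1. p ^ multiplicity p e) * (real (\<Prod>p\<in>F2. p ^ multiplicity p e)
      * real (\<Prod>(rough_primes y P)))"
    using arg_cong[OF split[unfolded c3], of real] by (simp only: of_nat_mult)
  ultimately have "real e \<le> 2 * (real T ^ 2 * real (\<Prod>(rough_primes y P)))"
    using c2 by (simp only:) (intro mult_mono mult_nonneg_nonneg of_nat_0_le_iff order_refl; simp)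
  moreover have "T ^ 6 \<le> 300 * e"
    using admissible_box_bounds(1)[of "fst P" "snd P" T] P by (simp flip: ie add: of_nat_power[symmetric] del: of_nat_power)
  then have "real (T ^ 6) \<le> real (300 * e)" by (rule of_nat_mono)
  ultimately have "real T ^ 2 * real T ^ 4 \<le> real T ^ 2 * (600 * real (\<Prod>(rough_primes y P)))"
    by (simp flip: power_add)
  moreover have "real T ^ 2 > 0" using T by simp
  ultimately have "real T ^ 4 \<le> 600 * real (\<Prod>(rough_primes y P))"
    by (simp only: mult_le_cancel_left_pos)
  then have "real (T ^ 4) \<le> real (600 * \<Prod>(rough_primes y P))"
    by (simp only: of_nat_mult of_nat_power of_nat_numeral)
  then show ?thesis by (simp only: of_nat_le_iff)
qed

text \<open>Each rough prime exceeds \<open>y\<close>, and their product divides a value of size at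
  most \<open>T^6 = y^(6J)\<close>.\<close>

lemma card_rough_primes_le:
  assumes P: "P \<in> admissible_box (y ^ J)" and y: "y \<ge> 2"
  shows "card (rough_primes y P) \<le> 6 * J"
proof -
  have "\<Prod>(rough_primes y P) dvd nat (sextic_at P)"
  proof (intro prod_coprime_dvd[where f = "\<lambda>x. x"] finite_rough_primes[OF P])
    fix p assume "p \<in> rough_primes y P"
    then have "int p dvd int (nat (sextic_at P))"
      using sextic_at_pos[OF P] by (simp add: rough_primes_def)
    then show "p dvd nat (sextic_at P)" by (simp only: int_dvd_int_iff)
  qed (auto simp: rough_primes_def primes_coprime)
  then have "\<Prod>(rough_primes y P) \<le> nat (sextic_at P)"
    using sextic_at_pos[OF P] by (intro dvd_imp_le) auto
  also have "\<dots> \<le> (y ^ J) ^ 6"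
    using admissible_box_bounds(2)[of "fst P" "snd P" "y ^ J"] P by (simp add: nat_le_iff)
  also have "\<dots> = y ^ (6 * J)" by (simp flip: power_mult add: mult.commute)
  finally have "\<Prod>(rough_primes y P) \<le> y ^ (6 * J)" .
  moreover have "y ^ card (rough_primes y P) = (\<Prod>p\<in>rough_primes y P. y)" by simp
  moreover have "(\<Prod>p\<in>rough_primes y P. y) \<le> (\<Prod>p\<in>rough_primes y P. p)"
    by (rule prod_mono) (auto simp: rough_primes_def)
  ultimately have "y ^ card (rough_primes y P) \<le> y ^ (6 * J)" by simp
  then show ?thesis using y by (simp add: power_increasing_iff)
qed

text \<open>A point of the fibre is determined by its ratio modulo each of the boundedly many rough
  primes, because the product of these exceeds the determinant of any two points of the box.\<close>

lemma card_squarefree_part_fibre: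
  assumes G: "G \<subseteq> admissible_box (y ^ J)" and y: "y \<ge> 397290"
    and rough: "\<And>P. P \<in> G \<Longrightarrow> int (\<Prod>(rough_primes y P)) > 3 * int (y ^ J) ^ 2"
    and square: "\<And>P p. P \<in> G \<Longrightarrow> prime p \<Longrightarrow> p > y \<Longrightarrow> \<not> int p ^ 2 dvd sextic_at P"
  shows "card {P \<in> G. squarefree_part (nat (sextic_at P)) = d} \<le> 6 ^ (6 * J)"
proof (cases "{P \<in> G. squarefree_part (nat (sextic_at P)) = d} = {}")
  case False
  define F where "F = {P \<in> G. squarefree_part (nat (sextic_at P)) = d}"
  have fF: "finite F" unfolding F_def by (rule finite_subset[of _ "admissible_box (y ^ J)"]) (use G in auto)
  obtain P0 where P0: "P0 \<in> F" using False unfolding F_def by blast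
  define R where "R = rough_primes y P0"
  have P0b: "P0 \<in> admissible_box (y ^ J)" using P0 G by (auto simp: F_def)
  have fR: "finite R" unfolding R_def by (rule finite_rough_primes[OF P0b])
  have good: "\<not> int p dvd 397290" if "p \<in> R" for p
    using that y by (auto simp: R_def rough_primes_def dest!: zdvd_imp_le)
  have pR: "prime p" if "p \<in> R" for p using that by (simp add: R_def rough_primes_def)
  \<comment> \<open>A rough prime divides the value at \<open>P0\<close> exactly once, so it divides
    the squarefree part \<open>d\<close>, and hence the value at every point of the fibre.\<close>
  have root: "\<exists>t. t \<in> sextic_roots (int p) \<and> int p dvd fst P - t * snd P" if P: "P \<in> F" and p: "p \<in> R" for P p
  proof -
    have Pb: "P \<in> admissible_box (y ^ J)" using P G by (auto simp: F_def)
    define e0 where "e0 = nat (sextic_at P0)"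
    define e where "e = nat (sextic_at P)"
    have ie: "int e0 = sextic_at P0" "int e = sextic_at P"
      using sextic_at_pos[OF P0b] sextic_at_pos[OF Pb] by (simp_all add: e0_def e_def)
    have sf: "squarefree_part e0 = squarefree_part e" using P P0 by (simp add: F_def e0_def e_def)
    have pd: "p dvd e0" "\<not> p ^ 2 dvd e0"
      using p square[of P0 p] P0 by (auto simp: R_def rough_primes_def F_def simp flip: ie)
    have "\<not> p dvd square_part e0" using pd(2) by (simp add: dvd_square_part_iff)
    moreover have "p dvd squarefree_part e0 * square_part e0 ^ 2"
      using pd(1) squarefree_decompose[of e0] by simp
    ultimately have "p dvd squarefree_part e0" using pR[OF p] by (meson prime_dvd_mult_iff prime_dvd_power)
    then have "p dvd e" using sf squarefree_decompose[of e] by (metis dvd_mult2)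
    then have "int p ^ 1 dvd sextic_at P" by (simp flip: ie)
    from sextic_root_of_box[OF Pb pR[OF p] good[OF p] this] show ?thesis by auto
  qed
  \<comment> \<open>The family of ratios of \<open>P\<close> modulo all rough primes of
    \<open>P0\<close>. It takes at most \<open>6 ^ card R\<close> values and determines
    \<open>P\<close> by the Chinese remainder principle.\<close>
  define r where "r P = (\<lambda>p\<in>R. SOME t. t \<in> sextic_roots (int p) \<and> int p dvd fst P - t * snd P)" for P
  have r: "r P p \<in> sextic_roots (int p)" "int p dvd fst P - r P p * snd P" if "P \<in> F" "p \<in> R" for P p
    using someI_ex[OF root[OF that]] that(2) by (auto simp: r_def)
  have "inj_on r F"
  proof (rule inj_onI)
    fix P P' assume P: "P \<in> F" "P' \<in> F" "r P = r P'"
    obtain u v u' v' where uv: "P = (u, v)" "P' = (u', v')" by (cases P, cases P')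
    have "int p dvd u * v' - u' * v" if p: "p \<in> R" for p
    proof -
      have "int p dvd (u - r P p * v) * v' - (u' - r P p * v') * v"
        by (rule dvd_diff; rule dvd_mult2) (use r(2)[OF P(1) p] r(2)[OF P(2) p] P(3) uv in auto)
      then show ?thesis by (simp add: algebra_simps)
    qed
    then have "(\<Prod>p\<in>R. int p) dvd u * v' - u' * v"
      using fR pR by (intro prod_coprime_dvd) (auto intro: primes_coprime)
    moreover have "(\<Prod>p\<in>R. int p) > 3 * int (y ^ J) ^ 2"
      using rough[of P0] P0 by (simp add: R_def F_def)
    ultimately show "P = P'"
      using admissible_box_eqI[of u v "y ^ J" u' v' "\<Prod>p\<in>R. int p"] P G uv unfolding F_def by blast
  qed
  moreover have "r ` F \<subseteq> (\<Pi>\<^sub>E p\<in>R. sextic_roots (int p))"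
    using r by (auto simp: r_def)
  ultimately have "card F \<le> card (\<Pi>\<^sub>E p\<in>R. sextic_roots (int p))"
    by (intro card_inj_on_le finite_PiE fR) auto
  also have "\<dots> = (\<Prod>p\<in>R. card (sextic_roots (int p)))" by (rule card_PiE[OF fR])
  also have "\<dots> \<le> (\<Prod>p\<in>R. 6)"
    using card_sextic_roots[of "int _" 1] good pR by (intro prod_mono) auto
  also have "\<dots> = 6 ^ card R" by simp
  also have "\<dots> \<le> 6 ^ (6 * J)"
    using card_rough_primes_le[OF P0b] y by (intro power_increasing) (auto simp: R_def)
  finally show ?thesis by (simp add: F_def)
qed (simp only: card.empty zero_le)

text \<open>From all pairs in the two residue classes one removes those with a common prime factor.
  Such a prime is at least 7, because 8277 and 2915 are coprime and the modulus contains 2, 3 and 5;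
  this keeps the loss below the main term.\<close>

lemma card_admissible_box_ge:
  fixes T :: nat
  defines "M \<equiv> 188853390660 :: real"
  assumes T: "T \<ge> 188853390660"
  shows "real (card (admissible_box T)) \<ge> (T / M - 1)\<^sup>2 - (T / M)\<^sup>2 / 3 - 4 * T"
proof -
  define m :: int where "m = 188853390660"
  have m0: "m > 0" and Mm: "M = m" by (simp_all add: m_def M_def)
  let ?I = "{int T<..int T + int T}"
  define U where "U = {u \<in> ?I. m dvd u - 8277}"
  define V where "V = {u \<in> ?I. m dvd u - 2915}"
  define C where "C p c = {u \<in> ?I. m dvd u - c \<and> p dvd u}" for p c :: int
  define Q where "Q = {p. prime p \<and> 7 \<le> p \<and> p \<le> 2 * T \<and> \<not> int p dvd m}"
  have fin: "finite U" "finite V" "finite (C p c)" for p c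
    by (rule finite_subset[of _ ?I]; auto simp: U_def V_def C_def)+
  have finQ: "finite Q" by (rule finite_subset[OF _ finite_primes_le[of "2 * T"]]) (auto simp: Q_def)
  have modU: "u mod m = c \<longleftrightarrow> m dvd u - c" if "c \<ge> 0" "c < m" for u c
    using that by (metis mod_eq_dvd_iff mod_pos_pos_trivial)
  have "U \<times> V \<subseteq> admissible_box T \<union> (\<Union>p\<in>Q. C p 8277 \<times> C p 2915)"
  proof
    fix P assume "P \<in> U \<times> V"
    then obtain u v where uv: "P = (u, v)" "u \<in> U" "v \<in> V" by auto
    show "P \<in> admissible_box T \<union> (\<Union>p\<in>Q. C p 8277 \<times> C p 2915)"
    proof (cases "coprime u v")
      case True
      have "u mod m = 8277" "v mod m = 2915" using uv modU by (auto simp: U_def V_def m_def)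
      then show ?thesis using True uv
        by (auto simp: admissible_box_def admissible_def U_def V_def m_def)
    next
      case False
      have u0: "u > 0" "u \<le> 2 * int T" using uv by (auto simp: U_def)
      have "gcd u v \<noteq> 1" using False by (simp add: coprime_iff_gcd_eq_1)
      moreover have "gcd u v \<noteq> 0" using u0 by simp
      ultimately obtain p where p: "prime p" "p dvd gcd u v"
        by (metis prime_factor_int gcd_ge_0_int abs_of_nonneg)
      then have pu: "p dvd u" "p dvd v" by auto
      have npm: "\<not> p dvd m"
      proof
        assume pm: "p dvd m"
        have "p dvd u - 8277" "p dvd v - 2915"
          using uv dvd_trans[OF pm] by (auto simp: U_def V_def)
        then have "p dvd u - (u - 8277)" "p dvd v - (v - 2915)" using pu by (blast intro: dvd_diff)+
        then have "p dvd 8277" "p dvd 2915" by simp_all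
        \<comment> \<open>Bezout again: the difference is 1.\<close>
        then have "p dvd 2915 * 7658 - 8277 * 2697" by (intro dvd_diff dvd_mult2)
        then show False using p(1) by (simp add: not_prime_unit)
      qed
      define q where "q = nat p"
      have q: "int q = p" "prime q" using p(1) by (auto simp: q_def prime_ge_0_int)
      have "q \<noteq> 2" "q \<noteq> 3" "q \<noteq> 5" using npm q by (auto simp: m_def)
      moreover have "q \<ge> 2" using q(2) by (rule prime_ge_2_nat)
      moreover from this have "odd q" if "q \<noteq> 2" using q(2) that by (simp add: prime_odd_nat)
      ultimately have "7 \<le> q" by presburger
      moreover have "p \<le> u" using pu(1) u0(1) by (rule zdvd_imp_le)
      then have "q \<le> 2 * T" using q u0 by linarith
      ultimately have "q \<in> Q" using q npm by (simp add: Q_def)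
      moreover have "P \<in> C p 8277 \<times> C p 2915" using uv pu by (auto simp: C_def U_def V_def)
      ultimately show ?thesis using q by blast
    qed
  qed
  then have "card (U \<times> V) \<le> card (admissible_box T \<union> (\<Union>p\<in>Q. C p 8277 \<times> C p 2915))"
    using fin finQ by (intro card_mono) auto
  also have "\<dots> \<le> card (admissible_box T) + card (\<Union>p\<in>Q. C p 8277 \<times> C p 2915)" by (rule card_Un_le)
  also have "card (\<Union>p\<in>Q. C p 8277 \<times> C p 2915) \<le> (\<Sum>p\<in>Q. card (C p 8277 \<times> C p 2915))"
    using finQ by (rule card_UN_le)
  finally have "card (U \<times> V) \<le> card (admissible_box T) + (\<Sum>p\<in>Q. card (C p 8277 \<times> C p 2915))" by simp
  then have "real (card (U \<times> V)) \<le> real (card (admissible_box T) + (\<Sum>p\<in>Q. card (C p 8277 \<times> C p 2915)))"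
    by (rule of_nat_mono)
  then have 1: "real (card U) * real (card V) \<le> real (card (admissible_box T)) + (\<Sum>p\<in>Q. real (card (C p 8277)) * real (card (C p 2915)))"
    by (simp add: card_cartesian_product)
  have C: "real (card (C p c)) \<le> T / M / p + 1" if p: "p \<in> Q" for p c
  proof (cases "C p c = {}")
    case False
    then obtain u where u: "u \<in> C p c" by auto
    have pos: "m * int p > 0" using p m0 by (auto simp: Q_def prime_gt_0_nat)
    have "C p c \<subseteq> {w \<in> ?I. m * int p dvd w - u}"
    proof
      fix w assume w: "w \<in> C p c"
      have "m dvd (w - c) - (u - c)" by (rule dvd_diff) (use u w in \<open>auto simp: C_def\<close>)
      then have "m dvd w - u" by simp
      moreover have "int p dvd w - u" using u w by (simp add: C_def)
      moreover have "coprime m (int p)"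
        using p by (metis (mono_tags, lifting) Q_def coprime_commute mem_Collect_eq prime_imp_coprime prime_nat_int_transfer)
      ultimately have "m * int p dvd w - u" by (simp add: divides_mult)
      then show "w \<in> {w \<in> ?I. m * int p dvd w - u}" using w by (simp add: C_def)
    qed
    then have "card (C p c) \<le> card {w \<in> ?I. m * int p dvd w - u}"
      by (rule card_mono[rotated]) (rule finite_subset[of _ ?I], auto)
    also have "real \<dots> \<le> int T / (m * int p) + 1"
      by (rule card_residue_class_interval(1)[OF pos]) simp
    finally show ?thesis by (simp add: Mm)
  qed (simp add: M_def)
  have "(\<Sum>p\<in>Q. real (card (C p 8277)) * real (card (C p 2915))) \<le> (\<Sum>p\<in>Q. 2 * (T / M)\<^sup>2 * (1 / (real p)\<^sup>2) + 2)"
  proof (rule sum_mono)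
    fix p assume p: "p \<in> Q"
    have "real (card (C p 8277)) * real (card (C p 2915)) \<le> (T / M / p + 1) * (T / M / p + 1)"
      by (intro mult_mono C p) (auto simp: M_def)
    also have "\<dots> \<le> 2 * (T / M / p)\<^sup>2 + 2"
    proof -
      have "(z + 1) * (z + 1) \<le> 2 * z\<^sup>2 + 2" for z :: real
        using zero_le_power2[of "z - 1"] by (simp add: power2_eq_square algebra_simps)
      then show ?thesis .
    qed
    also have "(T / M / p)\<^sup>2 = (T / M)\<^sup>2 * (1 / (real p)\<^sup>2)"
      by (simp add: power_divide power_mult_distrib)
    finally show "real (card (C p 8277)) * real (card (C p 2915)) \<le> 2 * (T / M)\<^sup>2 * (1 / (real p)\<^sup>2) + 2" by simp
  qed
  \<comment> \<open>Extending the sum to all integers from 7 on is affordable: their inverse squares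
    sum to at most 1/6, which costs a third of the main term.\<close>
  also have "\<dots> \<le> (\<Sum>p\<in>{6<..2 * T}. 2 * (T / M)\<^sup>2 * (1 / (real p)\<^sup>2) + 2)"
    by (rule sum_mono2) (auto simp: Q_def)
  also have "\<dots> = 2 * (T / M)\<^sup>2 * (\<Sum>p\<in>{6<..2 * T}. 1 / (real p)\<^sup>2) + 2 * card {6<..2 * T}"
    by (simp only: sum.distrib sum_distrib_left sum_constant)
  also have "\<dots> \<le> 2 * (T / M)\<^sup>2 * (1 / real 6) + 2 * (2 * real T)"
    by (intro add_mono mult_left_mono sum_inverse_squares_le) auto
  finally have 2: "(\<Sum>p\<in>Q. real (card (C p 8277)) * real (card (C p 2915))) \<le> (T / M)\<^sup>2 / 3 + 4 * T" by simp
  have cU: "real (card U) \<ge> T / M - 1" "real (card V) \<ge> T / M - 1"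
    using card_residue_class_interval(2)[OF m0, of "int T" "int T"] by (simp_all add: U_def V_def Mm)
  have "T / M - 1 \<ge> 0" using T by (simp add: M_def)
  then have "(T / M - 1)\<^sup>2 \<le> real (card U) * real (card V)"
    unfolding power2_eq_square by (intro mult_mono cU) auto
  then show ?thesis using 1 2 by linarith
qed

theorem card_squarefree_parts:
  obtains J c where "J > 0" "c > 0"
    "eventually (\<lambda>y::nat. real (card ((\<lambda>P. squarefree_part (nat (sextic_at P))) ` admissible_box (y ^ J)))
       \<ge> c * real (y ^ J) ^ 2) sequentially"
proof -
  define M where "M = (188853390660 :: real)"
  define c where "c = 1 / (4 * M\<^sup>2)"
  \<comment> \<open>Large enough that Markov's bound \<open>24 / J\<close> is at most
    \<open>c / 4\<close>, and at least 3 so that \<open>y^3 \<le> T\<close>. Each of the three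
    exceptional sets then has at most \<open>c / 4 * T^2\<close> points, which leaves a quarter of
    the lower bound for the box.\<close>
  define J where "J = nat \<lceil>96 / c\<rceil> + 3"
  have c0: "c > 0" by (simp add: c_def M_def)
  have J3: "J \<ge> 3" by (simp add: J_def)
  have "96 / c \<le> J" unfolding J_def by linarith
  then have J: "24 / J \<le> c / 4" using c0 J3 by (simp add: field_simps)
  have lim: "filterlim (\<lambda>y::nat. y ^ J) at_top at_top"
    using J3 by (intro filterlim_at_top_mono[OF filterlim_ident] eventually_sequentiallyI[of 1]) (auto intro!: self_le_power)
  have lim2: "filterlim (\<lambda>y::nat. 4 * y ^ J) at_top at_top" "filterlim (\<lambda>y::nat. 7 * (y ^ J) ^ 2) at_top at_top"
    by (rule filterlim_at_top_mono[OF lim], simp)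
       (rule filterlim_at_top_mono[OF lim], simp add: power2_eq_square)
  have M0: "M > 0" by (simp add: M_def)
  have "eventually (\<lambda>T::nat. T \<ge> nat \<lceil>M * (5 + 10 * M)\<rceil>) at_top" by (rule eventually_ge_at_top)
  then have "eventually (\<lambda>T::nat. (T / M - 1)\<^sup>2 - (T / M)\<^sup>2 / 3 - 4 * T \<ge> c * T\<^sup>2) at_top"
  proof eventually_elim
    case (elim T)
    define x where "x = T / M"
    have T: "real T = M * x" using M0 by (simp add: x_def)
    have "M * (5 + 10 * M) \<le> M * x" using elim unfolding T[symmetric] by linarith
    then have x: "5 + 10 * M \<le> x" using M0 by simp
    then have "x * (5 + 10 * M) \<le> x * x" using M0 by (intro mult_left_mono) auto
    moreover have "0 \<le> x" "0 \<le> M * x" using x M0 by auto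
    ultimately have "(x - 1)\<^sup>2 - x\<^sup>2 / 3 - 4 * (M * x) \<ge> x\<^sup>2 / 4"
      by (simp add: power2_eq_square algebra_simps)
    moreover have "c * real T ^ 2 = x\<^sup>2 / 4" using M0 by (simp add: c_def x_def power_divide)
    ultimately show ?case using T unfolding x_def[symmetric] by linarith
  qed
  note ev1 = eventually_compose_filterlim[OF this lim]
  note ev2 = eventually_compose_filterlim[OF eventually_ge_at_top[of "188853390660 :: nat"] lim]
  have ev3: "eventually (\<lambda>y. real (card {p::nat. prime p \<and> p \<le> 4 * y ^ J}) \<le> c / 480 * real (4 * y ^ J)) at_top"
    using eventually_compose_filterlim[OF card_primes_smallo[of "c / 480"] lim2(1)] c0 by (simp only: divide_pos_pos zero_less_numeral)
  have ev4: "eventually (\<lambda>y. real (card {p::nat. prime p \<and> p \<le> 7 * (y ^ J) ^ 2}) \<le> c / 840 * real (7 * (y ^ J) ^ 2)) at_top"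
    using eventually_compose_filterlim[OF card_primes_smallo[of "c / 840"] lim2(2)] c0 by (simp only: divide_pos_pos zero_less_numeral)
  have ev5: "eventually (\<lambda>y::nat. y \<ge> 397290 + nat \<lceil>360 / c\<rceil>) at_top" by (rule eventually_ge_at_top)
  have "eventually (\<lambda>y::nat. real (card ((\<lambda>P. squarefree_part (nat (sextic_at P))) ` admissible_box (y ^ J)))
       \<ge> (c / 4 / 6 ^ (6 * J)) * real (y ^ J) ^ 2) sequentially"
    using ev1 ev2 ev3 ev4 ev5
  proof eventually_elim
    case (elim y)
    define T where "T = y ^ J"
    have y: "y \<ge> 397290" using elim(5) by simp
    have "360 / c \<le> y" using elim(5) by linarith
    then have yc: "1 / y \<le> c / 360" using c0 y by (simp add: field_simps)
    have T0: "T > 0" using y by (simp add: T_def)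
    have "\<exists>k. p ^ k \<le> T \<and> T < p ^ (k + 1)" if "prime p" for p
      using that T0 by (intro ex_power_ivl1) (auto dest: prime_ge_2_nat)
    \<comment> \<open>Powers up to the exponent \<open>K p\<close> stay below \<open>T\<close>, as
      the first moment requires, while the next one exceeds \<open>T\<close>; this makes
      divisibility by \<open>p ^ K p\<close> rare.\<close>
    then obtain K where K: "\<And>p. prime p \<Longrightarrow> p ^ K p \<le> T \<and> T < p ^ (K p + 1)" by metis
    have yT: "y ^ 3 \<le> T" unfolding T_def using J3 y by (intro power_increasing) auto
    have K': "K p > 0 \<and> T \<le> y * p ^ K p" if "prime p" "p \<le> y" for p
    proof
      have "T < p * p ^ K p" using K[OF that(1)] by simp
      also have "\<dots> \<le> y * p ^ K p" using that by simp
      finally show "T \<le> y * p ^ K p" by simp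
      have "1 * 1 < y * y" using y by (intro mult_strict_mono) auto
      then have "y * (1 * 1) < y * (y * y)" using y by (intro mult_strict_left_mono) auto
      then have "y < T" using yT by (simp only: power3_eq_cube mult.assoc mult_1_right)
      show "K p > 0"
      proof (rule gr0I)
        assume "K p = 0"
        then show False using K[OF that(1)] that(2) \<open>y < T\<close> by simp
      qed
    qed
    define B1 where "B1 = {P \<in> admissible_box T. \<exists>p>y. prime p \<and> int p ^ 2 dvd sextic_at P}"
    define B2 where "B2 = {P \<in> admissible_box T. \<exists>p\<le>y. prime p \<and> \<not> int p dvd 397290 \<and> int p ^ K p dvd sextic_at P}"
    define B3 where "B3 = {P \<in> admissible_box T. smooth_weight y K P \<ge> 2 * ln T}"
    define G where "G = admissible_box T - (B1 \<union> B2 \<union> B3)"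
    have b1: "real (card B1) \<le> c / 4 * real T ^ 2"
    proof -
      have "real (card B1) \<le> 6 * real T * (T / y + card {p::nat. prime p \<and> p \<le> 4 * T})
          + 6 * card {p::nat. prime p \<and> p \<le> 7 * T ^ 2}"
        unfolding B1_def by (rule card_box_prime_square_dvd[OF y])
      also have "\<dots> \<le> 6 * real T * (T * (c / 360) + c / 480 * real (4 * T)) + 6 * (c / 840 * real (7 * T ^ 2))"
        using elim(3,4) mult_left_mono[OF yc, of "real T"] unfolding T_def[symmetric]
        by (intro add_mono mult_left_mono) auto
      also have "\<dots> = (7 / 60) * (c * real T ^ 2)" by (simp add: power2_eq_square algebra_simps)
      also have "\<dots> \<le> c / 4 * real T ^ 2" using c0 by simp
      finally show ?thesis .
    qed
    have b2: "real (card B2) \<le> c / 4 * real T ^ 2"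
    proof -
      have "real (card B2) \<le> 6 * real T * y * (real y + 1)"
        unfolding B2_def by (rule card_box_high_power_dvd[OF K'])
      also have "\<dots> \<le> 6 * real T * y * (2 * real y)" using y by (intro mult_left_mono) auto
      also have "\<dots> = 12 * real T * (real y ^ 3 * (1 / y))" using y by (simp add: power2_eq_square power3_eq_cube)
      also have "\<dots> \<le> 12 * real T * (T * (c / 360))"
      proof (intro mult_left_mono mult_mono yc)
        show "real y ^ 3 \<le> real T" using yT by (metis of_nat_le_iff of_nat_power)
      qed auto
      also have "\<dots> = (1 / 30) * (c * real T ^ 2)" by (simp add: power2_eq_square)
      also have "\<dots> \<le> c / 4 * real T ^ 2" using c0 by simp
      finally show ?thesis .
    qed
    have b3: "real (card B3) \<le> c / 4 * real T ^ 2"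
    proof -
      have "real (card B3) \<le> 24 * real T ^ 2 / J"
        unfolding B3_def by (rule card_box_smooth_weight) (use y J3 K T_def in auto)
      also have "\<dots> = 24 / J * real T ^ 2" by simp
      also have "\<dots> \<le> c / 4 * real T ^ 2" by (intro mult_right_mono J) auto
      finally show ?thesis .
    qed
    have "card (admissible_box T) \<le> card (G \<union> (B1 \<union> (B2 \<union> B3)))"
      by (intro card_mono) (auto simp: G_def B1_def B2_def B3_def)
    also have "\<dots> \<le> card G + (card B1 + (card B2 + card B3))"
      by (meson card_Un_le add_mono order_refl order_trans)
    finally have "real (card (admissible_box T)) \<le> real (card G) + (real (card B1) + (real (card B2) + real (card B3)))"
      by (simp only: flip: of_nat_add of_nat_le_iff)
    moreover have "real (card (admissible_box T)) \<ge> c * real T ^ 2"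
      using card_admissible_box_ge[of T] elim(1,2) by (simp add: T_def M_def)
    ultimately have G: "real (card G) \<ge> c / 4 * real T ^ 2" using b1 b2 b3 by linarith
    let ?f = "\<lambda>P. squarefree_part (nat (sextic_at P))"
    have fG: "finite G" by (simp add: G_def)
    have fibre: "card {P \<in> G. ?f P = d} \<le> 6 ^ (6 * J)" for d
    proof (rule card_squarefree_part_fibre[OF _ y])
      show "G \<subseteq> admissible_box (y ^ J)" by (auto simp: G_def T_def)
      show "\<not> int p ^ 2 dvd sextic_at P" if "P \<in> G" "prime p" "p > y" for P p
        using that by (auto simp: G_def B1_def)
      show "int (\<Prod>(rough_primes y P)) > 3 * int (y ^ J) ^ 2" if P: "P \<in> G" for P
      proof -
        have "T ^ 4 \<le> 600 * \<Prod>(rough_primes y P)"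
          by (rule prod_rough_primes_ge[where K = K]) (use P T0 in \<open>auto simp: G_def B1_def B2_def B3_def\<close>)
        \<comment> \<open>Turns \<open>T^4 \<le> 600 R\<close> for the product \<open>R\<close> of
          the rough primes into \<open>R > 3T^2\<close>, the size of the largest possible
          determinant.\<close>
        moreover have "1800 < T" using elim(2) by (simp add: T_def)
        then have "1800 < T ^ 2" using le_square[of T] by (simp only: power2_eq_square)
        then have "1800 * T ^ 2 < T ^ 2 * T ^ 2" using T0 by (intro mult_strict_right_mono) auto
        ultimately have "1800 * T ^ 2 < 600 * \<Prod>(rough_primes y P)" by (simp only: flip: power_add) simp
        then have "3 * T ^ 2 < \<Prod>(rough_primes y P)" by linarith
        then have "int (3 * T ^ 2) < int (\<Prod>(rough_primes y P))" by (simp only: of_nat_less_iff)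
        then show ?thesis by (simp add: T_def)
      qed
    qed
    have "card G = (\<Sum>d\<in>?f ` G. card {P \<in> G. ?f P = d})"
      using sum.image_gen[OF fG, of "\<lambda>_. 1 :: nat" ?f] by simp
    also have "\<dots> \<le> (\<Sum>d\<in>?f ` G. 6 ^ (6 * J))" by (intro sum_mono fibre)
    also have "\<dots> = card (?f ` G) * 6 ^ (6 * J)" by simp
    also have "\<dots> \<le> card (?f ` admissible_box T) * 6 ^ (6 * J)"
      by (intro mult_right_mono card_mono image_mono) (auto simp: G_def)
    finally have "real (card G) \<le> real (card (?f ` admissible_box T)) * 6 ^ (6 * J)"
      by (metis (mono_tags, lifting) of_nat_le_iff of_nat_mult of_nat_numeral of_nat_power)
    then show ?case using G by (simp add: T_def field_simps)
  qed
  then show thesis using J3 c0 by (intro that[of J "c / 4 / 6 ^ (6 * J)"]) auto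
qed

section \<open>Imaginary quadratic fields\<close>

definition sqrt_neg :: "nat \<Rightarrow> complex" where
  "sqrt_neg D = \<i> * of_real (sqrt (real D))"

lemma sqrt_neg_square [simp]: "sqrt_neg D * sqrt_neg D = - of_nat D" "(sqrt_neg D)\<^sup>2 = - of_nat D"
proof -
  have "complex_of_real (sqrt D) * complex_of_real (sqrt D) = of_nat D"
    by (simp flip: of_real_mult)
  then show "sqrt_neg D * sqrt_neg D = - of_nat D"
    by (simp add: sqrt_neg_def algebra_simps)
  then show "(sqrt_neg D)\<^sup>2 = - of_nat D" by (simp add: power2_eq_square)
qed

lemma cnj_sqrt_neg [simp]: "cnj (sqrt_neg D) = - sqrt_neg D"
  by (simp add: sqrt_neg_def)

lemma Re_sqrt_neg [simp]: "Re (sqrt_neg D) = 0" and Im_sqrt_neg [simp]: "Im (sqrt_neg D) = sqrt D"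
  by (simp_all add: sqrt_neg_def)

definition qelt :: "nat \<Rightarrow> rat \<Rightarrow> rat \<Rightarrow> complex" where
  "qelt D a b = of_rat a + of_rat b * sqrt_neg D"

lemma complex_of_rat: "(of_rat a :: complex) = of_real (of_rat a)"
  by (induction a) (simp add: of_rat_rat)

lemma of_rat_in_Reals: "(of_rat a :: complex) \<in> \<real>"
  by (simp add: complex_of_rat)

lemma Re_qelt [simp]: "Re (qelt D a b) = of_rat a" and Im_qelt [simp]: "Im (qelt D a b) = of_rat b * sqrt D"
  by (simp_all add: qelt_def complex_of_rat)

lemma qelt_eq_iff [simp]: "D > 0 \<Longrightarrow> qelt D a b = qelt D c d \<longleftrightarrow> a = c \<and> b = d"
  by (auto simp: complex_eq_iff)

lemma qelt_add: "qelt D a b + qelt D c d = qelt D (a + c) (b + d)"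
  by (simp add: qelt_def of_rat_add algebra_simps)

lemma qelt_minus: "- qelt D a b = qelt D (- a) (- b)"
  by (simp add: qelt_def of_rat_minus algebra_simps)

lemma qelt_mult: "qelt D a b * qelt D c d = qelt D (a * c - of_nat D * (b * d)) (a * d + b * c)"
proof -
  have "qelt D a b * qelt D c d = of_rat a * of_rat c + of_rat b * of_rat d * (sqrt_neg D * sqrt_neg D)
      + (of_rat a * of_rat d + of_rat b * of_rat c) * sqrt_neg D"
    by (simp add: qelt_def algebra_simps del: sqrt_neg_square)
  then show ?thesis by (simp add: qelt_def of_rat_add of_rat_mult of_rat_diff algebra_simps)
qed

lemma cnj_qelt: "cnj (qelt D a b) = qelt D a (- b)"
  by (simp add: qelt_def complex_of_rat of_rat_minus)

definition quadratic_field :: "nat \<Rightarrow> complex set" where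
  "quadratic_field D = {qelt D a b | a b. True}"

lemma qelt_in_quadratic_field [simp]: "qelt D a b \<in> quadratic_field D"
  by (auto simp: quadratic_field_def)

lemma quadratic_fieldE:
  assumes "x \<in> quadratic_field D" obtains a b where "x = qelt D a b"
  using assms by (auto simp: quadratic_field_def)

lemma qelt_0 [simp]: "qelt D a 0 = of_rat a" "qelt D 0 1 = sqrt_neg D" by (simp_all add: qelt_def)

section \<open>Subfields of the complex numbers\<close>

lemma complex_ring_simps [simp]:
  "carrier complex_ring = UNIV" "x \<otimes>\<^bsub>complex_ring\<^esub> y = x * y" "x \<oplus>\<^bsub>complex_ring\<^esub> y = x + y"
  "\<zero>\<^bsub>complex_ring\<^esub> = 0" "\<one>\<^bsub>complex_ring\<^esub> = 1"
  by (simp_all add: ring_of_type_algebra_def)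

lemma complex_field: "field complex_ring"
  by (rule field_from_type_algebra)

lemma complex_is_ring: "ring complex_ring"
  by (rule ring_from_type_algebra)

lemma complex_is_cring: "cring complex_ring"
  by (rule cring_from_type_algebra)

lemma complex_ring_inv: "x \<noteq> 0 \<Longrightarrow> inv\<^bsub>complex_ring\<^esub> x = inverse x"
  using complex_is_cring by (intro comm_monoid.comm_inv_char) (auto simp: cring_def)

lemma complex_ring_a_inv: "\<ominus>\<^bsub>complex_ring\<^esub> x = - x"
proof -
  interpret ring complex_ring by (rule complex_is_ring)
  show ?thesis by (rule minus_equality) auto
qed

lemma subring_complexI:
  assumes "1 \<in> S" "\<And>x y. x \<in> S \<Longrightarrow> y \<in> S \<Longrightarrow> x * y \<in> S" "\<And>x y. x \<in> S \<Longrightarrow> y \<in> S \<Longrightarrow> x + y \<in> S"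
    "\<And>x. x \<in> S \<Longrightarrow> - x \<in> S"
  shows "subring S complex_ring"
  using assms complex_is_ring by (intro ring.subringI) (auto simp: complex_ring_a_inv)

lemma subfield_complexI:
  assumes "1 \<in> S" "\<And>x y. x \<in> S \<Longrightarrow> y \<in> S \<Longrightarrow> x * y \<in> S" "\<And>x y. x \<in> S \<Longrightarrow> y \<in> S \<Longrightarrow> x + y \<in> S"
    "\<And>x. x \<in> S \<Longrightarrow> - x \<in> S" "\<And>x. x \<in> S \<Longrightarrow> inverse x \<in> S"
  shows "subfield S complex_ring"
  using assms by (intro field.subfieldI'[OF complex_field] subring_complexI) (auto simp: complex_ring_inv)

lemma subfield_complexD:
  assumes "subfield S complex_ring"
  shows "1 \<in> S" "0 \<in> S" "\<And>x y. x \<in> S \<Longrightarrow> y \<in> S \<Longrightarrow> x * y \<in> S" "\<And>x y. x \<in> S \<Longrightarrow> y \<in> S \<Longrightarrow> x + y \<in> S"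
    "\<And>x. x \<in> S \<Longrightarrow> - x \<in> S" "\<And>x. x \<in> S \<Longrightarrow> inverse x \<in> S" "\<rat> \<subseteq> S"
proof -
  have r: "subring S complex_ring" using assms by (simp add: subfieldE)
  show 1: "1 \<in> S" using subringE(3)[OF r] by simp
  show 0: "0 \<in> S" using subringE(2)[OF r] by simp
  show m: "x * y \<in> S" if "x \<in> S" "y \<in> S" for x y using subringE(6)[OF r] that by simp
  show p: "x + y \<in> S" if "x \<in> S" "y \<in> S" for x y using subringE(7)[OF r] that by simp
  show n: "- x \<in> S" if "x \<in> S" for x using subringE(5)[OF r] that by (simp add: complex_ring_a_inv)
  show i: "inverse x \<in> S" if "x \<in> S" for x
  proof (cases "x = 0")
    case False
    then show ?thesis
      using ring.subfield_m_inv(1)[OF complex_is_ring assms, of x] that by (simp add: complex_ring_inv)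
  qed (use 0 in simp)
  have nat: "of_nat k \<in> S" for k by (induction k) (auto intro: 0 1 p)
  have int: "of_int k \<in> S" for k using nat[of "nat k"] n[OF nat[of "nat (- k)"]] by (cases "k \<ge> 0") auto
  show "\<rat> \<subseteq> S"
  proof
    fix x :: complex assume "x \<in> \<rat>"
    then obtain a b where "x = of_int a / of_int b" by (auto elim: Rats_cases')
    then show "x \<in> S" using m[OF int i[OF int]] by (simp add: divide_inverse)
  qed
qed

lemma subfield_Rats: "subfield \<rat> complex_ring"
  by (rule subfield_complexI) auto

lemma inverse_qelt: "inverse (qelt D a b) = qelt D (a / (a\<^sup>2 + of_nat D * b\<^sup>2)) (- b / (a\<^sup>2 + of_nat D * b\<^sup>2))"
  if "D > 0"
proof (cases "a\<^sup>2 + of_nat D * b\<^sup>2 = 0")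
  case True
  moreover have "0 \<le> a\<^sup>2" "0 \<le> of_nat D * b\<^sup>2" by simp_all
  ultimately have "a\<^sup>2 = 0" "of_nat D * b\<^sup>2 = 0" by linarith+
  then have "a = 0 \<and> b = 0" using that by simp
  then show ?thesis by (simp add: qelt_def)
next
  case False
  let ?n = "a\<^sup>2 + of_nat D * b\<^sup>2"
  have "a * (a / ?n) - of_nat D * (b * (- b / ?n)) = ?n / ?n"
    by (simp add: power2_eq_square flip: add_divide_distrib)
  then have "qelt D a b * qelt D (a / ?n) (- b / ?n) = qelt D 1 0"
    unfolding qelt_mult using False by simp
  then have "qelt D a b * qelt D (a / ?n) (- b / ?n) = 1" by simp
  then show ?thesis by (metis inverse_unique)
qed

lemma subfield_quadratic_field: "D > 0 \<Longrightarrow> subfield (quadratic_field D) complex_ring"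
proof (rule subfield_complexI)
  show "1 \<in> quadratic_field D" using qelt_in_quadratic_field[of D 1 0] by simp
qed (auto elim!: quadratic_fieldE simp: qelt_mult qelt_add qelt_minus inverse_qelt)

section \<open>Classification of imaginary quadratic fields\<close>

lemma Span_pair: "ring.Span complex_ring \<rat> [x, y] = {a * x + b * y | a b. a \<in> \<rat> \<and> b \<in> \<rat>}"
proof -
  interpret ring complex_ring by (rule complex_is_ring)
  have "z \<in> Span \<rat> [x, y] \<longleftrightarrow> (\<exists>a\<in>\<rat>. \<exists>b\<in>\<rat>. z = a * x + b * y)" for z
    by (simp add: line_extension_mem_iff Bex_def) blast
  then show ?thesis by blast
qed

lemma independent_pair:
  assumes "x \<notin> \<real>"
  shows "ring.independent complex_ring \<rat> [x, 1]"
proof -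
  interpret ring complex_ring by (rule complex_is_ring)
  have "1 \<notin> Span \<rat> []" by simp
  moreover have "Span \<rat> [1] \<subseteq> \<real>" by (auto simp: line_extension_mem_iff of_rat_in_Reals elim!: Rats_cases)
  then have "x \<notin> Span \<rat> [1]" using assms by blast
  ultimately show ?thesis by (auto intro!: independent.li_Cons)
qed

lemma sqrt_neg_not_real: "D > 0 \<Longrightarrow> sqrt_neg D \<notin> \<real>"
  by (auto simp: complex_is_Real_iff)

lemma quadratic_field_eq_Span: "quadratic_field D = ring.Span complex_ring \<rat> [sqrt_neg D, 1]"
proof -
  have "(\<exists>a b. x = of_rat a + of_rat b * sqrt_neg D) \<longleftrightarrow> (\<exists>b\<in>\<rat>. \<exists>a\<in>\<rat>. x = b * sqrt_neg D + a * 1)" for x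
    by (auto simp: add.commute elim!: Rats_cases) (metis Rats_of_rat add.commute)
  then show ?thesis unfolding Span_pair quadratic_field_def qelt_def by blast
qed

lemma imaginary_quadratic_quadratic_field:
  assumes "D > 0" shows "imaginary_quadratic_field (quadratic_field D)"
proof -
  interpret ring complex_ring by (rule complex_is_ring)
  have "dimension (length [sqrt_neg D, 1]) \<rat> (quadratic_field D)"
    unfolding quadratic_field_eq_Span
    by (rule dimension_independent) (intro independent_pair sqrt_neg_not_real assms)
  then have "dimension 2 \<rat> (quadratic_field D)" by (simp add: numeral_2_eq_2)
  moreover have "sqrt_neg D \<in> quadratic_field D" using qelt_in_quadratic_field[of D 0 1] by simp
  ultimately show ?thesis using subfield_quadratic_field[OF assms] sqrt_neg_not_real[OF assms]
    by (auto simp: imaginary_quadratic_field_def number_field_of_degree_def)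
qed

lemma imaginary_quadratic_field_eq_Span:
  assumes K: "imaginary_quadratic_field K" and x: "x \<in> K" "x \<notin> \<real>"
  shows "K = ring.Span complex_ring \<rat> [x, 1]"
proof -
  interpret ring complex_ring by (rule complex_is_ring)
  have d: "dimension 2 \<rat> K" and s: "subfield K complex_ring"
    using K by (auto simp: imaginary_quadratic_field_def number_field_of_degree_def)
  have "set [x, 1] \<subseteq> K" using x subfield_complexD(1)[OF s] by simp
  from independent_length_eq_dimension[OF subfield_Rats d independent_pair[OF x(2)] this]
  show ?thesis by simp
qed

text \<open>Complete the square for a non-real element, clear the denominator and divide by the
  square part: this leaves an element whose square is \<open>- D\<close> with \<open>D\<close>
  squarefree. The sign is forced because the element is not real.\<close>

lemma imaginary_quadratic_field_cases:
  assumes K: "imaginary_quadratic_field K"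
  obtains D where "D > 0" "squarefree D" "K = quadratic_field D"
proof -
  have s: "subfield K complex_ring"
    using K by (auto simp: imaginary_quadratic_field_def number_field_of_degree_def)
  note S = subfield_complexD[OF s]
  obtain z where z: "z \<in> K" "z \<notin> \<real>" using K by (auto simp: imaginary_quadratic_field_def)
  have "z * z \<in> K" using z S by blast
  then obtain a b where ab: "a \<in> \<rat>" "b \<in> \<rat>" "z * z = a * z + b"
    using imaginary_quadratic_field_eq_Span[OF K z] unfolding Span_pair by auto
  define w where "w = 2 * z - a"
  have wK: "w \<in> K" unfolding w_def using z ab S(3,4,5,7)
    by (metis Rats_number_of subsetD diff_conv_add_uminus)
  have wR: "w \<notin> \<real>"
  proof
    assume "w \<in> \<real>"
    moreover have "a \<in> \<real>" using ab(1) by (auto simp: of_rat_in_Reals elim!: Rats_cases)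
    moreover have "z = (w + a) / 2" by (simp add: w_def)
    ultimately show False using z(2) by (metis Reals_add Reals_divide Reals_numeral)
  qed
  have "w * w = 4 * (z * z) - 4 * a * z + a * a" by (simp add: w_def algebra_simps)
  also have "\<dots> = a * a + 4 * b" unfolding ab(3) by (simp add: algebra_simps)
  finally have ww: "w * w = a * a + 4 * b" .
  then have "w * w \<in> \<rat>" using ab by auto
  then obtain m n where mn: "n > 0" "w * w = of_int m / of_int n" by (auto elim: Rats_cases')
  define v where "v = of_int n * w"
  have v: "v * v = of_int (n * m)" proof -
    have "v * v = of_int n * of_int n * (w * w)" by (simp add: v_def)
    then show ?thesis using mn by simp
  qed
  have vK: "v \<in> K" unfolding v_def by (rule S(3)[OF _ wK]) (use S(7) in auto)
  have vR: "v \<notin> \<real>"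
  proof
    assume "v \<in> \<real>"
    moreover have "w = v / of_int n" using mn by (simp add: v_def)
    ultimately show False using wR by (metis Reals_divide Reals_of_int)
  qed
  have neg: "n * m < 0"
  proof (rule ccontr)
    assume "\<not> n * m < 0"
    then have "v\<^sup>2 = (of_real (sqrt (of_int (n * m))))\<^sup>2"
      using v by (simp add: power2_eq_square flip: of_real_mult of_int_mult)
    then have "v = of_real (sqrt (of_int (n * m))) \<or> v = - of_real (sqrt (of_int (n * m)))"
      by (simp add: power2_eq_iff)
    then show False using vR by (metis Reals_minus Reals_of_real)
  qed
  define N where "N = nat (- (n * m))"
  have N0: "N > 0" using neg by (simp add: N_def)
  have vN: "v * v = - of_nat N" using v neg by (simp add: N_def)
  define D where "D = squarefree_part N"
  define t where "t = square_part N"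
  have Nd: "N = D * t\<^sup>2" unfolding D_def t_def by (rule squarefree_decompose)
  have t0: "t > 0" using N0 Nd by (auto intro: gr0I)
  have D0: "D > 0" using N0 Nd by (auto intro: gr0I)
  have "(v / of_nat t)\<^sup>2 = (sqrt_neg D)\<^sup>2"
    using vN t0 unfolding Nd by (simp add: power2_eq_square field_simps)
  then have "v / of_nat t = sqrt_neg D \<or> v / of_nat t = - sqrt_neg D" by (simp only: power2_eq_iff)
  moreover have "v / of_nat t \<in> K" using S(3)[OF vK S(6)] S(7) by (metis Rats_of_nat divide_inverse subsetD)
  ultimately have "sqrt_neg D \<in> K" using S(5) by (metis minus_minus)
  from imaginary_quadratic_field_eq_Span[OF K this sqrt_neg_not_real[OF D0]]
  have "K = quadratic_field D" by (simp only: quadratic_field_eq_Span)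
  then show ?thesis using D0 that by (simp add: D_def)
qed

section \<open>Rings of integers\<close>

definition int_span :: "nat \<Rightarrow> complex set" where
  "int_span D = {qelt D (of_int a) (of_int b) | a b. True}"

lemma int_spanI [intro]: "qelt D (of_int a) (of_int b) \<in> int_span D"
  by (auto simp: int_span_def)

lemma int_span_closed:
  "x \<in> int_span D \<Longrightarrow> y \<in> int_span D \<Longrightarrow> x + y \<in> int_span D"
  "x \<in> int_span D \<Longrightarrow> y \<in> int_span D \<Longrightarrow> x * y \<in> int_span D"
  "x \<in> int_span D \<Longrightarrow> - x \<in> int_span D"
  "x \<in> int_span D \<Longrightarrow> cnj x \<in> int_span D"
  "of_int n \<in> int_span D"
proof -
  show "x + y \<in> int_span D" if xy: "x \<in> int_span D" "y \<in> int_span D"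
  proof -
    obtain a b c d where "x = qelt D (of_int a) (of_int b)" "y = qelt D (of_int c) (of_int d)"
      using xy unfolding int_span_def by blast
    then have "x + y = qelt D (of_int (a + c)) (of_int (b + d))" by (simp add: qelt_add)
    then show ?thesis by (simp only: int_spanI)
  qed
  show "x * y \<in> int_span D" if xy: "x \<in> int_span D" "y \<in> int_span D"
  proof -
    obtain a b c d where "x = qelt D (of_int a) (of_int b)" "y = qelt D (of_int c) (of_int d)"
      using xy unfolding int_span_def by blast
    then have "x * y = qelt D (of_int (a * c - int D * (b * d))) (of_int (a * d + b * c))"
      by (simp add: qelt_mult)
    then show ?thesis by (simp only: int_spanI)
  qed
  show "- x \<in> int_span D" "cnj x \<in> int_span D" if x: "x \<in> int_span D"
  proof -
    obtain a b where "x = qelt D (of_int a) (of_int b)" using x unfolding int_span_def by blast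
    then have "- x = qelt D (of_int (- a)) (of_int (- b))" "cnj x = qelt D (of_int a) (of_int (- b))"
      by (simp_all add: qelt_minus cnj_qelt)
    then show "- x \<in> int_span D" "cnj x \<in> int_span D" by (simp_all only: int_spanI)
  qed
  show "of_int n \<in> int_span D" using int_spanI[of D n 0] by simp
qed

lemma int_span_power: "x \<in> int_span D \<Longrightarrow> x ^ k \<in> int_span D"
  using int_span_closed(5)[of 1 D] by (induction k) (auto intro: int_span_closed)

lemma int_span_sum: "(\<And>i. i \<in> A \<Longrightarrow> f i \<in> int_span D) \<Longrightarrow> sum f A \<in> int_span D"
  using int_span_closed(5)[of 0 D] by (induction A rule: infinite_finite_induct) (auto intro: int_span_closed)

lemma of_rat_in_int_span: "D > 0 \<Longrightarrow> of_rat r \<in> int_span D \<Longrightarrow> r \<in> \<int>"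
  using qelt_eq_iff[of D r 0] by (auto simp: int_span_def simp del: qelt_eq_iff)

text \<open>If \<open>b\<close> is the reduced denominator of \<open>r\<close>, every power of
  \<open>b\<close> divides \<open>N\<close>, so \<open>b = 1\<close>.\<close>

lemma rat_bounded_powers_imp_int:
  fixes r :: rat
  assumes N: "N > 0" and r: "\<And>k. of_int N * r ^ k \<in> \<int>"
  shows "r \<in> \<int>"
proof -
  obtain a b where ab: "r = of_int a / of_int b" "b > 0" "coprime a b"
    using quotient_of_div[of r] quotient_of_denom_pos[of r] quotient_of_coprime[of r]
    by (cases "quotient_of r") auto
  have le: "b ^ k \<le> N" for k
  proof -
    obtain m where "of_int N * r ^ k = of_int m" using r[of k] by (auto elim: Ints_cases)
    then have "of_int (N * a ^ k) = (of_int (m * b ^ k) :: rat)"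
      using ab by (simp add: power_divide field_simps)
    then have "N * a ^ k = m * b ^ k" by (simp only: of_int_eq_iff)
    then have "b ^ k dvd N * a ^ k" by simp
    moreover have "coprime (b ^ k) (a ^ k)" using ab(3) by (simp add: coprime_commute)
    ultimately have "b ^ k dvd N" by (simp add: coprime_dvd_mult_left_iff)
    then show ?thesis using N by (rule zdvd_imp_le)
  qed
  have "b = 1"
  proof (rule ccontr)
    assume "b \<noteq> 1"
    then have "2 ^ nat N \<le> b ^ nat N" using ab by (intro power_mono) auto
    then have "2 ^ nat N \<le> N" using le[of "nat N"] by linarith
    moreover have "int (nat N) < int (2 ^ nat N)" by (simp only: of_nat_less_iff less_exp)
    ultimately show False using N by simp
  qed
  then show ?thesis using ab by simp
qed

lemma quadratic_field_denominator:
  assumes "x \<in> quadratic_field D"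
  obtains c where "c > 0" "of_int c * x \<in> int_span D"
proof -
  obtain r s where rs: "x = qelt D r s" using assms by (elim quadratic_fieldE)
  define c where "c = snd (quotient_of r) * snd (quotient_of s)"
  have den: "of_int (snd (quotient_of r)) * r \<in> \<int>" "snd (quotient_of r) > 0" for r :: rat
    using quotient_of_div[of r] quotient_of_denom_pos[of r] by (cases "quotient_of r", auto)+
  have c0: "c > 0" using den(2) by (simp add: c_def)
  have "of_int c * r = of_int (snd (quotient_of s)) * (of_int (snd (quotient_of r)) * r)"
       "of_int c * s = of_int (snd (quotient_of r)) * (of_int (snd (quotient_of s)) * s)"
    by (simp_all add: c_def)
  then have "of_int c * r \<in> \<int>" "of_int c * s \<in> \<int>" using den(1) by (metis Ints_mult Ints_of_int)+
  then obtain a b where "of_int c * r = of_int a" "of_int c * s = of_int b" by (auto elim!: Ints_cases)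
  moreover have "of_int c * x = qelt D (of_int c * r) (of_int c * s)"
    by (simp add: rs qelt_def of_rat_mult algebra_simps)
  ultimately have "of_int c * x \<in> int_span D" by auto
  then show ?thesis using that c0 by blast
qed

text \<open>A substitute for the closure of algebraic integers under addition and multiplication.\<close>

lemma algebraic_int_powers_bounded_denominator:
  assumes x: "algebraic_int x" "x \<in> quadratic_field D"
  shows "\<exists>N>0. \<forall>k. of_int N * x ^ k \<in> int_span D"
proof -
  obtain c where c0: "c > 0" and cx: "of_int c * x \<in> int_span D"
    using x(2) by (rule quadratic_field_denominator)
  obtain f where f: "lead_coeff f = 1" "\<forall>i. coeff f i \<in> \<int>" "poly f x = 0"
    using x(1) by (auto elim: algebraic_int.cases)
  define n where "n = degree f"
  have rec: "x ^ (n + j) = - (\<Sum>i<n. coeff f i * x ^ (i + j))" for j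
  proof -
    have "0 = (\<Sum>i\<le>n. coeff f i * x ^ i)" using f(3) by (simp add: poly_altdef n_def)
    also have "\<dots> = (\<Sum>i<n. coeff f i * x ^ i) + x ^ n"
      using f(1) by (simp add: n_def lessThan_Suc_atMost[symmetric])
    finally have "x ^ n = - (\<Sum>i<n. coeff f i * x ^ i)" by (simp add: eq_neg_iff_add_eq_0 add.commute)
    then have "x ^ n * x ^ j = - (\<Sum>i<n. coeff f i * x ^ i) * x ^ j" by simp
    then show ?thesis by (simp add: power_add sum_distrib_right mult.assoc)
  qed
  \<comment> \<open>The factor \<open>c^n\<close> clears the denominators of the powers below the
    degree \<open>n\<close>, and the monic equation carries this on to all higher powers.\<close>
  have "of_int (c ^ n) * x ^ k \<in> int_span D" for k
  proof (induction k rule: less_induct)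
    case (less k)
    show ?case
    proof (cases "k < n")
      case True
      then have "of_int (c ^ n) * x ^ k = of_int (c ^ (n - k)) * (of_int c * x) ^ k"
        by (simp add: power_mult_distrib flip: power_add mult.assoc)
      then show ?thesis using cx by (simp only: int_span_closed int_span_power)
    next
      case False
      then obtain j where j: "k = n + j" using le_Suc_ex by (auto simp: not_less)
      have "of_int (c ^ n) * x ^ k = - (\<Sum>i<n. coeff f i * (of_int (c ^ n) * x ^ (i + j)))"
        unfolding j rec by (simp add: sum_distrib_left mult_ac)
      moreover have "coeff f i * (of_int (c ^ n) * x ^ (i + j)) \<in> int_span D" if "i < n" for i
      proof (rule int_span_closed(2))
        show "coeff f i \<in> int_span D" using f(2)[rule_format, of i] by (auto elim!: Ints_cases intro: int_span_closed)
        show "of_int (c ^ n) * x ^ (i + j) \<in> int_span D" using less[of "i + j"] j that by simp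
      qed
      ultimately show ?thesis by (auto intro!: int_span_closed(3) int_span_sum)
    qed
  qed
  moreover have "c ^ n > 0" using c0 by simp
  ultimately show ?thesis by blast
qed

text \<open>A common \<open>N\<close> bounds the denominators of all powers of the element and of
  its conjugate. By the binomial theorem \<open>N * N\<close> does so for the powers of the trace,
  and by multiplicativity for those of the norm; both are rational, hence integers.\<close>

lemma algebraic_int_trace_norm:
  assumes D: "D > 0" and x: "algebraic_int (qelt D r s)"
  shows "2 * r \<in> \<int>" "r\<^sup>2 + of_nat D * s\<^sup>2 \<in> \<int>"
proof -
  let ?x = "qelt D r s"
  obtain N where N: "N > 0" "\<And>k. of_int N * ?x ^ k \<in> int_span D"
    using algebraic_int_powers_bounded_denominator[OF x, of D] by auto
  have N': "of_int N * cnj ?x ^ k \<in> int_span D" for k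
    using int_span_closed(4)[OF N(2)[of k]] by simp
  have tr: "?x + cnj ?x = of_rat (2 * r)" by (simp add: cnj_qelt qelt_add)
  have no: "?x * cnj ?x = of_rat (r\<^sup>2 + of_nat D * s\<^sup>2)" by (simp add: cnj_qelt qelt_mult power2_eq_square)
  have NN: "N * N > 0" using N by simp
  show "2 * r \<in> \<int>"
  proof (rule rat_bounded_powers_imp_int[OF NN])
    fix k
    have "of_rat (of_int (N * N) * (2 * r) ^ k) = of_int N * of_int N * (?x + cnj ?x) ^ k"
      unfolding tr by (simp add: of_rat_mult of_rat_power)
    also have "\<dots> = (\<Sum>i\<le>k. of_int (int (k choose i)) * ((of_int N * ?x ^ i) * (of_int N * cnj ?x ^ (k - i))))"
      unfolding binomial_ring by (simp add: sum_distrib_left mult_ac)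
    also have "\<dots> \<in> int_span D" by (intro int_span_sum int_span_closed(2) N(2) N' int_span_closed(5))
    finally show "of_int (N * N) * (2 * r) ^ k \<in> \<int>" by (rule of_rat_in_int_span[OF D])
  qed
  show "r\<^sup>2 + of_nat D * s\<^sup>2 \<in> \<int>"
  proof (rule rat_bounded_powers_imp_int[OF NN])
    fix k
    have "of_rat (of_int (N * N) * (r\<^sup>2 + of_nat D * s\<^sup>2) ^ k) = of_int N * of_int N * (?x * cnj ?x) ^ k"
      unfolding no by (simp add: of_rat_mult of_rat_power)
    also have "\<dots> = (of_int N * ?x ^ k) * (of_int N * cnj ?x ^ k)" by (simp add: power_mult_distrib)
    also have "\<dots> \<in> int_span D" by (intro int_span_closed(2) N(2) N')
    finally show "of_int (N * N) * (r\<^sup>2 + of_nat D * s\<^sup>2) ^ k \<in> \<int>" by (rule of_rat_in_int_span[OF D])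
  qed
qed

text \<open>Trace and norm give that \<open>D (2s)^2\<close> is an integer. The square of the
  denominator of \<open>2s\<close> therefore divides the squarefree \<open>D\<close>, so
  \<open>2s\<close> is an integer, and the divisibility by 4 restates integrality of the
  norm.\<close>

lemma algebraic_int_half_integers:
  assumes D: "D > 0" "squarefree D" and x: "algebraic_int (qelt D r s)"
  shows "\<exists>a b. r = of_int a / 2 \<and> s = of_int b / 2 \<and> 4 dvd a\<^sup>2 + int D * b\<^sup>2"
proof -
  obtain a where a: "2 * r = of_int a" using algebraic_int_trace_norm(1)[OF D(1) x] by (auto elim: Ints_cases)
  obtain m where m: "r\<^sup>2 + of_nat D * s\<^sup>2 = of_int m"
    using algebraic_int_trace_norm(2)[OF D(1) x] by (auto elim: Ints_cases)
  obtain b c where bc: "2 * s = of_int b / of_int c" "c > 0" "coprime b c"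
    using quotient_of_div[of "2 * s"] quotient_of_denom_pos[of "2 * s"] quotient_of_coprime[of "2 * s"]
    by (cases "quotient_of (2 * s)") auto
  have "of_nat D * (2 * s)\<^sup>2 = 4 * (r\<^sup>2 + of_nat D * s\<^sup>2) - (2 * r)\<^sup>2" by (simp add: power_mult_distrib)
  also have "\<dots> = of_int (4 * m - a\<^sup>2)" unfolding a m by simp
  finally have e: "of_nat D * (2 * s)\<^sup>2 = of_int (4 * m - a\<^sup>2)" .
  then have "of_nat D * (of_int b)\<^sup>2 = (of_int (4 * m - a\<^sup>2) * (of_int c)\<^sup>2 :: rat)"
    unfolding bc(1) using bc(2) by (simp add: power_divide nonzero_divide_eq_eq)
  then have "of_int (int D * b\<^sup>2) = (of_int ((4 * m - a\<^sup>2) * c\<^sup>2) :: rat)" by simp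
  then have "int D * b\<^sup>2 = (4 * m - a\<^sup>2) * c\<^sup>2" by (simp only: of_int_eq_iff)
  then have "c\<^sup>2 dvd int D * b\<^sup>2" by simp
  moreover have "coprime (c\<^sup>2) (b\<^sup>2)" using bc(3) by (simp add: coprime_commute)
  ultimately have "c\<^sup>2 dvd int D" by (simp add: coprime_dvd_mult_left_iff)
  then have "(nat c)\<^sup>2 dvd D"
    using bc(2) by (metis int_dvd_int_iff int_nat_eq less_imp_le of_nat_power)
  then have "nat c dvd 1" using D(2) by (auto dest: squarefreeD)
  then have "c = 1" using bc(2) by simp
  then have s: "2 * s = of_int b" using bc by simp
  have "of_int (4 * m) = (of_int (a\<^sup>2 + int D * b\<^sup>2) :: rat)"
    using e unfolding s by (simp add: algebra_simps)
  then have "a\<^sup>2 + int D * b\<^sup>2 = 4 * m" by (simp only: of_int_eq_iff)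
  then have "4 dvd a\<^sup>2 + int D * b\<^sup>2" by simp
  moreover have "r = of_int a / 2" "s = of_int b / 2" using a s by simp_all
  ultimately show ?thesis by blast
qed

lemma algebraic_int_quadratic:
  fixes x :: complex
  assumes "x * x - of_int t * x + of_int n = 0"
  shows "algebraic_int x"
proof (rule algebraic_int.intros[of "[:of_int n, - of_int t, 1:]"])
  show "\<forall>i. coeff [:of_int n, - of_int t, 1:] i \<in> (\<int> :: complex set)"
    by (auto simp: coeff_pCons split: nat.splits)
  show "poly [:of_int n, - of_int t, 1:] x = 0" using assms by (simp add: algebra_simps)
qed simp

text \<open>The case distinction is the usual one on the radicand: \<open>D mod 4 = 3\<close> says
  that \<open>- D\<close> is 1 modulo 4.\<close>

definition int_gen :: "nat \<Rightarrow> complex" where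
  "int_gen D = (if D mod 4 = 3 then qelt D (1 / 2) (1 / 2) else sqrt_neg D)"

lemma of_int_mult_qelt: "of_int c * qelt D r s = qelt D (of_int c * r) (of_int c * s)"
  by (simp add: qelt_def of_rat_mult algebra_simps)

lemma of_int_eq_qelt: "of_int c = qelt D (of_int c) 0"
  by simp

lemma int_gen_comb:
  "of_int a + of_int b * int_gen D =
     (if D mod 4 = 3 then qelt D (of_int a + of_int b / 2) (of_int b / 2) else qelt D (of_int a) (of_int b))"
proof (cases "D mod 4 = 3")
  case True
  then show ?thesis
    unfolding int_gen_def of_int_eq_qelt[of a D] if_P[OF True] of_int_mult_qelt qelt_add by simp
next
  case False
  then show ?thesis by (simp add: int_gen_def qelt_def)
qed

lemma algebraic_int_comb:
  assumes "D > 0"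
  shows "algebraic_int (of_int a + of_int b * int_gen D)"
proof -
  let ?x = "of_int a + of_int b * int_gen D"
  have "\<exists>t n :: int. ?x + cnj ?x = of_int t \<and> ?x * cnj ?x = of_int n"
  proof (cases "D mod 4 = 3")
    case True
    define j where "j = int (D div 4)"
    have j: "(of_nat D :: rat) = 4 * of_int j + 3"
    proof -
      have "D = 4 * (D div 4) + 3" using True by (metis mult_div_mod_eq)
      then have "(of_nat D :: rat) = of_nat (4 * (D div 4) + 3)" by simp
      then show ?thesis by (simp add: j_def)
    qed
    have "?x + cnj ?x = of_int (2 * a + b)"
      unfolding int_gen_comb if_P[OF True] cnj_qelt qelt_add by (simp add: of_rat_add of_rat_mult)
    moreover have "?x * cnj ?x = of_int (a\<^sup>2 + a * b + b\<^sup>2 * (j + 1))"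
    proof -
      let ?r = "of_int a + of_int b / 2 :: rat" and ?s = "of_int b / 2 :: rat"
      have "?x * cnj ?x = of_rat (?r * ?r + of_nat D * (?s * ?s))"
        unfolding int_gen_comb if_P[OF True] cnj_qelt qelt_mult by simp
      also have "?r * ?r + of_nat D * (?s * ?s) = of_int (a\<^sup>2 + a * b + b\<^sup>2 * (j + 1))"
      proof -
        have "(x + y / 2) * (x + y / 2) + (4 * z + 3) * (y / 2 * (y / 2)) = x\<^sup>2 + x * y + y\<^sup>2 * (z + 1)"
          for x y z :: rat
        proof -
          define w where "w = y / 2"
          have y: "y = 2 * w" by (simp add: w_def)
          show ?thesis unfolding y by (simp add: power2_eq_square algebra_simps)
        qed
        then show ?thesis unfolding j by simp
      qed
      finally show ?thesis by (simp only: of_rat_of_int_eq)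
    qed
    ultimately show ?thesis by blast
  next
    case False
    have "?x + cnj ?x = of_int (2 * a)"
      unfolding int_gen_comb if_not_P[OF False] cnj_qelt qelt_add by (simp add: of_rat_add of_rat_mult)
    moreover have "?x * cnj ?x = of_int (a * a + int D * (b * b))"
      unfolding int_gen_comb if_not_P[OF False] cnj_qelt qelt_mult by (simp add: of_rat_add of_rat_mult)
    ultimately show ?thesis by blast
  qed
  then obtain t n where tn: "?x + cnj ?x = of_int t" "?x * cnj ?x = of_int n" by blast
  have "?x * ?x - of_int t * ?x + of_int n = 0"
    unfolding tn[symmetric] by (simp add: algebra_simps)
  then show ?thesis by (rule algebraic_int_quadratic)
qed

lemma square_mod_4: "(z::int)\<^sup>2 mod 4 = (if even z then 0 else 1)"
proof (cases "even z")
  case True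
  then obtain k where "z = 2 * k" by blast
  then show ?thesis by (simp add: power_mult_distrib)
next
  case False
  then obtain k where "z = 2 * k + 1" by (elim oddE)
  then have "z\<^sup>2 = 4 * (k\<^sup>2 + k) + 1" by (simp add: power2_eq_square algebra_simps)
  then have "z\<^sup>2 mod 4 = 1" by presburger
  then show ?thesis using False by simp
qed

text \<open>Squares are 0 or 1 modulo 4. So \<open>4 dvd a^2 + D b^2\<close> means that
  \<open>a\<close> and \<open>b\<close> have the same parity when \<open>D\<close> is 3 modulo 4,
  and that both are even when it is 1 or 2; the case 0 contradicts squarefreeness.\<close>

lemma integers_of_quadratic_field:
  assumes D: "D > 0" "squarefree D"
  shows "integers_of (quadratic_field D) = {of_int a + of_int b * int_gen D | a b. True}"
proof
  show "integers_of (quadratic_field D) \<subseteq> {of_int a + of_int b * int_gen D | a b. True}"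
  proof
    fix x assume "x \<in> integers_of (quadratic_field D)"
    then obtain r s where x: "x = qelt D r s" "algebraic_int (qelt D r s)"
      by (auto simp: integers_of_def elim!: quadratic_fieldE)
    obtain a b where ab: "r = of_int a / 2" "s = of_int b / 2" "4 dvd a\<^sup>2 + int D * b\<^sup>2"
      using algebraic_int_half_integers[OF D x(2)] by auto
    have D4: "D mod 4 \<noteq> 0"
    proof
      assume "D mod 4 = 0"
      then have "2\<^sup>2 dvd D" by (simp add: mod_0_imp_dvd)
      then have "(2::nat) dvd 1" by (rule squarefreeD[OF D(2)])
      then show False by simp
    qed
    have "(a\<^sup>2 + int D * b\<^sup>2) mod 4 = (a\<^sup>2 mod 4 + int (D mod 4) * (b\<^sup>2 mod 4)) mod 4"
    proof -
      have "[a\<^sup>2 + int D * b\<^sup>2 = a\<^sup>2 mod 4 + int (D mod 4) * (b\<^sup>2 mod 4)] (mod 4)"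
        by (intro cong_add cong_mult) (simp_all add: unique_euclidean_semiring_class.cong_def zmod_int)
      then show ?thesis by (simp only: unique_euclidean_semiring_class.cong_def)
    qed
    then have m: "(a\<^sup>2 mod 4 + int (D mod 4) * (b\<^sup>2 mod 4)) mod 4 = 0" using ab(3) by simp
    have "D mod 4 < 4" by simp
    then have D123: "D mod 4 = 1 \<or> D mod 4 = 2 \<or> D mod 4 = 3" using D4 by linarith
    show "x \<in> {of_int a + of_int b * int_gen D | a b. True}"
    proof (cases "D mod 4 = 3")
      case True
      have "even (a - b)" using m by (auto simp: True square_mod_4 split: if_splits)
      then obtain k where k: "a = 2 * k + b" by (metis dvdE diff_add_cancel)
      have "x = of_int k + of_int b * int_gen D"
        unfolding int_gen_comb if_P[OF True] x ab k by (simp add: add_divide_distrib)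
      then show ?thesis by blast
    next
      case False
      then have "even a \<and> even b" using m D123 by (auto simp: square_mod_4 split: if_splits)
      then obtain k l where "a = 2 * k" "b = 2 * l" by blast
      then have "x = of_int k + of_int l * int_gen D"
        unfolding int_gen_comb if_not_P[OF False] x ab by simp
      then show ?thesis by blast
    qed
  qed
  show "{of_int a + of_int b * int_gen D | a b. True} \<subseteq> integers_of (quadratic_field D)"
  proof clarify
    fix a b
    have "of_int a + of_int b * int_gen D \<in> quadratic_field D" by (simp add: int_gen_comb)
    then show "of_int a + of_int b * int_gen D \<in> integers_of (quadratic_field D)"
      using algebraic_int_comb[OF D(1)] by (simp add: integers_of_def)
  qed
qed

lemma int_gen_comb_eq_iff:
  assumes "D > 0"
  shows "of_int a + of_int b * int_gen D = of_int c + of_int d * int_gen D \<longleftrightarrow> a = c \<and> b = d"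
  unfolding int_gen_comb using assms by (cases "D mod 4 = 3") auto

section \<open>Embeddings and discriminants\<close>

lemma det_2:
  fixes A :: "'a :: comm_ring_1 mat"
  assumes A: "A \<in> carrier_mat 2 2"
  shows "Determinant.det A = A $$ (0,0) * A $$ (1,1) - A $$ (0,1) * A $$ (1,0)"
proof -
  have d: "mat_delete A 0 j \<in> carrier_mat 1 1" for j using mat_delete_carrier[of A 2 2 0 j] A by simp
  have "Determinant.det A = (\<Sum>j<2. A $$ (0,j) * cofactor A 0 j)" by (rule laplace_expansion_row[OF A]) simp
  also have "\<dots> = A $$ (0,0) * cofactor A 0 0 + A $$ (0,1) * cofactor A 0 1" by (simp add: numeral_2_eq_2)
  also have "cofactor A 0 0 = A $$ (1,1)"
    using det_single[OF d[of 0]] A by (simp add: cofactor_def mat_delete_def)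
  also have "cofactor A 0 1 = - A $$ (1,0)"
    using det_single[OF d[of 1]] A by (simp add: cofactor_def mat_delete_def)
  finally show ?thesis by simp
qed

text \<open>An embedding fixes the rationals and sends \<open>sqrt_neg D\<close> to one of the two
  square roots of \<open>- D\<close>.\<close>

lemma field_embeddings_quadratic_field:
  assumes D: "D > 0"
  shows "field_embeddings (quadratic_field D) = {restrict id (quadratic_field D), restrict cnj (quadratic_field D)}"
proof
  let ?K = "quadratic_field D"
  note S = subfield_complexD[OF subfield_quadratic_field[OF D]]
  show "field_embeddings ?K \<subseteq> {restrict id ?K, restrict cnj ?K}"
  proof
    fix \<sigma> assume "\<sigma> \<in> field_embeddings ?K"
    then have h: "\<sigma> \<in> Ring.ring_hom (complex_ring\<lparr>carrier := ?K\<rparr>) complex_ring" and e: "\<sigma> \<in> extensional ?K"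
      by (auto simp: field_embeddings_def)
    have mult: "\<sigma> (x * y) = \<sigma> x * \<sigma> y" and add: "\<sigma> (x + y) = \<sigma> x + \<sigma> y" if "x \<in> ?K" "y \<in> ?K" for x y
      using ring_hom_mult[OF h] ring_hom_add[OF h] that by simp_all
    have one: "\<sigma> 1 = 1" using ring_hom_one[OF h] by simp
    have zero: "\<sigma> 0 = 0" using add[of 0 0] S(2) by simp
    have minus: "\<sigma> (- x) = - \<sigma> x" if "x \<in> ?K" for x
      using add[OF that S(5)[OF that]] zero by (simp add: add_eq_0_iff)
    have nat: "\<sigma> (of_nat n) = of_nat n" for n
    proof (induction n)
      case (Suc n)
      have "of_nat n \<in> ?K" using S(7) by auto
      then show ?case using add[OF S(1), of "of_nat n"] Suc one by simp
    qed (use zero in simp)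
    have natK: "of_nat n \<in> ?K" and intK: "of_int z \<in> ?K" and ratK: "of_rat r \<in> ?K" for n z r using S(7) by auto
    have int: "\<sigma> (of_int z) = of_int z" for z
      using nat[of "nat z"] nat[of "nat (- z)"] minus[OF natK, of "nat (- z)"] by (cases "z \<ge> 0") auto
    have rat: "\<sigma> (of_rat r) = of_rat r" for r
    proof -
      obtain a b where ab: "r = of_int a / of_int b" "b > 0"
        using quotient_of_div[of r] quotient_of_denom_pos[of r] by (cases "quotient_of r") auto
      have "of_rat r * of_int b = (of_int a :: complex)" using ab by (simp add: of_rat_divide)
      then have "\<sigma> (of_rat r) * of_int b = of_int a" using mult[OF ratK intK, of r b] int by metis
      then have "\<sigma> (of_rat r) * of_int b = of_rat r * of_int b" using \<open>of_rat r * of_int b = of_int a\<close> by simp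
      then show ?thesis using ab by simp
    qed
    have w: "sqrt_neg D \<in> ?K" using qelt_in_quadratic_field[of D 0 1] by simp
    have "\<sigma> (sqrt_neg D) * \<sigma> (sqrt_neg D) = \<sigma> (- of_nat D)" using mult[OF w w] by simp
    also have "\<dots> = sqrt_neg D * sqrt_neg D" using minus[OF natK] nat by simp
    finally have "(\<sigma> (sqrt_neg D))\<^sup>2 = (sqrt_neg D)\<^sup>2" by (simp only: power2_eq_square)
    then have cases: "\<sigma> (sqrt_neg D) = sqrt_neg D \<or> \<sigma> (sqrt_neg D) = - sqrt_neg D" by (simp only: power2_eq_iff)
    have val: "\<sigma> (qelt D a b) = of_rat a + of_rat b * \<sigma> (sqrt_neg D)" for a b
      using add[OF ratK S(3)[OF ratK w]] mult[OF ratK w] rat by (simp add: qelt_def)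
    from cases show "\<sigma> \<in> {restrict id ?K, restrict cnj ?K}"
    proof
      assume *: "\<sigma> (sqrt_neg D) = sqrt_neg D"
      have "\<sigma> x = x" if "x \<in> ?K" for x
        using that by (elim quadratic_fieldE) (simp only: val *, simp only: qelt_def)
      then have "\<sigma> = restrict id ?K" using e by (intro extensionalityI[of _ ?K]) auto
      then show ?thesis by simp
    next
      assume *: "\<sigma> (sqrt_neg D) = - sqrt_neg D"
      have "\<sigma> x = cnj x" if "x \<in> ?K" for x
        using that by (elim quadratic_fieldE) (simp only: val * cnj_qelt, simp add: qelt_def of_rat_minus)
      then have "\<sigma> = restrict cnj ?K" using e by (intro extensionalityI[of _ ?K]) auto
      then show ?thesis by simp
    qed
  qed
  show "{restrict id ?K, restrict cnj ?K} \<subseteq> field_embeddings ?K"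
    using S(1,3,4) by (auto simp: field_embeddings_def intro!: ring_hom_memI)
qed

lemma integral_basis_int_gen:
  assumes D: "D > 0" "squarefree D"
  shows "integral_basis (quadratic_field D) [1, int_gen D]"
  unfolding integral_basis_def
proof
  let ?O = "integers_of (quadratic_field D)"
  have "of_int 1 + of_int 0 * int_gen D \<in> ?O" "of_int 0 + of_int 1 * int_gen D \<in> ?O"
    unfolding integers_of_quadratic_field[OF D] by blast+
  then show "set [1, int_gen D] \<subseteq> ?O" by simp
  show "\<forall>x\<in>?O. \<exists>!cs. length cs = length [1, int_gen D] \<and>
      x = (\<Sum>i<length [1, int_gen D]. of_int (cs ! i) * [1, int_gen D] ! i)"
  proof
    fix x assume "x \<in> ?O"
    then obtain a b where x: "x = of_int a + of_int b * int_gen D"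
      unfolding integers_of_quadratic_field[OF D] by blast
    have *: "(\<Sum>i<length [1, int_gen D]. of_int (cs ! i) * [1, int_gen D] ! i)
        = of_int (cs ! 0) + of_int (cs ! 1) * int_gen D" for cs :: "int list"
      by (simp add: numeral_2_eq_2)
    show "\<exists>!cs. length cs = length [1, int_gen D] \<and>
      x = (\<Sum>i<length [1, int_gen D]. of_int (cs ! i) * [1, int_gen D] ! i)"
    proof (rule ex1I[of _ "[a, b]"])
      show "length [a, b] = length [1, int_gen D] \<and>
          x = (\<Sum>i<length [1, int_gen D]. of_int ([a, b] ! i) * [1, int_gen D] ! i)"
        unfolding * by (simp add: x)
      fix cs assume "length cs = length [1, int_gen D] \<and>
          x = (\<Sum>i<length [1, int_gen D]. of_int (cs ! i) * [1, int_gen D] ! i)"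
      then have cs: "length cs = 2" "of_int a + of_int b * int_gen D = of_int (cs ! 0) + of_int (cs ! 1) * int_gen D"
        unfolding * x by simp_all
      then show "cs = [a, b]"
        using int_gen_comb_eq_iff[OF D(1)] by (cases cs; cases "tl cs") auto
    qed
  qed
qed

lemma field_discriminant_quadratic_field:
  assumes D: "D > 0" "squarefree D"
  shows "field_discriminant (quadratic_field D) = (if D mod 4 = 3 then - int D else - 4 * int D)"
proof -
  let ?K = "quadratic_field D" and ?g = "int_gen D"
  define \<Delta> where "\<Delta> = (if D mod 4 = 3 then - int D else - 4 * int D)"
  let ?id = "restrict id ?K" and ?cnj = "restrict cnj ?K"
  have gK: "?g \<in> ?K" and oneK: "1 \<in> ?K"
    using integral_basis_int_gen[OF D] by (auto simp: integral_basis_def integers_of_def)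
  have diff: "?g - cnj ?g = (if D mod 4 = 3 then sqrt_neg D else 2 * sqrt_neg D)"
  proof (cases "D mod 4 = 3")
    case True
    have "?g - cnj ?g = qelt D (1 / 2) (1 / 2) + qelt D (- (1 / 2)) (1 / 2)"
      using True by (simp add: int_gen_def cnj_qelt qelt_minus flip: diff_conv_add_uminus)
    then show ?thesis using True by (simp add: qelt_add)
  qed (simp add: int_gen_def)
  have sq: "(?g - cnj ?g)\<^sup>2 = of_int \<Delta>" unfolding diff \<Delta>_def by (simp add: power_mult_distrib)
  have "?id ?g \<noteq> ?cnj ?g"
  proof
    assume "?id ?g = ?cnj ?g"
    then have "?g - cnj ?g = 0" using gK by simp
    then show False using sq D by (simp add: \<Delta>_def split: if_splits)
  qed
  then have ne: "?id \<noteq> ?cnj" by metis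
  have emb: "field_embeddings ?K = {?id, ?cnj}" by (rule field_embeddings_quadratic_field[OF D(1)])
  have det: "(Determinant.det (Matrix.mat 2 2 (\<lambda>(i, j). (\<sigma>s ! i) (ws ! j))))\<^sup>2 = of_int \<Delta>"
    if ws: "integral_basis ?K ws" "length ws = 2" and \<sigma>: "distinct \<sigma>s" "set \<sigma>s = field_embeddings ?K" "length \<sigma>s = 2"
    for ws \<sigma>s
  proof -
    have O: "integers_of ?K = {of_int a + of_int b * ?g | a b. True}" by (rule integers_of_quadratic_field[OF D])
    have wO: "ws ! 0 \<in> integers_of ?K" "ws ! 1 \<in> integers_of ?K"
      using ws by (auto simp: integral_basis_def)
    obtain a b where ab: "ws ! 0 = of_int a + of_int b * ?g" using wO(1) unfolding O by blast
    obtain c d where cd: "ws ! 1 = of_int c + of_int d * ?g" using wO(2) unfolding O by blast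
    have comb: "\<exists>e f :: int. x = of_int e * (ws ! 0) + of_int f * (ws ! 1)" if "x \<in> integers_of ?K" for x
    proof -
      have "\<exists>!cs :: int list. length cs = length ws \<and> x = (\<Sum>i<length ws. of_int (cs ! i) * ws ! i)"
        using ws(1) that unfolding integral_basis_def by (elim conjE) (rule bspec)
      then obtain cs :: "int list" where "x = (\<Sum>i<length ws. of_int (cs ! i) * ws ! i)"
        by (elim ex1E) simp
      then have "x = of_int (cs ! 0) * (ws ! 0) + of_int (cs ! 1) * (ws ! 1)"
        unfolding ws(2) by (simp add: numeral_2_eq_2)
      then show ?thesis by blast
    qed
    have "1 \<in> integers_of ?K" "?g \<in> integers_of ?K" using integral_basis_int_gen[OF D] by (auto simp: integral_basis_def)
    then obtain e f g h where ef: "1 = of_int e * (ws ! 0) + of_int f * (ws ! 1)"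
      and gh: "?g = of_int g * (ws ! 0) + of_int h * (ws ! 1)" using comb by metis
    have "of_int 1 + of_int 0 * ?g = of_int (e * a + f * c) + of_int (e * b + f * d) * ?g"
      using ef unfolding ab cd by (simp add: algebra_simps)
    then have 1: "e * a + f * c = 1" "e * b + f * d = 0" unfolding int_gen_comb_eq_iff[OF D(1)] by auto
    have "of_int 0 + of_int 1 * ?g = of_int (g * a + h * c) + of_int (g * b + h * d) * ?g"
      using gh unfolding ab cd by (simp add: algebra_simps)
    then have 2: "g * a + h * c = 0" "g * b + h * d = 1" unfolding int_gen_comb_eq_iff[OF D(1)] by auto
    \<comment> \<open>The matrices from the standard basis to \<open>ws\<close> and back are inverse
      to each other, so their determinants are units; the square in the definition of the
      discriminant removes the sign.\<close>
    have "(a * d - b * c) * (e * h - f * g) = (e * a + f * c) * (g * b + h * d) - (e * b + f * d) * (g * a + h * c)"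
      by (simp add: algebra_simps)
    also have "\<dots> = 1" using 1 2 by simp
    finally have "(a * d - b * c) dvd 1" by (metis dvd_triv_left)
    then have unit: "(a * d - b * c)\<^sup>2 = 1" by (simp add: power2_eq_1_iff abs_if split: if_splits)
    have wK: "ws ! 0 \<in> ?K" "ws ! 1 \<in> ?K" using wO by (auto simp: integers_of_def)
    have "\<exists>x y. \<sigma>s = [x, y]" using \<sigma>(3) by (cases \<sigma>s; cases "tl \<sigma>s") auto
    then obtain x y where xy: "\<sigma>s = [x, y]" by blast
    have "\<sigma>s = [?id, ?cnj] \<or> \<sigma>s = [?cnj, ?id]"
      using \<sigma>(1,2) unfolding emb xy by (auto simp: doubleton_eq_iff)
    then have "Determinant.det (Matrix.mat 2 2 (\<lambda>(i, j). (\<sigma>s ! i) (ws ! j))) = ws ! 0 * cnj (ws ! 1) - ws ! 1 * cnj (ws ! 0)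
      \<or> Determinant.det (Matrix.mat 2 2 (\<lambda>(i, j). (\<sigma>s ! i) (ws ! j))) = - (ws ! 0 * cnj (ws ! 1) - ws ! 1 * cnj (ws ! 0))"
      using wK by (subst (1 2) det_2) (auto simp: algebra_simps)
    then have "(Determinant.det (Matrix.mat 2 2 (\<lambda>(i, j). (\<sigma>s ! i) (ws ! j))))\<^sup>2 = (ws ! 0 * cnj (ws ! 1) - ws ! 1 * cnj (ws ! 0))\<^sup>2"
      by (auto simp: power2_commute)
    also have "ws ! 0 * cnj (ws ! 1) - ws ! 1 * cnj (ws ! 0) = - of_int (a * d - b * c) * (?g - cnj ?g)"
      unfolding ab cd by (simp add: algebra_simps)
    also have "\<dots>\<^sup>2 = of_int ((a * d - b * c)\<^sup>2) * (?g - cnj ?g)\<^sup>2"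
      by (simp only: power_mult_distrib power2_minus of_int_power)
    also have "\<dots> = of_int \<Delta>" unfolding unit sq by simp
    finally show ?thesis .
  qed
  have "field_discriminant ?K = \<Delta>"
    unfolding field_discriminant_def
  proof (rule the_equality)
    show "\<exists>ws \<sigma>s. integral_basis ?K ws \<and> distinct \<sigma>s \<and> set \<sigma>s = field_embeddings ?K \<and> length \<sigma>s = length ws \<and>
        of_int \<Delta> = (Determinant.det (Matrix.mat (length ws) (length ws) (\<lambda>(i, j). (\<sigma>s ! i) (ws ! j))))\<^sup>2"
    proof (intro exI conjI)
      show ib: "integral_basis ?K [1, ?g]" by (rule integral_basis_int_gen[OF D])
      show "distinct [?id, ?cnj]" "set [?id, ?cnj] = field_embeddings ?K" using ne emb by auto
      from det[OF ib _ this]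
      show "of_int \<Delta> = (Determinant.det (Matrix.mat (length [1, ?g]) (length [1, ?g]) (\<lambda>(i, j). ([?id, ?cnj] ! i) ([1, ?g] ! j))))\<^sup>2"
        by (simp add: numeral_2_eq_2)
    qed simp
  next
    fix d assume "\<exists>ws \<sigma>s. integral_basis ?K ws \<and> distinct \<sigma>s \<and> set \<sigma>s = field_embeddings ?K \<and> length \<sigma>s = length ws \<and>
        of_int d = (Determinant.det (Matrix.mat (length ws) (length ws) (\<lambda>(i, j). (\<sigma>s ! i) (ws ! j))))\<^sup>2"
    then obtain ws \<sigma>s where *: "integral_basis ?K ws" "distinct \<sigma>s" "set \<sigma>s = field_embeddings ?K" "length \<sigma>s = length ws"
        "of_int d = (Determinant.det (Matrix.mat (length ws) (length ws) (\<lambda>(i, j). (\<sigma>s ! i) (ws ! j))))\<^sup>2" by blast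
    have "length \<sigma>s = card (set \<sigma>s)" using *(2) by (simp add: distinct_card)
    then have "length \<sigma>s = 2" using *(3) emb ne by simp
    then have "of_int d = (of_int \<Delta> :: complex)" using det[OF *(1) _ *(2,3)] * by simp
    then show "d = \<Delta>" by simp
  qed
  then show ?thesis by (simp add: \<Delta>_def)
qed

text \<open>Required because \<open>card\<close> of an infinite set is 0: it makes the count
  monotone under inclusion.\<close>

lemma finite_imaginary_quadratic_fields:
  "finite {K. imaginary_quadratic_field K \<and> real_of_int (abs (field_discriminant K)) \<le> x}"
proof (rule finite_subset)
  show "{K. imaginary_quadratic_field K \<and> real_of_int (abs (field_discriminant K)) \<le> x}
      \<subseteq> quadratic_field ` {..nat \<lfloor>x\<rfloor>}"
  proof clarify
    fix K assume K: "imaginary_quadratic_field K" "real_of_int (abs (field_discriminant K)) \<le> x"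
    from K(1) obtain D where D: "D > 0" "squarefree D" "K = quadratic_field D"
      by (rule imaginary_quadratic_field_cases)
    have "real D \<le> x" using K(2) unfolding D(3) field_discriminant_quadratic_field[OF D(1,2)]
      by (auto split: if_splits)
    then have "D \<le> nat \<lfloor>x\<rfloor>" by (rule le_nat_floor)
    then show "K \<in> quadratic_field ` {..nat \<lfloor>x\<rfloor>}" using D by blast
  qed
qed simp

section \<open>Ideal classes\<close>

text \<open>Isolates the facts on which the monoid of fractional ideals rests. For the fields in
  question closure and denominators are read off from the explicit description of the
  integers.\<close>

locale integer_ring =
  fixes K :: "complex set"
  assumes subfield_K: "subfield K complex_ring"
    and integers_add: "x \<in> integers_of K \<Longrightarrow> y \<in> integers_of K \<Longrightarrow> x + y \<in> integers_of K"
    and integers_mult: "x \<in> integers_of K \<Longrightarrow> y \<in> integers_of K \<Longrightarrow> x * y \<in> integers_of K"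
    and denominator: "x \<in> K \<Longrightarrow> \<exists>d \<in> integers_of K - {0}. d * x \<in> integers_of K"
begin

abbreviation R :: "complex set" where "R \<equiv> integers_of K"

abbreviation G :: "complex set monoid" where "G \<equiv> fractional_ideal_group K"

abbreviation Pr :: "complex set set" where "Pr \<equiv> principal_fractional_ideals K"

abbreviation prd :: "complex set \<Rightarrow> complex set \<Rightarrow> complex set" (infixl "\<diamondop>" 70) where
  "I \<diamondop> J \<equiv> ideal_prod complex_ring I J"

lemmas K_closed = subfield_complexD[OF subfield_K]

lemma of_int_R: "of_int n \<in> R"
  using K_closed(7) by (auto simp: integers_of_def)

lemma one_R: "1 \<in> R" and zero_R: "0 \<in> R" and neg_one_R: "- 1 \<in> R"
  using of_int_R[of 1] of_int_R[of 0] of_int_R[of "- 1"] by simp_all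

lemma R_subset_K: "R \<subseteq> K"
  by (auto simp: integers_of_def)

lemma integers_minus: "x \<in> R \<Longrightarrow> - x \<in> R"
  using integers_mult[OF neg_one_R] by simp

lemma ring_R: "ring (ring_of_integers K)"
  by (intro ring.subring_is_ring[OF complex_is_ring] subring_complexI integers_add integers_mult integers_minus one_R)

lemma ideal_iff:
  "ideal J (ring_of_integers K) \<longleftrightarrow>
     J \<subseteq> R \<and> 0 \<in> J \<and> (\<forall>x\<in>J. \<forall>y\<in>J. x + y \<in> J) \<and> (\<forall>a\<in>R. \<forall>x\<in>J. a * x \<in> J)"
proof
  assume i: "ideal J (ring_of_integers K)"
  then interpret ideal J "ring_of_integers K" .
  note as = ideal.axioms(1)[OF i]
  show "J \<subseteq> R \<and> 0 \<in> J \<and> (\<forall>x\<in>J. \<forall>y\<in>J. x + y \<in> J) \<and> (\<forall>a\<in>R. \<forall>x\<in>J. a * x \<in> J)"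
    using additive_subgroup.a_subset[OF as] additive_subgroup.a_closed[OF as]
      additive_subgroup.zero_closed[OF as] I_l_closed by auto
next
  assume *: "J \<subseteq> R \<and> 0 \<in> J \<and> (\<forall>x\<in>J. \<forall>y\<in>J. x + y \<in> J) \<and> (\<forall>a\<in>R. \<forall>x\<in>J. a * x \<in> J)"
  have comm: "x * a \<in> J" if "a \<in> R" "x \<in> J" for a x using * that by (simp add: mult.commute[of x])
  have neg: "- x \<in> J" if "x \<in> J" for x using * neg_one_R that by (metis mult_minus1)
  show "ideal J (ring_of_integers K)"
  proof (rule idealI[OF ring_R])
    interpret ring "ring_of_integers K" by (rule ring_R)
    show "subgroup J (add_monoid (ring_of_integers K))"
    proof (rule group.subgroupI)
      show "group (add_monoid (ring_of_integers K))" by (rule a_group)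
      fix x assume x: "x \<in> J"
      have "inv\<^bsub>add_monoid (ring_of_integers K)\<^esub> x = - x"
        by (rule group.inv_equality[OF a_group]) (use x * neg in auto)
      then show "inv\<^bsub>add_monoid (ring_of_integers K)\<^esub> x \<in> J" using neg x by simp
    qed (use * in auto)
  qed (use * comm in auto)
qed

lemma fractional_ideal_iff:
  "fractional_ideal K I \<longleftrightarrow> I \<subseteq> K \<and> I \<noteq> {0} \<and> 0 \<in> I \<and> (\<forall>x\<in>I. \<forall>y\<in>I. x + y \<in> I)
     \<and> (\<forall>a\<in>R. \<forall>x\<in>I. a * x \<in> I) \<and> (\<exists>d\<in>R - {0}. \<forall>x\<in>I. d * x \<in> R)"
proof -
  have "ideal ((*) d ` I) (ring_of_integers K) \<longleftrightarrow>
     0 \<in> I \<and> (\<forall>x\<in>I. \<forall>y\<in>I. x + y \<in> I) \<and> (\<forall>a\<in>R. \<forall>x\<in>I. a * x \<in> I) \<and> (\<forall>x\<in>I. d * x \<in> R)"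
    if d: "d \<noteq> 0" for d
  proof -
    have 1: "d * x \<in> (*) d ` I \<longleftrightarrow> x \<in> I" for x using d by auto
    have 2: "d * x + d * y \<in> (*) d ` I \<longleftrightarrow> x + y \<in> I" "a * (d * x) \<in> (*) d ` I \<longleftrightarrow> a * x \<in> I"
      "0 \<in> (*) d ` I \<longleftrightarrow> 0 \<in> I" for x y a
      using 1[of "x + y"] 1[of "a * x"] 1[of 0] by (simp_all add: algebra_simps)
    show ?thesis unfolding ideal_iff using 2 by (auto simp: image_subset_iff)
  qed
  then show ?thesis unfolding fractional_ideal_def by (auto 0 4)
qed

lemma fractional_idealD:
  assumes "fractional_ideal K I"
  shows "I \<subseteq> K" "I \<noteq> {0}" "0 \<in> I" "x \<in> I \<Longrightarrow> y \<in> I \<Longrightarrow> x + y \<in> I" "a \<in> R \<Longrightarrow> x \<in> I \<Longrightarrow> a * x \<in> I"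
    "\<exists>d\<in>R - {0}. \<forall>x\<in>I. d * x \<in> R" "\<exists>x\<in>I. x \<noteq> 0"
  using assms unfolding fractional_ideal_iff by blast+

lemma prod_memI: "i \<in> I \<Longrightarrow> j \<in> J \<Longrightarrow> i * j \<in> I \<diamondop> J"
  using ideal_prod.prod[of i I j J complex_ring] by simp

lemma prod_addI: "x \<in> I \<diamondop> J \<Longrightarrow> y \<in> I \<diamondop> J \<Longrightarrow> x + y \<in> I \<diamondop> J"
  using ideal_prod.sum[of x complex_ring I J y] by simp

lemma prod_induct [consumes 1, case_names mult add]:
  assumes "x \<in> I \<diamondop> J" "\<And>i j. i \<in> I \<Longrightarrow> j \<in> J \<Longrightarrow> P (i * j)" "\<And>x y. P x \<Longrightarrow> P y \<Longrightarrow> P (x + y)"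
  shows "P x"
  using assms(1) by induction (use assms(2,3) in auto)

lemma prod_commute: "I \<diamondop> J = J \<diamondop> I"
proof -
  have "I \<diamondop> J \<subseteq> J \<diamondop> I" for I J
  proof
    fix x assume "x \<in> I \<diamondop> J" then show "x \<in> J \<diamondop> I"
      by (induction rule: prod_induct) (auto intro: prod_addI simp: mult.commute[of _ _] intro: prod_memI dest: prod_memI[of _ J _ I])
  qed
  then show ?thesis by blast
qed

lemma prod_assoc: "(I \<diamondop> J) \<diamondop> L = I \<diamondop> (J \<diamondop> L)"
proof -
  have 1: "(I \<diamondop> J) \<diamondop> L \<subseteq> I \<diamondop> (J \<diamondop> L)" for I J L
  proof
    fix x assume "x \<in> (I \<diamondop> J) \<diamondop> L" then show "x \<in> I \<diamondop> (J \<diamondop> L)"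
    proof (induction rule: prod_induct)
      case (mult s l)
      from mult(1) show ?case
      proof (induction rule: prod_induct)
        case (mult i j)
        then show ?case using \<open>l \<in> L\<close> by (simp add: mult.assoc prod_memI)
      next
        case (add x y)
        then show ?case by (simp add: distrib_right prod_addI)
      qed
    qed (rule prod_addI)
  qed
  have "I \<diamondop> (J \<diamondop> L) = (L \<diamondop> J) \<diamondop> I" by (simp add: prod_commute)
  also have "\<dots> \<subseteq> L \<diamondop> (J \<diamondop> I)" by (rule 1)
  also have "\<dots> = (I \<diamondop> J) \<diamondop> L" by (simp add: prod_commute)
  finally show ?thesis using 1 by blast
qed

lemma prod_R: "fractional_ideal K I \<Longrightarrow> R \<diamondop> I = I"
proof
  assume I: "fractional_ideal K I"
  note D = fractional_idealD[OF I]
  show "R \<diamondop> I \<subseteq> I"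
  proof
    fix x assume "x \<in> R \<diamondop> I" then show "x \<in> I" by (induction rule: prod_induct) (auto intro: D)
  qed
  show "I \<subseteq> R \<diamondop> I" using prod_memI[OF one_R, of _ I] by auto
qed

lemma fractional_ideal_prod:
  assumes I: "fractional_ideal K I" and J: "fractional_ideal K J"
  shows "fractional_ideal K (I \<diamondop> J)"
  unfolding fractional_ideal_iff
proof (intro conjI ballI)
  note D = fractional_idealD[OF I] and E = fractional_idealD[OF J]
  show "I \<diamondop> J \<subseteq> K"
  proof
    fix x assume "x \<in> I \<diamondop> J" then show "x \<in> K"
      by (induction rule: prod_induct) (use D(1) E(1) K_closed in auto)
  qed
  obtain x y where "x \<in> I" "x \<noteq> 0" "y \<in> J" "y \<noteq> 0" using D(7) E(7) by blast
  then have "x * y \<in> I \<diamondop> J" "x * y \<noteq> 0" by (auto intro: prod_memI)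
  then show "I \<diamondop> J \<noteq> {0}" by blast
  show "0 \<in> I \<diamondop> J" using prod_memI[OF D(3) E(3)] by simp
  show "x + y \<in> I \<diamondop> J" if "x \<in> I \<diamondop> J" "y \<in> I \<diamondop> J" for x y by (rule prod_addI[OF that])
  show "a * x \<in> I \<diamondop> J" if a: "a \<in> R" and x: "x \<in> I \<diamondop> J" for a x
    using x
  proof (induction rule: prod_induct)
    case (mult i j)
    then show ?case using prod_memI[OF D(5)[OF a], of i j J] by (simp add: mult.assoc)
  next
    case (add x y)
    then show ?case by (simp add: distrib_left prod_addI)
  qed
  obtain d e where d: "d \<in> R - {0}" "\<And>x. x \<in> I \<Longrightarrow> d * x \<in> R" and e: "e \<in> R - {0}" "\<And>x. x \<in> J \<Longrightarrow> e * x \<in> R"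
    using D(6) E(6) by blast
  have "d * e * x \<in> R" if "x \<in> I \<diamondop> J" for x using that
  proof (induction rule: prod_induct)
    case (mult i j)
    then show ?case using integers_mult[OF d(2)[of i] e(2)[of j]] by (simp add: mult_ac)
  next
    case (add x y)
    then show ?case by (simp add: distrib_left integers_add)
  qed
  moreover have "d * e \<in> R - {0}" using d(1) e(1) integers_mult by auto
  ultimately show "\<exists>d\<in>R - {0}. \<forall>x\<in>I \<diamondop> J. d * x \<in> R" by blast
qed

lemma fractional_ideal_principal: "x \<in> K - {0} \<Longrightarrow> fractional_ideal K ((*) x ` R)"
  unfolding fractional_ideal_iff
proof (intro conjI ballI)
  assume x: "x \<in> K - {0}"
  show "(*) x ` R \<subseteq> K" using x R_subset_K K_closed(3) by auto
  have "x * 1 \<in> (*) x ` R" using one_R by blast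
  then show "(*) x ` R \<noteq> {0}" using x by auto
  have "x * 0 \<in> (*) x ` R" using zero_R by blast
  then show "0 \<in> (*) x ` R" by simp
  show "y + z \<in> (*) x ` R" if "y \<in> (*) x ` R" "z \<in> (*) x ` R" for y z
    using that integers_add by (auto simp flip: distrib_left)
  show "a * y \<in> (*) x ` R" if "a \<in> R" "y \<in> (*) x ` R" for a y
    using that integers_mult by (auto simp: mult.left_commute[of a])
  obtain d where "d \<in> R - {0}" "d * x \<in> R" using denominator x by blast
  then show "\<exists>d\<in>R - {0}. \<forall>y\<in>(*) x ` R. d * y \<in> R"
    using integers_mult by (auto intro!: bexI[of _ d] simp flip: mult.assoc)
qed

lemma fractional_ideal_R: "fractional_ideal K R"
  using fractional_ideal_principal[of 1] K_closed(1) by (simp add: image_def)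

lemma principal_prod:
  assumes I: "fractional_ideal K I"
  shows "((*) x ` R) \<diamondop> I = (*) x ` I"
proof
  note D = fractional_idealD[OF I]
  show "((*) x ` R) \<diamondop> I \<subseteq> (*) x ` I"
  proof
    fix y assume "y \<in> ((*) x ` R) \<diamondop> I" then show "y \<in> (*) x ` I"
      by (induction rule: prod_induct) (auto simp: mult.assoc simp flip: distrib_left intro!: imageI D)
  qed
  show "(*) x ` I \<subseteq> ((*) x ` R) \<diamondop> I"
  proof clarify
    fix y assume "y \<in> I"
    then have "(x * 1) * y \<in> ((*) x ` R) \<diamondop> I" using one_R by (intro prod_memI) auto
    then show "x * y \<in> ((*) x ` R) \<diamondop> I" by simp
  qed
qed

lemma G_simps [simp]: "carrier G = {I. fractional_ideal K I}" "I \<otimes>\<^bsub>G\<^esub> J = I \<diamondop> J" "\<one>\<^bsub>G\<^esub> = R"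
  by (simp_all add: fractional_ideal_group_def)

lemma comm_monoid_G: "comm_monoid G"
proof (rule comm_monoidI)
  fix I J show "I \<otimes>\<^bsub>G\<^esub> J = J \<otimes>\<^bsub>G\<^esub> I" by (simp add: prod_commute)
qed (auto simp: fractional_ideal_prod fractional_ideal_R prod_assoc prod_R)

definition cl :: "complex set \<Rightarrow> complex set set" where
  "cl I = Pr #>\<^bsub>G\<^esub> I"

lemma cl_eq: "fractional_ideal K I \<Longrightarrow> cl I = {(*) x ` I | x. x \<in> K - {0}}"
  unfolding cl_def r_coset_def principal_fractional_ideals_def by (auto simp: principal_prod)

lemma cl_R: "cl R = Pr"
  by (simp add: cl_eq[OF fractional_ideal_R] principal_fractional_ideals_def)

lemma fractional_ideal_scale:
  assumes "fractional_ideal K I" "x \<in> K - {0}"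
  shows "fractional_ideal K ((*) x ` I)"
  using fractional_ideal_prod[OF fractional_ideal_principal[OF assms(2)] assms(1)] assms(1)
  by (simp add: principal_prod)

lemma cl_eq_iff:
  assumes I: "fractional_ideal K I" and J: "fractional_ideal K J"
  shows "cl I = cl J \<longleftrightarrow> (\<exists>x\<in>K - {0}. J = (*) x ` I)"
proof
  assume "cl I = cl J"
  moreover have "J \<in> cl J" unfolding cl_eq[OF J] using K_closed(1) by (auto intro!: exI[of _ 1])
  ultimately show "\<exists>x\<in>K - {0}. J = (*) x ` I" unfolding cl_eq[OF I] by blast
next
  assume "\<exists>x\<in>K - {0}. J = (*) x ` I"
  then obtain x where x: "x \<in> K - {0}" "J = (*) x ` I" by blast
  have "(*) y ` J = (*) (y * x) ` I" for y by (simp add: x image_image mult.assoc)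
  moreover have "(*) y ` I = (*) (y / x) ` J" for y using x by (simp add: x image_image)
  moreover have "y * x \<in> K - {0}" "y / x \<in> K - {0}" if "y \<in> K - {0}" for y
    using that x K_closed(3,6) by (auto simp: divide_inverse)
  ultimately have "(\<exists>y. L = (*) y ` I \<and> y \<in> K - {0}) \<longleftrightarrow> (\<exists>y. L = (*) y ` J \<and> y \<in> K - {0})" for L
    by metis
  then show "cl I = cl J" unfolding cl_eq[OF I] cl_eq[OF J] by (rule Collect_cong)
qed

lemma class_group_simps:
  "carrier (class_group K) = cl ` {I. fractional_ideal K I}" "\<one>\<^bsub>class_group K\<^esub> = cl R"
  by (auto simp: class_group_def FactGroup_def RCOSETS_def cl_def cl_R[unfolded cl_def])

lemma class_group_mult:
  assumes I: "fractional_ideal K I" and J: "fractional_ideal K J"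
  shows "cl I \<otimes>\<^bsub>class_group K\<^esub> cl J = cl (I \<diamondop> J)"
proof -
  have *: "((*) x ` I) \<diamondop> ((*) y ` J) = (*) (x * y) ` (I \<diamondop> J)" if "x \<in> K - {0}" "y \<in> K - {0}" for x y
  proof -
    have "((*) x ` I) \<diamondop> ((*) y ` J) = (((*) x ` R) \<diamondop> I) \<diamondop> (((*) y ` R) \<diamondop> J)"
      using I J by (simp add: principal_prod)
    also have "\<dots> = ((*) x ` R) \<diamondop> (((*) y ` R) \<diamondop> (I \<diamondop> J))"
      by (metis prod_assoc prod_commute)
    also have "\<dots> = (*) (x * y) ` (I \<diamondop> J)"
      using fractional_ideal_prod[OF I J] fractional_ideal_scale[OF _ that(2)]
      by (simp add: principal_prod image_image mult.assoc)
    finally show ?thesis .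
  qed
  have "cl I \<otimes>\<^bsub>class_group K\<^esub> cl J = cl I <#>\<^bsub>G\<^esub> cl J"
    by (simp add: class_group_def FactGroup_def)
  also have "\<dots> = {((*) x ` I) \<diamondop> ((*) y ` J) | x y. x \<in> K - {0} \<and> y \<in> K - {0}}"
    unfolding cl_eq[OF I] cl_eq[OF J] set_mult_def by auto
  also have "\<dots> = {(*) z ` (I \<diamondop> J) | z. z \<in> K - {0}}"
  proof -
    have "\<exists>x y. x \<in> K - {0} \<and> y \<in> K - {0} \<and> z = x * y" if "z \<in> K - {0}" for z
      using that K_closed(1) by (intro exI[of _ z] exI[of _ 1]) auto
    moreover have "x * y \<in> K - {0}" if "x \<in> K - {0}" "y \<in> K - {0}" for x y using that K_closed(3) by auto
    ultimately show ?thesis using * by (auto 0 4) (metis)+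
  qed
  also have "\<dots> = cl (I \<diamondop> J)" by (rule cl_eq[symmetric, OF fractional_ideal_prod[OF I J]])
  finally show ?thesis .
qed

lemma comm_monoid_class_group: "comm_monoid (class_group K)"
proof (rule comm_monoidI)
  fix a b assume "a \<in> carrier (class_group K)" "b \<in> carrier (class_group K)"
  then show "a \<otimes>\<^bsub>class_group K\<^esub> b = b \<otimes>\<^bsub>class_group K\<^esub> a"
    by (auto simp only: class_group_simps class_group_mult prod_commute mem_Collect_eq elim!: imageE)
qed (auto simp: class_group_simps class_group_mult fractional_ideal_prod fractional_ideal_R prod_assoc prod_R)

end

text \<open>The exponents give an embedding of the square of the cyclic group of order five, whose
  image consists of invertible elements because \<open>a\<close> and \<open>b\<close> have fifth
  power one.\<close>

lemma rk_ge_2: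
  fixes C (structure)
  assumes C: "comm_monoid C" and fin: "finite (carrier C)"
    and a: "a \<in> carrier C" "a [^] (5::nat) = \<one>" and b: "b \<in> carrier C" "b [^] (5::nat) = \<one>"
    and indep: "\<And>(i::nat) (j::nat). i < 5 \<Longrightarrow> j < 5 \<Longrightarrow> a [^] i \<otimes> b [^] j = \<one> \<Longrightarrow> i = 0 \<and> j = 0"
  shows "rk 5 C \<ge> 2"
proof -
  interpret comm_monoid C by (rule C)
  let ?P = "\<lambda>r::nat. product_group {..<r} (\<lambda>_. integer_mod_group 5)"
  let ?Q = "\<lambda>r. \<exists>H. subgroup H C \<and> C\<lparr>carrier := H\<rparr> \<cong> ?P r"
  have period: "x [^] (m mod 5) = x [^] m" if x: "x \<in> carrier C" "x [^] (5::nat) = \<one>" for x and m :: nat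
  proof -
    have "x [^] m = x [^] (5 * (m div 5) + m mod 5)" by simp
    also have "\<dots> = (x [^] (5::nat)) [^] (m div 5) \<otimes> x [^] (m mod 5)"
      using x(1) by (simp only: nat_pow_mult nat_pow_pow)
    finally show ?thesis using x by simp
  qed
  define \<psi> where "\<psi> f = a [^] nat (f 0) \<otimes> b [^] nat (f 1)" for f :: "nat \<Rightarrow> int"
  have gP: "group (?P 2)" by simp
  interpret P: group "?P 2" by (rule gP)
  have car: "f i \<in> {0..<5}" if "f \<in> carrier (?P 2)" "i < 2" for f i
    using PiE_mem[OF that(1)[unfolded carrier_product_group], of i] that(2)
    by (simp add: carrier_integer_mod_group)
  have \<psi>_closed: "\<psi> f \<in> carrier C" for f using a b by (simp add: \<psi>_def)
  have add: "x [^] nat ((m + n) mod 5) = x [^] nat m \<otimes> x [^] nat n"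
    if x: "x \<in> carrier C" "x [^] (5::nat) = \<one>" and mn: "m \<ge> 0" "n \<ge> 0" for x m n
  proof -
    have "nat ((m + n) mod 5) = (nat m + nat n) mod 5" using mn by (simp add: nat_mod_distrib nat_add_distrib)
    then show ?thesis using period[OF x] x(1) by (simp add: nat_pow_mult)
  qed
  have \<psi>_mult: "\<psi> (f \<otimes>\<^bsub>?P 2\<^esub> g) = \<psi> f \<otimes> \<psi> g" if f: "f \<in> carrier (?P 2)" and g: "g \<in> carrier (?P 2)" for f g
  proof -
    have "\<psi> (f \<otimes>\<^bsub>?P 2\<^esub> g) = (a [^] nat (f 0) \<otimes> a [^] nat (g 0)) \<otimes> (b [^] nat (f 1) \<otimes> b [^] nat (g 1))"
      using car[OF f, of 0] car[OF f, of 1] car[OF g, of 0] car[OF g, of 1] add[OF a] add[OF b]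
      by (simp add: \<psi>_def)
    then show ?thesis using a b by (simp add: \<psi>_def m_ac)
  qed
  have \<psi>_one: "\<psi> \<one>\<^bsub>?P 2\<^esub> = \<one>" by (simp add: \<psi>_def)
  have ker: "f = \<one>\<^bsub>?P 2\<^esub>" if f: "f \<in> carrier (?P 2)" "\<psi> f = \<one>" for f
  proof -
    have c: "f 0 \<in> {0..<5}" "f 1 \<in> {0..<5}" using car[OF f(1)] by auto
    then have "nat (f 0) < 5" "nat (f 1) < 5" by auto
    then have "nat (f 0) = 0 \<and> nat (f 1) = 0" using f(2) unfolding \<psi>_def by (rule indep)
    then have "f 0 = 0" "f 1 = 0" using c by auto
    then show ?thesis using f(1) by (auto simp: fun_eq_iff less_2_cases_iff PiE_def extensional_def restrict_def)
  qed
  have inj: "inj_on \<psi> (carrier (?P 2))"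
  proof (rule inj_onI)
    fix f g assume fg: "f \<in> carrier (?P 2)" "g \<in> carrier (?P 2)" "\<psi> f = \<psi> g"
    have "\<psi> (f \<otimes>\<^bsub>?P 2\<^esub> inv\<^bsub>?P 2\<^esub> g) = \<psi> (g \<otimes>\<^bsub>?P 2\<^esub> inv\<^bsub>?P 2\<^esub> g)"
      using \<psi>_mult[OF fg(1) P.inv_closed[OF fg(2)]] \<psi>_mult[OF fg(2) P.inv_closed[OF fg(2)]] fg(3) by (simp only:)
    also have "\<dots> = \<one>" using \<psi>_one P.r_inv[OF fg(2)] by (simp only:)
    finally have "f \<otimes>\<^bsub>?P 2\<^esub> inv\<^bsub>?P 2\<^esub> g = \<one>\<^bsub>?P 2\<^esub>"
      by (rule ker[OF P.m_closed[OF fg(1) P.inv_closed[OF fg(2)]]])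
    then have "f = inv\<^bsub>?P 2\<^esub> (inv\<^bsub>?P 2\<^esub> g)"
      using fg P.inv_equality P.inv_closed by metis
    then show "f = g" using P.inv_inv[OF fg(2)] by (simp only:)
  qed
  define H where "H = \<psi> ` carrier (?P 2)"
  have "subgroup H C"
  proof
    show "H \<subseteq> carrier C" using \<psi>_closed by (auto simp: H_def)
    show "x \<otimes> y \<in> H" if xy: "x \<in> H" "y \<in> H" for x y
    proof -
      obtain f where f: "x = \<psi> f" "f \<in> carrier (?P 2)" using xy(1) unfolding H_def by (rule imageE)
      obtain g where g: "y = \<psi> g" "g \<in> carrier (?P 2)" using xy(2) unfolding H_def by (rule imageE)
      show ?thesis
        unfolding H_def f(1) g(1) \<psi>_mult[OF f(2) g(2), symmetric] by (rule imageI[OF P.m_closed[OF f(2) g(2)]])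
    qed
    show "\<one> \<in> H" unfolding H_def using imageI[OF P.one_closed, of \<psi>] by (simp only: \<psi>_one)
    show "inv x \<in> H" if x: "x \<in> H" for x
    proof -
      obtain f where f: "x = \<psi> f" "f \<in> carrier (?P 2)" using x unfolding H_def by (rule imageE)
      note f = f(2,1)
      have "x \<otimes> \<psi> (inv\<^bsub>?P 2\<^esub> f) = \<one>"
        using \<psi>_mult[OF f(1) P.inv_closed[OF f(1)]] \<psi>_one P.r_inv[OF f(1)] f(2) by (simp only:)
      then have "inv x = \<psi> (inv\<^bsub>?P 2\<^esub> f)" using \<psi>_closed f(2) by (intro comm_inv_char) auto
      then show ?thesis unfolding H_def using imageI[OF P.inv_closed[OF f(1)], of \<psi>] by (simp only:)
    qed
  qed
  moreover have "\<psi> \<in> iso (?P 2) (C\<lparr>carrier := H\<rparr>)"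
  proof -
    have "\<psi> \<in> hom (?P 2) (C\<lparr>carrier := H\<rparr>)"
      by (rule homI) (use \<psi>_mult in \<open>simp_all only: H_def imageI partial_object.simps monoid.simps partial_object.update_convs partial_object.select_convs monoid.select_convs\<close>, simp_all)
    moreover have "bij_betw \<psi> (carrier (?P 2)) H" using inj by (simp add: bij_betw_def H_def)
    ultimately show ?thesis by (simp add: iso_def)
  qed
  then have "iso (?P 2) (C\<lparr>carrier := H\<rparr>) \<noteq> {}" by (rule ex_in_conv[THEN iffD1, OF exI])
  then have "?P 2 \<cong> C\<lparr>carrier := H\<rparr>" unfolding is_iso_def .
  then have "C\<lparr>carrier := H\<rparr> \<cong> ?P 2" by (rule P.iso_sym)
  ultimately have Q2: "?Q 2" by blast
  \<comment> \<open>\<open>GREATEST\<close> yields a usable value only for a bounded set of ranks; a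
    subgroup with \<open>r\<close> factors has \<open>5 ^ r\<close> elements, so finiteness of the
    carrier gives the bound.\<close>
  have "r \<le> card (carrier C)" if "?Q r" for r
  proof -
    from that obtain H where H: "subgroup H C" and iso: "C\<lparr>carrier := H\<rparr> \<cong> ?P r" by (elim exE conjE)
    have "iso (C\<lparr>carrier := H\<rparr>) (?P r) \<noteq> {}" using iso unfolding is_iso_def .
    then obtain h where h: "h \<in> iso (C\<lparr>carrier := H\<rparr>) (?P r)" by (elim ex_in_conv[THEN iffD2, THEN exE])
    have "bij_betw h H (carrier (?P r))" using h by (simp add: iso_def)
    then have "card H = card (carrier (?P r))" by (rule bij_betw_same_card)
    also have "\<dots> = 5 ^ r" by (simp add: card_PiE carrier_integer_mod_group)
    finally have "5 ^ r \<le> card (carrier C)" using card_mono[OF fin subgroup.subset[OF H]] by simp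
    moreover have "r < 5 ^ r" by (rule less_exp[THEN order_less_le_trans]) (simp add: power_mono)
    ultimately show ?thesis by simp
  qed
  then show ?thesis unfolding rk_def using Q2 by (intro Greatest_le_nat[where b = "card (carrier C)"]) auto
qed

section \<open>Ideals with principal fifth power\<close>

context integer_ring
begin

definition gen2 :: "complex \<Rightarrow> complex \<Rightarrow> complex set" where
  "gen2 a b = {x * a + y * b | x y. x \<in> R \<and> y \<in> R}"

lemma gen2I: "x \<in> R \<Longrightarrow> y \<in> R \<Longrightarrow> x * a + y * b \<in> gen2 a b"
  by (auto simp: gen2_def)

lemma gen2E:
  assumes "z \<in> gen2 a b" obtains x y where "z = x * a + y * b" "x \<in> R" "y \<in> R"
  using assms unfolding gen2_def by blast

lemma gen2_gens: "a \<in> gen2 a b" "b \<in> gen2 a b"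
  using gen2I[OF one_R zero_R, of a b] gen2I[OF zero_R one_R, of a b] by simp_all

lemma gen2_subset: "a \<in> R \<Longrightarrow> b \<in> R \<Longrightarrow> gen2 a b \<subseteq> R"
  by (auto simp: gen2_def intro: integers_add integers_mult)

lemma fractional_ideal_gen2:
  assumes "a \<in> R" "b \<in> R" "b \<noteq> 0"
  shows "fractional_ideal K (gen2 a b)"
  unfolding fractional_ideal_iff
proof (intro conjI ballI)
  show "gen2 a b \<subseteq> K" using gen2_subset[OF assms(1,2)] R_subset_K by blast
  show "gen2 a b \<noteq> {0}" using gen2_gens(2)[of b a] assms(3) by auto
  show "0 \<in> gen2 a b" using gen2I[OF zero_R zero_R, of a b] by simp
  show "x + y \<in> gen2 a b" if xy: "x \<in> gen2 a b" "y \<in> gen2 a b" for x y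
  proof -
    obtain p q where "x = p * a + q * b" "p \<in> R" "q \<in> R" using xy(1) by (rule gen2E)
    moreover obtain r s where "y = r * a + s * b" "r \<in> R" "s \<in> R" using xy(2) by (rule gen2E)
    ultimately show ?thesis using gen2I[OF integers_add integers_add, of p r q s a b] by (simp add: algebra_simps)
  qed
  show "c * x \<in> gen2 a b" if cx: "c \<in> R" "x \<in> gen2 a b" for c x
  proof -
    obtain p q where "x = p * a + q * b" "p \<in> R" "q \<in> R" using cx(2) by (rule gen2E)
    then show ?thesis using cx(1) gen2I[OF integers_mult integers_mult, of c p c q a b] by (simp add: algebra_simps)
  qed
  show "\<exists>d\<in>R - {0}. \<forall>x\<in>gen2 a b. d * x \<in> R" using gen2_subset[OF assms(1,2)] one_R by (intro bexI[of _ 1]) auto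
qed

lemma integers_power: "x \<in> R \<Longrightarrow> x ^ n \<in> R"
  by (induction n) (auto intro: one_R integers_mult)

text \<open>No unique factorisation of ideals is needed: since \<open>\<alpha>\<close> and its conjugate are comaximal,
  the powers of \<open>(Q, \<alpha>)\<close> can be written down.\<close>

lemma gen2_prod_step:
  assumes Q: "Q \<in> R" and \<alpha>: "\<alpha> \<in> R" "\<alpha> \<noteq> 0" and \<beta>: "\<alpha> * \<beta> = Q ^ 5"
    and xy: "x \<in> R" "y \<in> R" "x * \<alpha> + y * \<beta> = 1" and k: "k \<le> 4"
  shows "gen2 (Q ^ k) \<alpha> \<diamondop> gen2 Q \<alpha> = gen2 (Q ^ Suc k) \<alpha>"
proof
  note Qk = integers_power[OF Q]
  have F: "fractional_ideal K (gen2 (Q ^ k) \<alpha>)" for k by (rule fractional_ideal_gen2[OF Qk \<alpha>])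
  have F1: "fractional_ideal K (gen2 Q \<alpha>)" by (rule fractional_ideal_gen2[OF Q \<alpha>])
  note FP = fractional_idealD[OF fractional_ideal_prod[OF F F1]]
  show "gen2 (Q ^ k) \<alpha> \<diamondop> gen2 Q \<alpha> \<subseteq> gen2 (Q ^ Suc k) \<alpha>"
  proof
    fix z assume "z \<in> gen2 (Q ^ k) \<alpha> \<diamondop> gen2 Q \<alpha>"
    then show "z \<in> gen2 (Q ^ Suc k) \<alpha>"
    proof (induction rule: prod_induct)
      case (mult i j)
      obtain p q where i: "i = p * Q ^ k + q * \<alpha>" "p \<in> R" "q \<in> R" using mult(1) by (rule gen2E)
      obtain r s where j: "j = r * Q + s * \<alpha>" "r \<in> R" "s \<in> R" using mult(2) by (rule gen2E)
      note * = i j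
      have "i * j = (p * r) * Q ^ Suc k + (p * Q ^ k * s + q * (r * Q + s * \<alpha>)) * \<alpha>"
        by (simp add: * algebra_simps)
      moreover have "p * r \<in> R" "p * Q ^ k * s + q * (r * Q + s * \<alpha>) \<in> R"
        by (intro integers_add integers_mult * Q Qk \<alpha>)+
      ultimately show ?case by (simp only: gen2I)
    qed (rule fractional_idealD(4)[OF F])
  qed
  have 1: "Q ^ Suc k \<in> gen2 (Q ^ k) \<alpha> \<diamondop> gen2 Q \<alpha>"
    using prod_memI[OF gen2_gens(1)[of "Q ^ k" \<alpha>] gen2_gens(1)[of Q \<alpha>]] by (simp add: mult.commute)
  have 2: "\<alpha> * \<alpha> \<in> gen2 (Q ^ k) \<alpha> \<diamondop> gen2 Q \<alpha>" by (rule prod_memI[OF gen2_gens(2) gen2_gens(2)])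
  have "Q ^ 5 = Q ^ (4 - k) * Q ^ Suc k" using k by (simp flip: power_add power_Suc)
  \<comment> \<open>Comaximality recovers \<open>\<alpha>\<close> itself from
    \<open>\<alpha> * \<alpha>\<close> and \<open>\<alpha> * \<beta> = Q ^ 5\<close>, a multiple of
    \<open>Q ^ Suc k\<close>; this is where \<open>k \<le> 4\<close> enters.\<close>
  moreover have "\<alpha> * 1 = x * (\<alpha> * \<alpha>) + y * (\<alpha> * \<beta>)" unfolding xy(3)[symmetric] by (simp add: algebra_simps)
  ultimately have "\<alpha> = x * (\<alpha> * \<alpha>) + (y * Q ^ (4 - k)) * Q ^ Suc k"
    unfolding \<beta> by (simp only: mult.assoc mult_1_right)
  moreover have "x * (\<alpha> * \<alpha>) + (y * Q ^ (4 - k)) * Q ^ Suc k \<in> gen2 (Q ^ k) \<alpha> \<diamondop> gen2 Q \<alpha>"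
    by (intro FP(4) FP(5) integers_mult xy Qk 1 2)
  ultimately have 3: "\<alpha> \<in> gen2 (Q ^ k) \<alpha> \<diamondop> gen2 Q \<alpha>" by simp
  show "gen2 (Q ^ Suc k) \<alpha> \<subseteq> gen2 (Q ^ k) \<alpha> \<diamondop> gen2 Q \<alpha>"
    unfolding gen2_def[of "Q ^ Suc k"] using FP(4) FP(5) 1 3 by blast
qed

text \<open>After five factors the ideal is
  \<open>(Q^5, \<alpha>) = (\<alpha> \<beta>, \<alpha>) = (\<alpha>)\<close>.\<close>

lemma gen2_power_five:
  assumes Q: "Q \<in> R" and \<alpha>: "\<alpha> \<in> R" "\<alpha> \<noteq> 0" and \<beta>: "\<beta> \<in> R" "\<alpha> * \<beta> = Q ^ 5"
    and xy: "x \<in> R" "y \<in> R" "x * \<alpha> + y * \<beta> = 1"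
  shows "gen2 Q \<alpha> [^]\<^bsub>G\<^esub> (5::nat) = (*) \<alpha> ` R"
proof -
  interpret G: comm_monoid G by (rule comm_monoid_G)
  have F1: "fractional_ideal K (gen2 Q \<alpha>)" by (rule fractional_ideal_gen2[OF Q \<alpha>])
  have step: "gen2 Q \<alpha> [^]\<^bsub>G\<^esub> Suc k = gen2 (Q ^ Suc k) \<alpha>" if "k \<le> 4" for k using that
  proof (induction k)
    case 0
    show ?case using G.nat_pow_eone[of "gen2 Q \<alpha>"] F1 by simp
  next
    case (Suc k)
    have "gen2 Q \<alpha> [^]\<^bsub>G\<^esub> Suc (Suc k) = gen2 (Q ^ Suc k) \<alpha> \<diamondop> gen2 Q \<alpha>"
      using Suc G.nat_pow_Suc[of "gen2 Q \<alpha>" "Suc k"] by (simp del: nat_pow_Suc)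
    also have "\<dots> = gen2 (Q ^ Suc (Suc k)) \<alpha>"
      by (rule gen2_prod_step[OF Q \<alpha> \<beta>(2) xy]) (use Suc in simp)
    finally show ?case .
  qed
  have "gen2 Q \<alpha> [^]\<^bsub>G\<^esub> (5::nat) = gen2 (Q ^ 5) \<alpha>" using step[of 4] by (simp add: eval_nat_numeral)
  also have "\<dots> = (*) \<alpha> ` R"
  proof
    show "gen2 (Q ^ 5) \<alpha> \<subseteq> (*) \<alpha> ` R"
    proof
      fix z assume "z \<in> gen2 (Q ^ 5) \<alpha>"
      then obtain p q where "z = p * (\<alpha> * \<beta>) + q * \<alpha>" "p \<in> R" "q \<in> R" by (auto simp: gen2_def \<beta>(2))
      then have "z = \<alpha> * (p * \<beta> + q)" "p * \<beta> + q \<in> R" using \<beta>(1) by (auto simp: algebra_simps intro: integers_add integers_mult)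
      then show "z \<in> (*) \<alpha> ` R" by blast
    qed
    show "(*) \<alpha> ` R \<subseteq> gen2 (Q ^ 5) \<alpha>"
      using gen2I[OF zero_R, of _ "Q ^ 5" \<alpha>] by (auto simp: mult.commute)
  qed
  finally show ?thesis .
qed

lemma fractional_ideal_pow: "fractional_ideal K I \<Longrightarrow> fractional_ideal K (I [^]\<^bsub>G\<^esub> (n::nat))"
  using monoid.nat_pow_closed[OF comm_monoid.axioms(1)[OF comm_monoid_G], of I n] by simp

lemma cl_pow: "fractional_ideal K I \<Longrightarrow> cl I [^]\<^bsub>class_group K\<^esub> (n::nat) = cl (I [^]\<^bsub>G\<^esub> n)"
proof (induction n)
  case 0
  then show ?case by (simp add: class_group_simps)
next
  case (Suc n)
  then show ?case by (simp add: class_group_mult fractional_ideal_pow)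
qed

lemma principal_mult: "x \<in> K - {0} \<Longrightarrow> y \<in> K - {0} \<Longrightarrow> ((*) x ` R) \<diamondop> ((*) y ` R) = (*) (x * y) ` R"
  using principal_prod[OF fractional_ideal_principal[of y], of x] by (simp add: image_image mult.assoc)

lemma K_power: "x \<in> K \<Longrightarrow> x ^ n \<in> K"
  by (induction n) (auto intro: K_closed)

lemma principal_pow: "x \<in> K - {0} \<Longrightarrow> ((*) x ` R) [^]\<^bsub>G\<^esub> (n::nat) = (*) (x ^ n) ` R"
proof (induction n)
  case (Suc n)
  have "x ^ n \<in> K" using Suc.prems K_power by blast
  then show ?case using Suc principal_mult[of "x ^ n" x] by (simp add: mult.commute)
qed (simp add: image_def)

lemma pow_subset_R: "I \<subseteq> R \<Longrightarrow> I [^]\<^bsub>G\<^esub> (n::nat) \<subseteq> R"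
proof (induction n)
  case (Suc n)
  have "x \<in> R" if "x \<in> (I [^]\<^bsub>G\<^esub> n) \<diamondop> I" for x
    using that by (induction rule: prod_induct) (use Suc in \<open>auto intro: integers_mult integers_add\<close>)
  then show ?case by auto
qed simp

lemma prod_subset_R: "I \<subseteq> R \<Longrightarrow> J \<subseteq> R \<Longrightarrow> I \<diamondop> J \<subseteq> R"
proof
  fix x assume "I \<subseteq> R" "J \<subseteq> R" "x \<in> I \<diamondop> J"
  from this(3) this(1,2) show "x \<in> R"
    by (induction rule: prod_induct) (auto intro: integers_mult integers_add)
qed

text \<open>A relation says that \<open>I^i J^j\<close> is generated by some
  \<open>\<gamma>\<close>. Its fifth power is then generated both by \<open>\<gamma>^5\<close> and
  by \<open>\<alpha>^i \<beta>^j\<close>, so these differ by a unit. As the ideals are integral,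
  \<open>\<gamma>\<close> is an integer.\<close>

lemma relation_of_classes:
  assumes I: "fractional_ideal K I" "I \<subseteq> R" "I [^]\<^bsub>G\<^esub> (5::nat) = (*) \<alpha> ` R" "\<alpha> \<in> R - {0}"
    and J: "fractional_ideal K J" "J \<subseteq> R" "J [^]\<^bsub>G\<^esub> (5::nat) = (*) \<beta> ` R" "\<beta> \<in> R - {0}"
    and rel: "cl I [^]\<^bsub>class_group K\<^esub> (i::nat) \<otimes>\<^bsub>class_group K\<^esub> cl J [^]\<^bsub>class_group K\<^esub> (j::nat) = \<one>\<^bsub>class_group K\<^esub>"
  shows "\<exists>\<gamma>\<in>R. \<exists>\<epsilon>\<in>R. \<exists>\<delta>\<in>R. \<epsilon> * \<delta> = 1 \<and> \<alpha> ^ i * \<beta> ^ j = \<epsilon> * \<gamma> ^ 5"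
proof -
  interpret G: comm_monoid G by (rule comm_monoid_G)
  have RK: "x \<in> K - {0}" if "x \<in> R - {0}" for x using that R_subset_K by auto
  let ?L = "(I [^]\<^bsub>G\<^esub> i) \<diamondop> (J [^]\<^bsub>G\<^esub> j)"
  have L: "fractional_ideal K ?L" by (intro fractional_ideal_prod fractional_ideal_pow I J)
  have "cl R = cl ?L"
    using rel by (simp add: cl_pow[OF I(1)] cl_pow[OF J(1)] class_group_mult fractional_ideal_pow I(1) J(1) class_group_simps)
  then obtain \<gamma> where \<gamma>: "\<gamma> \<in> K - {0}" "?L = (*) \<gamma> ` R" unfolding cl_eq_iff[OF fractional_ideal_R L] by blast
  have "\<gamma> * 1 \<in> ?L" unfolding \<gamma>(2) using one_R by blast
  then have \<gamma>R: "\<gamma> \<in> R" using prod_subset_R[OF pow_subset_R[OF I(2)] pow_subset_R[OF J(2)]] by auto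
  have "?L [^]\<^bsub>G\<^esub> (5::nat) = (I [^]\<^bsub>G\<^esub> i) [^]\<^bsub>G\<^esub> (5::nat) \<otimes>\<^bsub>G\<^esub> (J [^]\<^bsub>G\<^esub> j) [^]\<^bsub>G\<^esub> (5::nat)"
    using G.pow_mult_distrib[of "I [^]\<^bsub>G\<^esub> i" "J [^]\<^bsub>G\<^esub> j" 5] fractional_ideal_pow I(1) J(1) G.m_comm by simp
  also have "\<dots> = (I [^]\<^bsub>G\<^esub> (5::nat)) [^]\<^bsub>G\<^esub> i \<otimes>\<^bsub>G\<^esub> (J [^]\<^bsub>G\<^esub> (5::nat)) [^]\<^bsub>G\<^esub> j"
    using I(1) J(1) by (simp add: G.nat_pow_pow mult.commute)
  also have "\<dots> = (*) (\<alpha> ^ i * \<beta> ^ j) ` R"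
  proof -
    have pw: "x ^ n \<in> K - {0}" if "x \<in> R - {0}" for x n using RK[of "x ^ n"] that integers_power by auto
    show ?thesis unfolding I(3) J(3)
      using principal_pow[OF RK[OF I(4)], of i] principal_pow[OF RK[OF J(4)], of j]
        principal_mult[OF pw[OF I(4)] pw[OF J(4)], of i j] by simp
  qed
  finally have e: "(*) (\<gamma> ^ 5) ` R = (*) (\<alpha> ^ i * \<beta> ^ j) ` R" unfolding \<gamma>(2) principal_pow[OF \<gamma>(1)] .
  have "\<alpha> ^ i * \<beta> ^ j * 1 \<in> (*) (\<gamma> ^ 5) ` R" unfolding e using one_R by blast
  then obtain \<epsilon> where \<epsilon>: "\<epsilon> \<in> R" "\<alpha> ^ i * \<beta> ^ j = \<gamma> ^ 5 * \<epsilon>" by auto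
  have "\<gamma> ^ 5 * 1 \<in> (*) (\<alpha> ^ i * \<beta> ^ j) ` R" unfolding e[symmetric] using one_R by blast
  then obtain \<delta> where \<delta>: "\<delta> \<in> R" "\<gamma> ^ 5 = \<alpha> ^ i * \<beta> ^ j * \<delta>" by auto
  have "\<gamma> ^ 5 * (\<epsilon> * \<delta>) = \<gamma> ^ 5 * 1" 
    by (simp only: mult.assoc[symmetric] \<epsilon>(2)[symmetric] \<delta>(2)[symmetric] mult_1_right)
  then have "\<epsilon> * \<delta> = 1" using \<gamma>(1) by simp
  moreover have "\<alpha> ^ i * \<beta> ^ j = \<epsilon> * \<gamma> ^ 5" using \<epsilon>(2) by (simp only: mult.commute)
  ultimately show ?thesis using \<gamma>R \<epsilon>(1) \<delta>(1) by blast
qed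

end

text \<open>The congruences on \<open>u\<close> and \<open>v\<close> make the sextic value 2 modulo
  4, so only this case arises: the integers are spanned by 1 and \<open>sqrt_neg D\<close>, and the
  discriminant is \<open>- 4D\<close>.\<close>

locale even_quadratic =
  fixes D :: nat
  assumes D_mod_4: "D mod 4 = 2" and D_squarefree: "squarefree D"
begin

lemma D_pos: "D > 0" and D_ge_2: "D \<ge> 2"
  using D_mod_4 by (cases "D = 0"; cases "D = 1"; simp)+

lemma int_gen_D: "int_gen D = sqrt_neg D"
  using D_mod_4 by (simp add: int_gen_def)

lemma integers_D: "integers_of (quadratic_field D) = int_span D"
  unfolding integers_of_quadratic_field[OF D_pos D_squarefree] int_span_def int_gen_D by (simp add: qelt_def)

lemma discriminant_D: "field_discriminant (quadratic_field D) = - 4 * int D"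
  using field_discriminant_quadratic_field[OF D_pos D_squarefree] D_mod_4 by simp

sublocale integer_ring "quadratic_field D"
proof (rule integer_ring.intro)
  show "subfield (quadratic_field D) complex_ring" by (rule subfield_quadratic_field[OF D_pos])
  fix x assume "x \<in> quadratic_field D"
  then obtain c where "c > 0" and cx: "of_int c * x \<in> int_span D"
    by (rule quadratic_field_denominator)
  then have "of_int c \<in> int_span D - {0}" using int_span_closed(5)[of c D] by auto
  with cx show "\<exists>d\<in>integers_of (quadratic_field D) - {0}. d * x \<in> integers_of (quadratic_field D)"
    unfolding integers_D by blast
qed (auto simp: integers_D int_span_closed)

lemma R_cases:
  assumes "x \<in> R" obtains a b where "x = qelt D (of_int a) (of_int b)"
  using assms unfolding integers_D int_span_def by blast

lemma R_memI: "qelt D (of_int a) (of_int b) \<in> R"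
  unfolding integers_D by (rule int_spanI)

lemma cmod_qelt: "(cmod (qelt D (of_int a) (of_int b)))\<^sup>2 = of_int (a\<^sup>2 + int D * b\<^sup>2)"
  by (simp add: cmod_power2 power_mult_distrib)

lemma R_units:
  assumes "x \<in> R" "y \<in> R" "x * y = 1"
  shows "x = 1 \<or> x = - 1"
proof -
  obtain a b where x: "x = qelt D (of_int a) (of_int b)" using assms(1) by (rule R_cases)
  obtain c d where y: "y = qelt D (of_int c) (of_int d)" using assms(2) by (rule R_cases)
  have "(cmod x)\<^sup>2 * (cmod y)\<^sup>2 = 1" using arg_cong[OF assms(3), of cmod] by (simp add: norm_mult flip: power_mult_distrib)
  then have "real_of_int ((a\<^sup>2 + int D * b\<^sup>2) * (c\<^sup>2 + int D * d\<^sup>2)) = real_of_int 1"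
    unfolding x y cmod_qelt by simp
  then have "(a\<^sup>2 + int D * b\<^sup>2) * (c\<^sup>2 + int D * d\<^sup>2) = 1" by (simp only: of_int_eq_iff)
  then have "a\<^sup>2 + int D * b\<^sup>2 = 1" by (smt (verit) zmult_eq_1_iff zero_le_power2 mult_nonneg_nonneg of_nat_0_le_iff)
  moreover have "b = 0"
  proof (rule ccontr)
    assume "b \<noteq> 0"
    then have "1 \<le> b\<^sup>2" by (simp add: int_one_le_iff_zero_less)
    then have "2 * 1 \<le> int D * b\<^sup>2" using D_ge_2 by (intro mult_mono) auto
    then show False using calculation zero_le_power2[of a] by linarith
  qed
  ultimately have "a = 1 \<or> a = - 1" "b = 0" by (auto simp: power2_eq_1_iff)
  then show ?thesis unfolding x by auto
qed

text \<open>A substitute for division with remainder. Dirichlet's theorem approximates both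
  coordinates of \<open>\<alpha> / \<beta>\<close> to within \<open>1 / N\<close> with a common
  denominator \<open>q \<le> N^2\<close>; the choice \<open>N > 1 + sqrt D\<close> makes the
  remainder smaller than the divisor.\<close>

lemma approximation:
  "\<exists>M>0. \<forall>\<alpha> \<beta>. \<beta> \<noteq> 0 \<longrightarrow> (\<exists>q>0. q \<le> M \<and> (\<exists>\<gamma>\<in>R. cmod (of_int q * \<alpha> - \<gamma> * \<beta>) < cmod \<beta>))"
proof -
  obtain N :: nat where N: "real N > 1 + sqrt D" using reals_Archimedean2 by blast
  have s0: "sqrt D > 0" using D_pos by simp
  have "real N > 0" using N s0 by linarith
  then have N0: "N > 0" by simp
  have "\<exists>q>0. q \<le> int (N ^ 2) \<and> (\<exists>\<gamma>\<in>R. cmod (of_int q * \<alpha> - \<gamma> * \<beta>) < cmod \<beta>)" if \<beta>: "\<beta> \<noteq> 0" for \<alpha> \<beta>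
  proof -
    define z where "z = \<alpha> / \<beta>"
    define \<theta> :: "nat \<Rightarrow> real" where "\<theta> i = (if i = 0 then Re z else Im z / sqrt D)" for i
    obtain q p where qp: "0 < q" "q \<le> int (N ^ 2)" "\<And>i. i < 2 \<Longrightarrow> \<bar>of_int q * \<theta> i - of_int (p i)\<bar> < 1 / N"
      using Dirichlet_approx_simult[OF N0, of 2 \<theta>] by blast
    define \<gamma> where "\<gamma> = qelt D (of_int (p 0)) (of_int (p 1))"
    have "Re (of_int q * z - \<gamma>) = of_int q * \<theta> 0 - of_int (p 0)" by (simp add: \<gamma>_def \<theta>_def)
    then have re: "\<bar>Re (of_int q * z - \<gamma>)\<bar> < 1 / N" using qp(3)[of 0] by simp
    have "Im (of_int q * z - \<gamma>) = (of_int q * \<theta> 1 - of_int (p 1)) * sqrt D"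
      using s0 by (simp add: \<gamma>_def \<theta>_def algebra_simps)
    then have "\<bar>Im (of_int q * z - \<gamma>)\<bar> = \<bar>of_int q * \<theta> 1 - of_int (p 1)\<bar> * sqrt D" by (simp add: abs_mult)
    also have "\<dots> < 1 / N * sqrt D" using qp(3)[of 1] s0 by (intro mult_strict_right_mono) auto
    finally have im: "\<bar>Im (of_int q * z - \<gamma>)\<bar> < 1 / N * sqrt D" .
    have "cmod (of_int q * z - \<gamma>) \<le> \<bar>Re (of_int q * z - \<gamma>)\<bar> + \<bar>Im (of_int q * z - \<gamma>)\<bar>" by (rule cmod_le)
    also have "\<dots> < 1 / N + 1 / N * sqrt D" using re im by linarith
    also have "\<dots> = (1 + sqrt D) / N" by (simp add: add_divide_distrib)
    also have "\<dots> \<le> 1" using N N0 by (simp add: divide_le_eq)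
    finally have "cmod (of_int q * z - \<gamma>) < 1" .
    then have "cmod (of_int q * z - \<gamma>) * cmod \<beta> < 1 * cmod \<beta>" using \<beta> by (intro mult_strict_right_mono) auto
    moreover have "(of_int q * z - \<gamma>) * \<beta> = of_int q * \<alpha> - \<gamma> * \<beta>" using \<beta> by (simp add: z_def algebra_simps)
    ultimately have "cmod (of_int q * \<alpha> - \<gamma> * \<beta>) < cmod \<beta>" by (simp flip: norm_mult)
    moreover have "\<gamma> \<in> R" unfolding \<gamma>_def by (rule R_memI)
    ultimately show ?thesis using qp by blast
  qed
  moreover have "int (N ^ 2) > 0" using N0 by simp
  ultimately show ?thesis by blast
qed

text \<open>An ideal containing \<open>M\<close> is a union of classes modulo \<open>M\<close>,
  hence determined by its elements with coordinates in \<open>[0, M)\<close>.\<close>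

lemma finite_ideals_containing:
  assumes M: "M > 0"
  shows "finite {J. fractional_ideal (quadratic_field D) J \<and> J \<subseteq> R \<and> of_int M \<in> J}" (is "finite ?S")
proof -
  define Box where "Box = (\<lambda>(a, b). qelt D (of_int a) (of_int b)) ` ({0..<M} \<times> {0..<M})"
  have fB: "finite Box" unfolding Box_def by simp
  have sub: "J \<subseteq> J'" if J: "J \<in> ?S" and J': "J' \<in> ?S" and eq: "J \<inter> Box = J' \<inter> Box" for J J'
  proof
    fix x assume x: "x \<in> J"
    have xR: "x \<in> R" using x J by blast
    obtain a b where ab: "x = qelt D (of_int a) (of_int b)" using xR by (rule R_cases)
    define r where "r = qelt D (of_int (a div M)) (of_int (b div M))"
    define x' where "x' = qelt D (of_int (a mod M)) (of_int (b mod M))"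
    have rR: "r \<in> R" "- r \<in> R" unfolding r_def by (auto intro: R_memI integers_minus)
    have "x = x' + of_int M * r"
      unfolding ab x'_def r_def of_int_mult_qelt qelt_add by (simp flip: of_int_mult of_int_add)
    then have xx: "x = x' + r * of_int M" "x' = x + (- r) * of_int M" by (simp_all add: mult.commute)
    note F = fractional_idealD(4,5)[of J] fractional_idealD(4,5)[of J']
    have "x' \<in> J" unfolding xx(2) using J x rR F by blast
    moreover have "x' \<in> Box" unfolding Box_def x'_def using M by force
    ultimately have "x' \<in> J'" using eq by blast
    then show "x \<in> J'" unfolding xx(1) using J' rR F by blast
  qed
  have "inj_on (\<lambda>J. J \<inter> Box) ?S"
  proof (rule inj_onI)
    fix J J' assume "J \<in> ?S" "J' \<in> ?S" "J \<inter> Box = J' \<inter> Box"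
    then show "J = J'" using sub[of J J'] sub[of J' J] by (intro subset_antisym) simp_all
  qed
  moreover have "(\<lambda>J. J \<inter> Box) ` ?S \<subseteq> Pow Box" by blast
  ultimately show ?thesis using fB by (meson finite_Pow_iff finite_imageD finite_subset)
qed

text \<open>After scaling by an element of minimal norm, every class is represented by an integral ideal
  containing a fixed integer.\<close>

lemma finite_class_group: "finite (carrier (class_group (quadratic_field D)))"
proof -
  let ?K = "quadratic_field D"
  obtain M where M: "M > 0" and approx: "\<And>\<alpha> \<beta>. \<beta> \<noteq> 0 \<Longrightarrow> \<exists>q>0. q \<le> M \<and> (\<exists>\<gamma>\<in>R. cmod (of_int q * \<alpha> - \<gamma> * \<beta>) < cmod \<beta>)"
    using approximation by blast
  \<comment> \<open>The factorial is divisible by every denominator \<open>q \<le> M\<close>, so one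
    integer serves all elements of the ideal at once.\<close>
  define F :: int where "F = fact (nat M)"
  have F0: "F > 0" by (simp add: F_def)
  let ?S = "{J. fractional_ideal ?K J \<and> J \<subseteq> R \<and> of_int F \<in> J}"
  have "cl I \<in> cl ` ?S" if I: "fractional_ideal ?K I" for I
  proof -
    note FI = fractional_idealD[OF I]
    obtain d where d: "d \<in> R - {0}" "\<forall>x\<in>I. d * x \<in> R" using FI(6) by blast
    have dK: "d \<in> ?K - {0}" using d R_subset_K by blast
    define I1 where "I1 = (*) d ` I"
    have I1: "fractional_ideal ?K I1" unfolding I1_def by (rule fractional_ideal_scale[OF I dK])
    note F1 = fractional_idealD[OF I1]
    have I1R: "I1 \<subseteq> R" using d by (auto simp: I1_def)
    define nrm where "nrm x = nat \<lfloor>(cmod x)\<^sup>2\<rfloor>" for x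
    have nrm: "real (nrm x) = (cmod x)\<^sup>2" if "x \<in> R" for x
    proof -
      obtain a b where "x = qelt D (of_int a) (of_int b)" using \<open>x \<in> R\<close> by (rule R_cases)
      then have "(cmod x)\<^sup>2 = of_int (a\<^sup>2 + int D * b\<^sup>2)" by (simp only: cmod_qelt)
      moreover have "a\<^sup>2 + int D * b\<^sup>2 \<ge> 0" by simp
      ultimately show ?thesis unfolding nrm_def by (simp only: floor_of_int of_nat_nat)
    qed
    obtain \<beta> where \<beta>: "\<beta> \<in> I1" "\<beta> \<noteq> 0" "\<And>x. x \<in> I1 \<Longrightarrow> x \<noteq> 0 \<Longrightarrow> nrm \<beta> \<le> nrm x"
      using ex_has_least_nat[of "\<lambda>x. x \<in> I1 \<and> x \<noteq> 0" _ nrm] F1(7) by blast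
    have small: "x = 0" if "x \<in> I1" "cmod x < cmod \<beta>" for x
    proof (rule ccontr)
      assume "x \<noteq> 0"
      then have "real (nrm \<beta>) \<le> real (nrm x)" using \<beta>(3) that by simp
      then have "(cmod \<beta>)\<^sup>2 \<le> (cmod x)\<^sup>2"
        unfolding nrm[OF subsetD[OF I1R \<beta>(1)]] nrm[OF subsetD[OF I1R that(1)]] .
      moreover have "(cmod x)\<^sup>2 < (cmod \<beta>)\<^sup>2" using that(2) by (intro power_strict_mono) auto
      ultimately show False by linarith
    qed
    have div: "\<exists>\<gamma>\<in>R. of_int F * \<alpha> = \<gamma> * \<beta>" if \<alpha>: "\<alpha> \<in> I1" for \<alpha>
    proof -
      obtain q \<gamma> where q: "q > 0" "q \<le> M" "\<gamma> \<in> R" "cmod (of_int q * \<alpha> - \<gamma> * \<beta>) < cmod \<beta>"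
        using approx[OF \<beta>(2), of \<alpha>] by blast
      have "of_int q * \<alpha> + (- \<gamma>) * \<beta> \<in> I1"
        by (intro F1(4) F1(5) \<alpha> \<beta>(1) integers_minus q(3) of_int_R)
      then have "of_int q * \<alpha> - \<gamma> * \<beta> = 0" using q(4) by (intro small) simp_all
      then have z: "of_int q * \<alpha> = \<gamma> * \<beta>" by simp
      have "nat q dvd fact (nat M)" using q by (intro dvd_fact) auto
      then have "int (nat q) dvd int (fact (nat M))" by (simp only: int_dvd_int_iff)
      then have "q dvd F" using q(1) by (simp add: F_def)
      then obtain k where "F = q * k" by blast
      then have "of_int F * \<alpha> = (of_int k * \<gamma>) * \<beta>" using z by (simp add: mult_ac)
      then show ?thesis using integers_mult[OF of_int_R q(3)] by blast
    qed
    \<comment> \<open>Every \<open>F * \<alpha>\<close> with \<open>\<alpha>\<close> in the ideal is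
      a multiple of the minimal element \<open>\<beta>\<close>, so scaling by
      \<open>F / \<beta>\<close> keeps the ideal integral and takes \<open>\<beta>\<close> to
      \<open>F\<close>.\<close>
    define c where "c = of_int F / \<beta>"
    have \<beta>K: "\<beta> \<in> ?K" using \<beta>(1) F1(1) by blast
    have cK: "c \<in> ?K - {0}"
      unfolding c_def divide_inverse using \<beta>(2) \<beta>K F0 K_closed(3)[OF subsetD[OF R_subset_K of_int_R] K_closed(6)] by auto
    define J where "J = (*) c ` I1"
    have J: "fractional_ideal ?K J" unfolding J_def by (rule fractional_ideal_scale[OF I1 cK])
    have "J \<subseteq> R"
    proof
      fix x assume "x \<in> J"
      then obtain \<alpha> where \<alpha>: "\<alpha> \<in> I1" "x = c * \<alpha>" by (auto simp: J_def)
      obtain \<gamma> where "\<gamma> \<in> R" "of_int F * \<alpha> = \<gamma> * \<beta>" using div[OF \<alpha>(1)] by blast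
      then show "x \<in> R" using \<beta>(2) by (simp add: \<alpha>(2) c_def)
    qed
    moreover have "c * \<beta> \<in> J" unfolding J_def using \<beta>(1) by blast
    then have "of_int F \<in> J" using \<beta>(2) by (simp add: c_def)
    moreover have "cl I = cl J"
    proof -
      have "cl I = cl I1" unfolding cl_eq_iff[OF I I1] using dK by (auto simp: I1_def)
      also have "\<dots> = cl J" unfolding cl_eq_iff[OF I1 J] using cK by (auto simp: J_def)
      finally show ?thesis .
    qed
    ultimately show ?thesis using J by blast
  qed
  then have "carrier (class_group ?K) \<subseteq> cl ` ?S" unfolding class_group_simps by blast
  then show ?thesis using finite_ideals_containing[OF F0] by (meson finite_imageI finite_subset)
qed

end

section \<open>Two independent classes of order five\<close>

text \<open>On the elliptic curve \<open>E: Y\<^sup>2 = 4x\<^sup>3 - 4bx\<^sup>2 + ((1 - b)x - b)\<^sup>2\<close> the point with \<open>x = 0\<close> has order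
  five, and \<open>((b - 3)x\<^sup>2 + (2b - 1)x + b)\<^sup>2 - (x + 1)\<^sup>2 Y\<^sup>2 = - 4x\<^sup>5\<close>. For \<open>b = - 5/48\<close> there is also
  a rational point of order two, \<open>x = - 1/9\<close>, and the substitution
  \<open>x = - (304(u\<^sup>2 + v\<^sup>2) + 697v\<^sup>2) / (6273v\<^sup>2)\<close> makes \<open>v\<^sup>6 Y\<^sup>2\<close> symmetric in \<open>u\<close> and \<open>v\<close>. After
  clearing denominators this is the identity below.\<close>

definition elt_re :: "int \<Rightarrow> int \<Rightarrow> int" where
  "elt_re n v = v * (v ^ 4 - 2128 * n * v\<^sup>2 + 430312 * n\<^sup>2)"

definition elt_im :: "int \<Rightarrow> int \<Rightarrow> int" where
  "elt_im n v = 76 * (v\<^sup>2 - 38 * n)"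

text \<open>With \<open>u^2 + v^2 = 697 n\<close> the substitution reads
  \<open>x = - (v^2 + 304 n) / (9 v^2)\<close>. So this is \<open>- 9 v^2 x\<close>, while
  \<open>elt_im\<close> is a constant times \<open>v^2 (x + 1)\<close> and \<open>elt_re\<close> a
  constant times \<open>v^5\<close> times the quadratic polynomial in \<open>x\<close>.\<close>

definition elt_root :: "int \<Rightarrow> int \<Rightarrow> int" where
  "elt_root n v = v\<^sup>2 + 304 * n"

text \<open>After \<open>w^2\<close> is replaced by \<open>697 n - V\<close> with
  \<open>V = v^2\<close>, an identity of homogeneous polynomials of degree five in \<open>V\<close>
  and \<open>n\<close>. It is stated for \<open>w\<close> so that it applies to
  \<open>(u, v)\<close> and to \<open>(v, u)\<close>.\<close>

lemma norm_identity:
  assumes "w\<^sup>2 + v\<^sup>2 = 697 * n"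
  shows "(elt_re n v)\<^sup>2 + (elt_im n v)\<^sup>2 * (n * (311296 * n\<^sup>2 - (w * v)\<^sup>2)) = elt_root n v ^ 5"
proof -
  define V where "V = v\<^sup>2"
  have w: "w\<^sup>2 = 697 * n - V" using assms by (simp add: V_def)
  have "v ^ 4 = V * V" by (simp add: V_def flip: power_add)
  then have "(elt_re n v)\<^sup>2 = V * (V * V - 2128 * n * V + 430312 * (n * n)) * (V * V - 2128 * n * V + 430312 * (n * n))"
    unfolding elt_re_def power_mult_distrib V_def[symmetric] by (simp add: power2_eq_square mult.assoc)
  moreover have "(elt_im n v)\<^sup>2 = 5776 * ((V - 38 * n) * (V - 38 * n))"
    unfolding elt_im_def power_mult_distrib V_def[symmetric] by (simp add: power2_eq_square)
  moreover have "n * (311296 * n\<^sup>2 - (w * v)\<^sup>2) = n * (311296 * (n * n) - (697 * n - V) * V)"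
    unfolding power_mult_distrib w by (simp add: V_def power2_eq_square)
  moreover have "elt_root n v ^ 5 = (V + 304 * n) * (V + 304 * n) * (V + 304 * n) * (V + 304 * n) * (V + 304 * n)"
    by (simp add: elt_root_def V_def eval_nat_numeral)
  moreover have "V * (V * V - 2128 * n * V + 430312 * (n * n)) * (V * V - 2128 * n * V + 430312 * (n * n))
     + 5776 * ((V - 38 * n) * (V - 38 * n)) * (n * (311296 * (n * n) - (697 * n - V) * V))
     = (V + 304 * n) * (V + 304 * n) * (V + 304 * n) * (V + 304 * n) * (V + 304 * n)"
    by (simp add: algebra_simps)
  ultimately show ?thesis by (simp only:)
qed

text \<open>The number \<open>2 * elt_re n v\<close> is the trace of the element to be constructed,
  so this coprimality makes the element and its conjugate comaximal. Apart from 2, 3, 5 and 19, the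
  primes of 570, a common prime would divide \<open>n\<close>, \<open>v\<close> and finally
  \<open>w\<close>.\<close>

lemma coprime_trace_root:
  assumes wv: "w\<^sup>2 + v\<^sup>2 = 697 * n" "coprime w v" and c: "coprime (elt_root n v) 570"
  shows "coprime (2 * elt_re n v) (elt_root n v)"
proof (rule ccontr)
  let ?Q = "elt_root n v"
  assume "\<not> ?thesis"
  then have "gcd (2 * elt_re n v) ?Q \<noteq> 1" by (simp add: coprime_iff_gcd_eq_1)
  then have "\<bar>gcd (2 * elt_re n v) ?Q\<bar> \<noteq> 1" by simp
  then obtain p where "prime p" "p dvd gcd (2 * elt_re n v) ?Q" using prime_factor_int by blast
  then have p: "prime p" "p dvd 2 * elt_re n v" "p dvd ?Q" by simp_all
  have np: "\<not> p dvd 570" using c p by (metis coprime_common_divisor not_prime_unit)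
  have *: "\<not> p dvd d" if "d dvd 570 ^ k" for d k using np p(1) that by (meson dvd_trans prime_dvd_power)
  have n2: "\<not> p dvd 2" "\<not> p dvd 304" "\<not> p dvd 1169640"
    by (rule *[of _ 1], simp, rule *[of _ 4], simp, rule *[of _ 4], simp)
  have "p dvd elt_re n v" using p n2 by (simp add: prime_dvd_mult_iff)
  \<comment> \<open>Division by the root with remainder; the constant
    \<open>1169640 = 2^3 * 3^4 * 5 * 19^2\<close> divides \<open>570^4\<close>.\<close>
  moreover have "elt_re n v = v * (?Q * (v\<^sup>2 - 2432 * n)) + 1169640 * (v * n\<^sup>2)"
    by (simp add: elt_re_def elt_root_def power2_eq_square eval_nat_numeral algebra_simps)
  ultimately have "p dvd 1169640 * (v * n\<^sup>2)"
    using p(3) by (metis dvd_add_right_iff dvd_mult dvd_mult2)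
  then have "p dvd v \<or> p dvd n" using n2 p(1) by (meson prime_dvd_mult_iff prime_dvd_power)
  moreover have "p dvd n" if "p dvd v"
  proof -
    have "p dvd ?Q - v\<^sup>2" using p(3) that by (intro dvd_diff) (auto simp: power2_eq_square)
    then have "p dvd 304 * n" by (simp add: elt_root_def)
    then show ?thesis using n2 p(1) by (simp add: prime_dvd_mult_iff)
  qed
  moreover have "p dvd v" if "p dvd n"
  proof -
    have "p dvd ?Q - 304 * n" using p(3) that by (intro dvd_diff) auto
    then show ?thesis using p(1) by (simp add: elt_root_def prime_dvd_power_iff)
  qed
  ultimately have pv: "p dvd v" "p dvd n" by blast+
  then have "p dvd 697 * n - v\<^sup>2" by (intro dvd_diff) (auto simp: power2_eq_square)
  then have "p dvd w\<^sup>2" unfolding wv(1)[symmetric] by simp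
  then have "p dvd w" using p(1) by (simp add: prime_dvd_power_iff)
  then show False using pv(1) wv(2) p(1) by (metis coprime_common_divisor not_prime_unit)
qed

section \<open>Residue obstruction to being a fifth power\<close>

context even_quadratic
begin

text \<open>Reduction modulo the prime ideal \<open>(p, sqrt_neg D - t)\<close>, as a relation.\<close>

definition residue :: "int \<Rightarrow> int \<Rightarrow> complex \<Rightarrow> int \<Rightarrow> bool" where
  "residue p t x m \<longleftrightarrow> (\<exists>a b. x = qelt D (of_int a) (of_int b) \<and> [a + b * t = m] (mod p))"

lemma residue_mult:
  assumes t: "[t\<^sup>2 = - int D] (mod p)" and "residue p t x m" "residue p t y n"
  shows "residue p t (x * y) (m * n)"
proof -
  obtain a b c d where x: "x = qelt D (of_int a) (of_int b)" "[a + b * t = m] (mod p)"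
    and y: "y = qelt D (of_int c) (of_int d)" "[c + d * t = n] (mod p)"
    using assms(2,3) unfolding residue_def by blast
  have "x * y = qelt D (of_int (a * c - int D * (b * d))) (of_int (a * d + b * c))"
    by (simp add: x y qelt_mult)
  moreover have "[(a * c - int D * (b * d)) + (a * d + b * c) * t = m * n] (mod p)"
  proof -
    have "[(a * c - int D * (b * d)) + (a * d + b * c) * t = (a * c + t\<^sup>2 * (b * d)) + (a * d + b * c) * t] (mod p)"
      using cong_sym[OF t] cong_mult[OF cong_sym[OF t] cong_refl[of "b * d"]]
      by (intro cong_add cong_refl) (simp add: cong_add_lcancel diff_conv_add_uminus del: add_uminus_conv_diff)
    also have "(a * c + t\<^sup>2 * (b * d)) + (a * d + b * c) * t = (a + b * t) * (c + d * t)"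
      by (simp add: power2_eq_square algebra_simps)
    also have "[\<dots> = m * n] (mod p)" by (intro cong_mult x y)
    finally show ?thesis .
  qed
  ultimately show ?thesis unfolding residue_def by blast
qed

lemma residue_of_int: "residue p t (of_int n) n"
  unfolding residue_def by (rule exI[of _ n], rule exI[of _ 0]) simp

lemma residue_power:
  "[t\<^sup>2 = - int D] (mod p) \<Longrightarrow> residue p t x m \<Longrightarrow> residue p t (x ^ k) (m ^ k)"
  using residue_of_int[of p t 1] by (induction k) (auto intro: residue_mult)

lemma residue_unique:
  assumes "residue p t x m" "residue p t x n"
  shows "[m = n] (mod p)"
  using assms D_pos unfolding residue_def by (auto intro: cong_trans cong_sym)

lemma residue_exists:
  assumes "x \<in> R" shows "\<exists>m. residue p t x m"
proof -
  obtain a b where "x = qelt D (of_int a) (of_int b)" using assms by (rule R_cases)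
  then show ?thesis unfolding residue_def using cong_refl by blast
qed

text \<open>Raising to the power \<open>(p - 1) / 5\<close> turns the residue of
  \<open>\<gamma>^5\<close> into 1 by Fermat. As \<open>p\<close> is 1 modulo 10 this exponent is
  even, so the sign of the unit disappears too.\<close>

lemma fifth_power_residue:
  assumes p: "prime p" "p mod 10 = 1" and t: "[t\<^sup>2 = - int D] (mod int p)"
    and \<alpha>: "residue (int p) t \<alpha> m" and \<beta>: "residue (int p) t \<beta> n"
    and \<gamma>: "\<gamma> \<in> R" and \<epsilon>: "\<epsilon> = 1 \<or> \<epsilon> = - 1" and eq: "\<alpha> ^ i * \<beta> ^ j = \<epsilon> * \<gamma> ^ 5"
    and mn: "\<not> int p dvd m" "\<not> int p dvd n"
  shows "[(m ^ i * n ^ j) ^ ((p - 1) div 5) = 1] (mod int p)"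
proof -
  obtain g where g: "residue (int p) t \<gamma> g" using residue_exists[OF \<gamma>] by blast
  obtain s :: int where s: "s = 1 \<or> s = - 1" "\<epsilon> = of_int s" using \<epsilon> by (metis of_int_1 of_int_minus)
  have "residue (int p) t (\<alpha> ^ i * \<beta> ^ j) (m ^ i * n ^ j)" by (intro residue_mult residue_power t \<alpha> \<beta>)
  moreover have "residue (int p) t (\<epsilon> * \<gamma> ^ 5) (s * g ^ 5)" unfolding s(2) by (intro residue_mult residue_power t g residue_of_int)
  ultimately have c: "[m ^ i * n ^ j = s * g ^ 5] (mod int p)" unfolding eq by (rule residue_unique)
  have pp: "prime (int p)" using p by simp
  have "\<not> int p dvd m ^ i * n ^ j" using mn pp by (meson prime_dvd_mult_iff prime_dvd_power)
  then have "\<not> int p dvd s * g ^ 5" using c cong_dvd_iff by blast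
  then have ng: "\<not> int p dvd g" by (metis dvd_mult dvd_power dvd_trans zero_less_numeral)
  define k where "k = (p - 1) div 5"
  have k: "5 * k = p - 1" "even k"
    using p(2) unfolding k_def by presburger+
  have "[(m ^ i * n ^ j) ^ k = (s * g ^ 5) ^ k] (mod int p)" by (rule cong_pow[OF c])
  also have "(s * g ^ 5) ^ k = s ^ k * g ^ (p - 1)" by (simp add: power_mult_distrib k(1) flip: power_mult)
  also have "s ^ k = 1" using s(1) k(2) by auto
  also have "[1 * g ^ (p - 1) = 1] (mod int p)"
  proof -
    define h where "h = nat (g mod int p)"
    have ih: "int h = g mod int p" using p by (simp add: h_def prime_gt_0_nat)
    have hg: "[int h = g] (mod int p)" by (simp add: ih unique_euclidean_semiring_class.cong_def)
    then have "\<not> int p dvd int h" using ng cong_dvd_iff by blast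
    then have "\<not> p dvd h" by (metis int_dvd_int_iff)
    then have "[h ^ (p - 1) = 1] (mod p)" by (rule fermat_theorem[OF p(1)])
    then have "[int (h ^ (p - 1)) = int 1] (mod int p)" by (simp only: cong_int_iff)
    then have "[g ^ (p - 1) = 1] (mod int p)"
      using cong_trans[OF cong_sym[OF cong_pow[OF hg, of "p - 1"]]] by simp
    then show ?thesis by simp
  qed
  finally show ?thesis by (simp add: k_def)
qed

end

section \<open>The two classes and their independence\<close>

context even_quadratic
begin

text \<open>The element and its conjugate have product \<open>Q^5\<close> and sum \<open>2a\<close>,
  so a Bezout relation between \<open>2a\<close> and \<open>Q^5\<close> becomes one between the two
  elements.\<close>

lemma ideal_class_of_norm_identity:
  fixes a c Q :: int and s :: nat
  assumes id: "a\<^sup>2 + c\<^sup>2 * int (D * s\<^sup>2) = Q ^ 5" and cop: "coprime (2 * a) Q" and Q: "Q \<noteq> 0"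
  defines "\<alpha> \<equiv> qelt D (of_int a) (of_int (c * int s))"
  shows "\<alpha> \<in> R - {0}" "fractional_ideal (quadratic_field D) (gen2 (of_int Q) \<alpha>)" "gen2 (of_int Q) \<alpha> \<subseteq> R"
    "gen2 (of_int Q) \<alpha> [^]\<^bsub>G\<^esub> (5::nat) = (*) \<alpha> ` R"
proof -
  define \<beta> where "\<beta> = qelt D (of_int a) (of_int (- (c * int s)))"
  have \<alpha>R: "\<alpha> \<in> R" and \<beta>R: "\<beta> \<in> R" unfolding \<alpha>_def \<beta>_def by (rule R_memI)+
  have "a * a - int D * (c * int s * (- (c * int s))) = Q ^ 5"
    unfolding id[symmetric] by (simp add: power2_eq_square algebra_simps)
  then have "of_int a * of_int a - of_nat D * (of_int (c * int s) * of_int (- (c * int s))) = (of_int (Q ^ 5) :: rat)"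
    by (metis of_int_diff of_int_mult of_int_of_nat_eq)
  then have prod: "\<alpha> * \<beta> = of_int Q ^ 5"
    unfolding \<alpha>_def \<beta>_def qelt_mult by (simp add: mult.commute of_rat_power)
  have sum: "\<alpha> + \<beta> = of_int (2 * a)"
    unfolding \<alpha>_def \<beta>_def qelt_add by (simp add: of_rat_add of_rat_mult)
  have \<alpha>0: "\<alpha> \<noteq> 0" using prod Q by auto
  then show "\<alpha> \<in> R - {0}" using \<alpha>R by simp
  have QR: "of_int Q \<in> R" by (rule of_int_R)
  show "fractional_ideal (quadratic_field D) (gen2 (of_int Q) \<alpha>)" by (rule fractional_ideal_gen2[OF QR \<alpha>R \<alpha>0])
  show "gen2 (of_int Q) \<alpha> \<subseteq> R" by (rule gen2_subset[OF QR \<alpha>R])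
  have "coprime (2 * a) (Q ^ 5)" using cop by simp
  then obtain x y where "x * (2 * a) + y * Q ^ 5 = 1" using bezout_int[of "2 * a" "Q ^ 5"] by (auto simp: coprime_iff_gcd_eq_1)
  then have "(of_int (x * (2 * a) + y * Q ^ 5) :: complex) = 1" by simp
  then have "of_int x * (\<alpha> + \<beta>) + of_int y * (\<alpha> * \<beta>) = 1" unfolding sum prod by simp
  then have "of_int x * \<alpha> + (of_int x + of_int y * \<alpha>) * \<beta> = 1" by (simp add: algebra_simps)
  moreover have "of_int x + of_int y * \<alpha> \<in> R" by (intro integers_add integers_mult of_int_R \<alpha>R)
  ultimately show "gen2 (of_int Q) \<alpha> [^]\<^bsub>G\<^esub> (5::nat) = (*) \<alpha> ` R"
    using gen2_power_five[OF QR \<alpha>R \<alpha>0 \<beta>R prod of_int_R] by blast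
qed

end

lemma elt_cong:
  assumes "[n = n'] (mod m)" "[v = v'] (mod m)"
  shows "[elt_re n v + elt_im n v * w = elt_re n' v' + elt_im n' v' * w] (mod m)" "[elt_root n v = elt_root n' v'] (mod m)"
  unfolding elt_re_def elt_im_def elt_root_def
  by (intro cong_add cong_mult cong_diff cong_pow cong_refl assms)+

lemma rank_of_admissible:
  assumes P: "P \<in> admissible_box T"
  defines "D \<equiv> squarefree_part (nat (sextic_at P))"
  shows "D mod 4 = 2" "squarefree D" "rk 5 (class_group (quadratic_field D)) \<ge> 2"
proof -
  obtain u v where uv: "P = (u, v)" by (cases P)
  have adm: "admissible u v" using P uv by (auto simp: admissible_box_def)
  define e where "e = nat (sextic u v)"
  define n where "n = red_norm u v"
  have e: "int e = sextic u v" using sextic_at_pos[OF P] by (simp add: e_def uv)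
  have De: "D = squarefree_part e" by (simp add: D_def e_def uv)
  define s where "s = square_part e"
  have eD: "e = D * s\<^sup>2" unfolding De s_def by (rule squarefree_decompose)
  show sf: "squarefree D" by (simp add: De)
  have "\<not> 4 dvd int e" "2 dvd int e" unfolding e using admissible_sextic_dvd(1,2)[OF adm] by simp_all
  then have e4: "\<not> 4 dvd e" "2 dvd e" by presburger+
  have "odd s"
  proof
    assume "even s"
    then have "2\<^sup>2 dvd s\<^sup>2" by (rule dvd_power_same)
    then show False using e4(1) eD by simp
  qed
  then have "even D" using e4(2) eD by simp
  moreover have "\<not> 4 dvd D" using e4(1) eD by auto
  ultimately show D4: "D mod 4 = 2" by presburger
  interpret even_quadratic D by unfold_locales (rule D4, rule sf)
  have nuv: "u\<^sup>2 + v\<^sup>2 = 697 * n" using admissible_red_norm(1)[OF adm] by (simp add: n_def)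
  have nvu: "v\<^sup>2 + u\<^sup>2 = 697 * n" using nuv by simp
  have n0: "n > 0" using admissible_box_bounds(3)[of u v T] P uv by (simp add: n_def)
  have ie: "int (D * s\<^sup>2) = n * (311296 * n\<^sup>2 - (u * v)\<^sup>2)" using e unfolding eD sextic_def n_def .
  have ie': "int (D * s\<^sup>2) = n * (311296 * n\<^sup>2 - (v * u)\<^sup>2)" unfolding ie by (simp only: mult.commute[of u v])
  note mods = admissible_mod[OF adm, folded n_def]
  have cop: "coprime u v" using adm by (simp add: admissible_def)
  \<comment> \<open>The modulus of admissibility contains 570, so both roots have fixed residues
    modulo 570, namely 83 and 277, which are units there.\<close>
  have root: "coprime (elt_root n w) 570" if "[w = w'] (mod 570)" "[elt_root 110482 w' = r] (mod 570)" "coprime r 570" for w w' r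
  proof -
    have "[elt_root n w = r] (mod 570)" using elt_cong(2)[OF mods(3)[of 570] that(1)] that(2) by (auto intro: cong_trans)
    then show ?thesis using that(3) cong_imp_coprime cong_sym by blast
  qed
  have r1: "coprime (elt_root n v) 570"
  proof (rule root[OF mods(2)])
    show "[elt_root 110482 2915 = 83] (mod 570)" by (simp add: elt_root_def unique_euclidean_semiring_class.cong_def)
    show "coprime 83 (570::int)"
    proof (rule coprimeI)
      fix c :: int assume "c dvd 83" "c dvd 570"
      then have "c dvd 467 * 83 - 68 * 570" by (intro dvd_diff dvd_mult)
      then show "c dvd 1" by simp
    qed
  qed simp
  have r2: "coprime (elt_root n u) 570"
  proof (rule root[OF mods(1)])
    show "[elt_root 110482 8277 = 277] (mod 570)" by (simp add: elt_root_def unique_euclidean_semiring_class.cong_def)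
    show "coprime 277 (570::int)"
    proof (rule coprimeI)
      fix c :: int assume "c dvd 277" "c dvd 570"
      then have "c dvd 463 * 277 - 225 * 570" by (intro dvd_diff dvd_mult)
      then show "c dvd 1" by simp
    qed
  qed simp
  have pos: "elt_root n w \<noteq> 0" for w using n0 zero_le_power2[of w] unfolding elt_root_def by linarith
  let ?\<alpha> = "qelt D (of_int (elt_re n v)) (of_int (elt_im n v * int s))"
  let ?\<beta> = "qelt D (of_int (elt_re n u)) (of_int (elt_im n u * int s))"
  let ?I = "gen2 (of_int (elt_root n v)) ?\<alpha>" and ?J = "gen2 (of_int (elt_root n u)) ?\<beta>"
  note I = ideal_class_of_norm_identity[OF norm_identity[OF nuv, folded ie] coprime_trace_root[OF nuv cop r1] pos]
  note J = ideal_class_of_norm_identity[OF norm_identity[OF nvu, folded ie'] coprime_trace_root[OF nvu coprime_commute[THEN iffD1, OF cop] r2] pos]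
  \<comment> \<open>Take \<open>t = w / s\<close> modulo \<open>p\<close>, where
    \<open>w^2 = - F = - D s^2\<close>. Then \<open>t\<close> is a square root of
    \<open>- D\<close>, and \<open>s * sqrt_neg D\<close> reduces to \<open>w\<close>, so the
    residues of both elements depend only on fixed data although \<open>D\<close> and
    \<open>s\<close> vary.\<close>
  have res: "\<exists>t. [t\<^sup>2 = - int D] (mod int p) \<and>
      (\<forall>z z' m. [z = z'] (mod int p) \<longrightarrow> [elt_re 110482 z' + elt_im 110482 z' * w = m] (mod int p) \<longrightarrow>
        residue (int p) t (qelt D (of_int (elt_re n z)) (of_int (elt_im n z * int s))) m)"
    if p: "prime p" "int p dvd 270951780" "[w\<^sup>2 = - 17276038] (mod int p)" "\<not> int p dvd 17276038" for p w
  proof -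
    have E: "[int (D * s\<^sup>2) = 17276038] (mod int p)" using mods(4)[OF p(2)] e eD by simp
    have "\<not> int p dvd int (D * s\<^sup>2)" using E p(4) cong_dvd_iff by blast
    then have "\<not> int p dvd int s" by (auto simp: power2_eq_square)
    then have "coprime (int s) (int p)" using p(1) by (metis coprime_commute prime_imp_coprime prime_nat_int_transfer)
    then obtain s' where s': "[int s * s' = 1] (mod int p)" using cong_solve_coprime_int by blast
    define t where "t = w * s'"
    have st: "[int s * t = w] (mod int p)"
      using cong_mult[OF s' cong_refl[of w]] by (simp add: t_def mult_ac)
    have "[t\<^sup>2 = w\<^sup>2 * s'\<^sup>2] (mod int p)" by (simp add: t_def power_mult_distrib)
    also have "[w\<^sup>2 * s'\<^sup>2 = - 17276038 * s'\<^sup>2] (mod int p)" by (intro cong_mult p(3) cong_refl)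
    also have "[- 17276038 * s'\<^sup>2 = - int (D * s\<^sup>2) * s'\<^sup>2] (mod int p)"
      using E by (intro cong_mult cong_refl) (simp add: cong_minus_minus_iff cong_sym)
    also have "- int (D * s\<^sup>2) * s'\<^sup>2 = - int D * (int s * s')\<^sup>2" by (simp add: power_mult_distrib)
    also have "[- int D * (int s * s')\<^sup>2 = - int D * 1\<^sup>2] (mod int p)" by (intro cong_mult cong_pow s' cong_refl)
    finally have t: "[t\<^sup>2 = - int D] (mod int p)" by simp
    have "residue (int p) t (qelt D (of_int (elt_re n z)) (of_int (elt_im n z * int s))) m"
      if z: "[z = z'] (mod int p)" "[elt_re 110482 z' + elt_im 110482 z' * w = m] (mod int p)" for z z' m
    proof -
      have "[elt_re n z + elt_im n z * int s * t = elt_re n z + elt_im n z * w] (mod int p)"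
        using st by (simp only: mult.assoc) (intro cong_add cong_mult cong_refl)
      also have "[elt_re n z + elt_im n z * w = elt_re 110482 z' + elt_im 110482 z' * w] (mod int p)"
        by (rule elt_cong(1)[OF mods(3)[OF p(2)] z(1)])
      also note z(2)
      finally show ?thesis unfolding residue_def by blast
    qed
    then show ?thesis using t by blast
  qed
  show "rk 5 (class_group (quadratic_field D)) \<ge> 2"
  proof (rule rk_ge_2[where a = "cl ?I" and b = "cl ?J"])
    show "comm_monoid (class_group (quadratic_field D))" by (rule comm_monoid_class_group)
    show "finite (carrier (class_group (quadratic_field D)))" by (rule finite_class_group)
    show "cl ?I \<in> carrier (class_group (quadratic_field D))" "cl ?J \<in> carrier (class_group (quadratic_field D))"
      unfolding class_group_simps using I(2) J(2) by blast+
    have pr: "cl ((*) x ` R) = cl R" if "x \<in> R - {0}" for x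
    proof -
      have x: "x \<in> quadratic_field D - {0}" using that R_subset_K by blast
      have "\<exists>y\<in>quadratic_field D - {0}. (*) x ` R = (*) y ` R" using x by blast
      then show ?thesis using cl_eq_iff[OF fractional_ideal_R fractional_ideal_principal[OF x]] by simp
    qed
    show "cl ?I [^]\<^bsub>class_group (quadratic_field D)\<^esub> (5::nat) = \<one>\<^bsub>class_group (quadratic_field D)\<^esub>"
      unfolding cl_pow[OF I(2)] I(4) class_group_simps by (rule pr[OF I(1)])
    show "cl ?J [^]\<^bsub>class_group (quadratic_field D)\<^esub> (5::nat) = \<one>\<^bsub>class_group (quadratic_field D)\<^esub>"
      unfolding cl_pow[OF J(2)] J(4) class_group_simps by (rule pr[OF J(1)])
    fix i j :: nat
    assume ij: "i < 5" "j < 5" and rel: "cl ?I [^]\<^bsub>class_group (quadratic_field D)\<^esub> i \<otimes>\<^bsub>class_group (quadratic_field D)\<^esub>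
      cl ?J [^]\<^bsub>class_group (quadratic_field D)\<^esub> j = \<one>\<^bsub>class_group (quadratic_field D)\<^esub>"
    obtain \<gamma> \<epsilon> \<delta> where g: "\<gamma> \<in> R" "\<epsilon> \<in> R" "\<delta> \<in> R" "\<epsilon> * \<delta> = 1" "?\<alpha> ^ i * ?\<beta> ^ j = \<epsilon> * \<gamma> ^ 5"
      using relation_of_classes[OF I(2,3,4,1) J(2,3,4,1) rel] by blast
    have \<epsilon>: "\<epsilon> = 1 \<or> \<epsilon> = - 1" by (rule R_units[OF g(2,3,4)])
    have num: "i \<in> {0, 1, 2, 3, 4}" "j \<in> {0, 1, 2, 3, 4}" using ij by auto
    \<comment> \<open>Modulo 11, with 10 as a square root of \<open>- F\<close>, the first element
      reduces to \<open>10 = - 1\<close> and drops out on squaring. The second reduces to 4, and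
      \<open>4^2 = 5\<close> has order five modulo 11.\<close>
    have j0: "j = 0"
    proof -
      have p: "prime (11::nat)" by simp
      obtain t where t: "[t\<^sup>2 = - int D] (mod int 11)"
        "\<And>z z' m. [z = z'] (mod int 11) \<Longrightarrow> [elt_re 110482 z' + elt_im 110482 z' * 10 = m] (mod int 11) \<Longrightarrow>
          residue (int 11) t (qelt D (of_int (elt_re n z)) (of_int (elt_im n z * int s))) m"
        using res[OF p, of 10] by (auto simp: unique_euclidean_semiring_class.cong_def)
      have "residue (int 11) t ?\<alpha> 10"
        by (rule t(2)[of _ 2915]) (use mods(2)[of 11] in \<open>simp_all add: elt_re_def elt_im_def unique_euclidean_semiring_class.cong_def\<close>)
      moreover have "residue (int 11) t ?\<beta> 4"
        by (rule t(2)[of _ 8277]) (use mods(1)[of 11] in \<open>simp_all add: elt_re_def elt_im_def unique_euclidean_semiring_class.cong_def\<close>)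
      ultimately have "[(10 ^ i * 4 ^ j) ^ ((11 - 1) div 5) = 1] (mod int 11)"
        by (intro fifth_power_residue[OF p _ t(1) _ _ g(1) \<epsilon> g(5)]) simp_all
      then show ?thesis using num by (auto simp: unique_euclidean_semiring_class.cong_def)
    qed
    \<comment> \<open>Modulo 31, with 13 as a square root of \<open>- F\<close>, the first element
      reduces to 16. The exponent is 6, and \<open>16^6 = 16\<close> modulo 31 has order
      five.\<close>
    have "i = 0"
    proof -
      have p: "prime (31::nat)" by simp
      obtain t where t: "[t\<^sup>2 = - int D] (mod int 31)"
        "\<And>z z' m. [z = z'] (mod int 31) \<Longrightarrow> [elt_re 110482 z' + elt_im 110482 z' * 13 = m] (mod int 31) \<Longrightarrow>
          residue (int 31) t (qelt D (of_int (elt_re n z)) (of_int (elt_im n z * int s))) m"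
        using res[OF p, of 13] by (auto simp: unique_euclidean_semiring_class.cong_def)
      have "residue (int 31) t ?\<alpha> 16"
        by (rule t(2)[of _ 2915]) (use mods(2)[of 31] in \<open>simp_all add: elt_re_def elt_im_def unique_euclidean_semiring_class.cong_def\<close>)
      moreover have "residue (int 31) t ?\<beta> 6"
        by (rule t(2)[of _ 8277]) (use mods(1)[of 31] in \<open>simp_all add: elt_re_def elt_im_def unique_euclidean_semiring_class.cong_def\<close>)
      ultimately have "[(16 ^ i * 6 ^ j) ^ ((31 - 1) div 5) = 1] (mod int 31)"
        by (intro fifth_power_residue[OF p _ t(1) _ _ g(1) \<epsilon> g(5)]) simp_all
      then show ?thesis using num(1) by (auto simp: j0 unique_euclidean_semiring_class.cong_def)
    qed
    then show "i = 0 \<and> j = 0" using j0 by simp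
  qed
qed

section \<open>Counting the fields\<close>

theorem theorem1p3:
  shows "\<exists>c > 0. \<forall>\<^sub>F x in at_top.
           real (N_minus 5 2 x) \<ge> c * (x powr (1 / 3) / (ln x)\<^sup>2)"
proof -
  obtain J c where J: "J > 0" and c: "c > 0" and
    ev: "eventually (\<lambda>y::nat. real (card ((\<lambda>P. squarefree_part (nat (sextic_at P))) ` admissible_box (y ^ J)))
       \<ge> c * real (y ^ J) ^ 2) sequentially"
    by (rule card_squarefree_parts)
  \<comment> \<open>The discriminants are at most \<open>4T^6\<close> in absolute value, so
    \<open>T\<close> should be near \<open>(x / 4) powr (1 / 6)\<close>; since \<open>T\<close> has
    to be a \<open>J\<close>-th power, its \<open>J\<close>-th root is rounded down to an
    integer.\<close>
  define z where "z x = (x / 4) powr (1 / (6 * real J))" for x :: real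
  define y where "y x = nat \<lfloor>z x\<rfloor>" for x
  have zlim: "filterlim z at_top at_top"
    unfolding z_def using J by real_asymp
  have ylim: "filterlim y sequentially at_top"
    unfolding y_def by (rule filterlim_compose[OF filterlim_nat_sequentially filterlim_compose[OF filterlim_floor_sequentially zlim]])
  \<comment> \<open>Rounding loses at most a factor 2 in \<open>y\<close>, hence
    \<open>4 ^ J\<close> in \<open>T^2 = y^(2J)\<close>; the other factor comes from
    \<open>x / 4\<close>.\<close>
  define C where "C = c / (4 ^ J * 4 powr (1 / 3))"
  have "eventually (\<lambda>x. real (N_minus 5 2 x) \<ge> C * (x powr (1 / 3) / (ln x)\<^sup>2)) at_top"
    using eventually_compose_filterlim[OF ev ylim] eventually_ge_at_top[of "4 :: real"]
      filterlim_at_top[THEN iffD1, OF zlim, rule_format, of 1]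
  proof eventually_elim
    case (elim x)
    define T where "T = y x ^ J"
    let ?f = "\<lambda>P. squarefree_part (nat (sextic_at P))"
    let ?S = "{K. imaginary_quadratic_field K \<and> real_of_int (abs (field_discriminant K)) \<le> x \<and>
              rk 5 (class_group K) \<ge> 2}"
    have x0: "x / 4 > 0" using elim by simp
    have z1: "z x \<ge> 1" using elim by simp
    have f1: "1 \<le> \<lfloor>z x\<rfloor>" using z1 by (simp add: le_floor_iff)
    then have "real (y x) = real_of_int \<lfloor>z x\<rfloor>" by (simp add: y_def)
    then have yz: "real (y x) \<le> z x" "z x / 2 \<le> real (y x)" using f1 by linarith+
    have zpow: "z x ^ (6 * J) = x / 4"
    proof -
      have "z x ^ (6 * J) = (x / 4) powr (1 / (6 * real J) * real (6 * J))"
        using x0 by (simp add: z_def powr_powr flip: powr_realpow)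
      then show ?thesis using J x0 by simp
    qed
    have "real T ^ 6 = real (y x) ^ (6 * J)" by (simp add: T_def mult.commute flip: power_mult)
    also have "\<dots> \<le> z x ^ (6 * J)" using yz by (intro power_mono) auto
    finally have T6: "real T ^ 6 \<le> x / 4" unfolding zpow .
    have "quadratic_field (?f P) \<in> ?S" if P: "P \<in> admissible_box T" for P
    proof -
      let ?D = "?f P"
      note r = rank_of_admissible[OF P]
      interpret even_quadratic ?D by unfold_locales (rule r(1), rule r(2))
      have pos: "nat (sextic_at P) > 0" using sextic_at_pos[OF P] by simp
      have "?D dvd nat (sextic_at P)" by (metis squarefree_decompose dvd_triv_left)
      then have "?D \<le> nat (sextic_at P)" using pos by (rule dvd_imp_le)
      also have "\<dots> \<le> T ^ 6" using admissible_box_bounds(2)[of "fst P" "snd P" T] P by (simp add: nat_le_iff)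
      finally have "real ?D \<le> real (T ^ 6)" by (rule of_nat_mono)
      then have "real ?D \<le> real T ^ 6" by (simp only: of_nat_power)
      moreover have "real_of_int \<bar>field_discriminant (quadratic_field ?D)\<bar> = 4 * real ?D"
        unfolding discriminant_D by simp
      ultimately have "real_of_int \<bar>field_discriminant (quadratic_field ?D)\<bar> \<le> x" using T6 by linarith
      then show "quadratic_field ?D \<in> ?S"
        using imaginary_quadratic_quadratic_field[OF D_pos] r(3) by simp
    qed
    then have "quadratic_field ` ?f ` admissible_box T \<subseteq> ?S" by (intro image_subsetI) (elim imageE, simp only:)
    moreover have "finite ?S" by (rule finite_subset[OF _ finite_imaginary_quadratic_fields[of x]]) auto
    ultimately have "card (quadratic_field ` ?f ` admissible_box T) \<le> N_minus 5 2 x"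
      unfolding N_minus_def by (intro card_mono)
    moreover have "inj_on quadratic_field (?f ` admissible_box T)"
    proof (rule inj_onI)
      fix D D' assume D: "D \<in> ?f ` admissible_box T" and D': "D' \<in> ?f ` admissible_box T"
        and eq: "quadratic_field D = quadratic_field D'"
      interpret A: even_quadratic D by unfold_locales (use D rank_of_admissible(1,2) in blast)+
      interpret B: even_quadratic D' by unfold_locales (use D' rank_of_admissible(1,2) in blast)+
      have "- 4 * int D = field_discriminant (quadratic_field D)" by (rule A.discriminant_D[symmetric])
      also have "\<dots> = field_discriminant (quadratic_field D')" by (simp only: eq)
      also have "\<dots> = - 4 * int D'" by (rule B.discriminant_D)
      finally show "D = D'" by simp
    qed
    ultimately have "real (card (?f ` admissible_box T)) \<le> real (N_minus 5 2 x)" by (simp add: card_image)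
    moreover have "c * real T ^ 2 \<le> real (card (?f ` admissible_box T))" using elim(1) by (simp add: T_def)
    moreover have "C * (x powr (1 / 3) / (ln x)\<^sup>2) \<le> c * real T ^ 2"
    proof -
      \<comment> \<open>Since \<open>x \<ge> 4\<close> exceeds \<open>exp 1\<close>, division by the
        squared logarithm only makes the bound smaller.\<close>
      have ln1: "1 \<le> ln x"
      proof -
        have "exp 1 \<le> (3::real)" by (rule exp_le)
        then have "ln (exp 1) \<le> ln x" using elim by (subst ln_le_cancel_iff) auto
        then show ?thesis by simp
      qed
      then have "1 \<le> (ln x)\<^sup>2" by (simp add: one_le_power)
      then have "x powr (1 / 3) / (ln x)\<^sup>2 \<le> x powr (1 / 3)"
        using divide_left_mono[of 1 "(ln x)\<^sup>2" "x powr (1 / 3)"] ln1 by simp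
      then have "C * (x powr (1 / 3) / (ln x)\<^sup>2) \<le> C * x powr (1 / 3)"
        using c by (intro mult_left_mono) (auto simp: C_def)
      also have "\<dots> = c * ((x / 4) powr (1 / 3) / 4 ^ J)"
        using x0 by (simp add: C_def powr_divide)
      also have "(x / 4) powr (1 / 3) / 4 ^ J = (z x / 2) ^ (2 * J)"
      proof -
        have "(x / 4) powr (1 / 3) = z x ^ (2 * J)"
          using x0 J by (simp add: z_def powr_powr flip: powr_realpow)
        then show ?thesis by (simp add: power_divide power_mult)
      qed
      also have "\<dots> \<le> real (y x) ^ (2 * J)" using yz z1 by (intro power_mono) auto
      also have "\<dots> = real T ^ 2" by (simp add: T_def mult.commute flip: power_mult)
      finally show ?thesis using c by simp
    qed
    ultimately show ?case by linarith
  qed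
  moreover have "C > 0" using c by (simp add: C_def)
  ultimately show ?thesis by blast
qed

end
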